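(* Let $\widetilde C_\Gamma=\Gamma\times I_r\times I_\theta$ be the resolved product collar, with $E=\{r=0\}$, $F_0=\{\theta=0\}$, $F_1=\{\theta=1\}$, and let $\mathcal I=\pi_E^*W_E$, $\mathcal P=R_Ej_E^*$, $\mathcal K=H_r+\pi_E^*\kappa_Ej_E^*$ (notation in the context). Then these maps form a special deformation retract $$\Omega^\bullet(\widetilde C_\Gamma)\ \rightleftarrows\ \Omega^\bullet(\Gamma)\otimes C^\bullet(I),$$ that is, $$d\mathcal K+\mathcal Kd=\mathrm{id}-\mathcal I\mathcal P,\qquad \mathcal P\mathcal I=\mathrm{id},\qquad \mathcal K^2=\mathcal K\mathcal I=\mathcal P\mathcal K=0.$$ Moreover $j_E^*\mathcal K=\kappa_Ej_E^*$, while on $F_0,F_1$ the restriction of $\mathcal K$ is the corresponding radial homotopy (the radial integration homotopy of $F_i$ applied to the restriction to $F_i$); and $\mathcal K$ vanishes (after restriction) at the two endpoint corners $E\cap F_0$ and $E\cap F_1$.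
   Context: $\Gamma$ is a smooth manifold (the blown-up codimension-two corner), $I_r$ is the radial interval with endpoint $r=0$, $I_\theta=[0,1]$ the angular interval. $j_E:E\hookrightarrow\widetilde C_\Gamma$ is inclusion, $\pi_E:\widetilde C_\Gamma\to E$ the projection forgetting $r$, $P_E=\pi_E^*j_E^*$. $H_r$ is the normalized radial integration homotopy (integration of the contraction with $\partial_r$ from $0$ to $r$), satisfying $dH_r+H_rd=\mathrm{id}-P_E$, $H_r^2=H_rP_E=P_EH_r=0$, $j_E^*H_r=0$. $C^\bullet(I)$ is the cellular cochain complex of $[0,1]$: basis $\epsilon_0,\epsilon_1$ (degree 0), $\epsilon_{01}$ (degree 1), $d\epsilon_0=-\epsilon_{01}$, $d\epsilon_1=\epsilon_{01}$. On forms on $[0,1]$: Whitney map $W(c_0\epsilon_0+c_1\epsilon_1+a\epsilon_{01})=(1-\theta)c_0+\theta c_1+a\,d\theta$; integration map $R(f+g\,d\theta)=\epsilon_0f(0)+\epsilon_1f(1)+\epsilon_{01}\int_0^1g$; Dupont homotopy $(\kappa\alpha)(\theta)=\int_0^\theta\iota_{\partial_u}\alpha(u)\,du-\theta\int_0^1\iota_{\partial_u}\alpha(u)\,du$. They satisfy $d\kappa+\kappa d=\mathrm{id}-WR$, $RW=\mathrm{id}$, $\kappa W=R\kappa=\kappa^2=0$. $(W_E,R_E,\kappa_E)$ denotes $(W,R,\kappa)$ in the angular direction tensored with the identity on $\Omega^\bullet(\Gamma)$ (with Koszul signs), i.e. the retract $\Omega^\bullet(E)\rightleftarrows\Omega^\bullet(\Gamma)\otimes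 C^\bullet(I)$ given by fibrewise operations along $I_\theta$. *)

theory Defs
  imports "HOL-Analysis.Analysis" "HOL-Library.Function_Algebras"
begin

text \<open>Pointwise scaling, so that differential forms (represented as functions below) live in
  a real vector space.\<close>

instantiation "fun" :: (type, real_vector) real_vector
begin
definition scaleR_fun :: "real \<Rightarrow> ('a \<Rightarrow> 'b) \<Rightarrow> 'a \<Rightarrow> 'b"
  where "scaleR_fun r f = (\<lambda>x. r *\<^sub>R f x)"
instance
  by standard (auto simp: scaleR_fun_def fun_eq_iff plus_fun_def algebra_simps)
end

section \<open>Smooth functions, atlases, manifolds\<close>

text \<open>Smoothness on sets with boundary and corners (an open set times intervals) is
  differentiability to all orders within the set, i.e. with one-sided derivatives at the
  boundary.  The domain type is meant to be finite-dimensional, where continuity of every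
  directional derivative is continuity of the derivative.\<close>

primrec Ck_on :: "nat \<Rightarrow> ('w::real_normed_vector \<Rightarrow> 'b::real_normed_vector) \<Rightarrow> 'w set \<Rightarrow> bool" where
  "Ck_on 0 f S \<longleftrightarrow> continuous_on S f"
| "Ck_on (Suc k) f S \<longleftrightarrow>
     (\<exists>f'. (\<forall>x\<in>S. (f has_derivative f' x) (at x within S)) \<and> (\<forall>v. Ck_on k (\<lambda>x. f' x v) S))"

definition smooth_on :: "('w::real_normed_vector \<Rightarrow> 'b::real_normed_vector) \<Rightarrow> 'w set \<Rightarrow> bool"
  where "smooth_on f S \<longleftrightarrow> (\<forall>k. Ck_on k f S)"

text \<open>A chart is a pair of its domain and its coordinate map, whose values outside the domain
  are irrelevant.\<close>

type_synonym ('m, 'w) chart = "'m set \<times> ('m \<Rightarrow> 'w)"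
type_synonym ('m, 'w) atlas = "('m, 'w) chart set"

definition coord_rep :: "('m, 'w) chart \<Rightarrow> ('n, 'x) chart \<Rightarrow> ('m \<Rightarrow> 'n) \<Rightarrow> 'w \<Rightarrow> 'x"
  where "coord_rep c c' f = snd c' \<circ> f \<circ> inv_into (fst c) (snd c)"

text \<open>The tangent map of \<open>f\<close> at \<open>q\<close> in the charts \<open>c\<close>, \<open>c'\<close>; for \<open>f = id\<close> this is the
  derivative of the change of coordinates.\<close>

definition tangent_map ::
    "('m, 'w::real_normed_vector) chart \<Rightarrow> ('n, 'x::real_normed_vector) chart \<Rightarrow> ('m \<Rightarrow> 'n) \<Rightarrow> 'm \<Rightarrow> 'w \<Rightarrow> 'x"
  where "tangent_map c c' f q =
    frechet_derivative (coord_rep c c' f) (at (snd c q) within snd c ` {y \<in> fst c. f y \<in> fst c'})"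

text \<open>Smooth manifolds without boundary.  The model space is a finite-dimensional normed
  space rather than a \<^class>\<open>euclidean_space\<close>, because the latter has positive dimension,
  whereas 0-dimensional manifolds are to be included.  Finite-dimensional normed spaces are
  complete, so the sort \<^class>\<open>banach\<close> used in the main statement is no restriction.\<close>

definition smooth_manifold :: "'a topology \<Rightarrow> ('a, 'e::real_normed_vector) atlas \<Rightarrow> bool"
  where "smooth_manifold \<Gamma> A \<longleftrightarrow>
    (\<exists>B::'e set. finite B \<and> span B = UNIV) \<and>
    Hausdorff_space \<Gamma> \<and> second_countable \<Gamma> \<and>
    (\<Union>c\<in>A. fst c) = topspace \<Gamma> \<and>
    (\<forall>c\<in>A. openin \<Gamma> (fst c) \<and> open (snd c ` fst c) \<and>
       homeomorphic_map (subtopology \<Gamma> (fst c)) (top_of_set (snd c ` fst c)) (snd c)) \<and>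
    (\<forall>c\<in>A. \<forall>c'\<in>A. smooth_on (coord_rep c c' id) (snd c ` (fst c \<inter> fst c')))"

definition prod_chart :: "'q set \<Rightarrow> ('m, 'w) chart \<Rightarrow> ('m \<times> 'q, 'w \<times> 'q) chart"
  where "prod_chart Q c = (fst c \<times> Q, map_prod (snd c) id)"

definition prod_atlas :: "('m, 'w) atlas \<Rightarrow> 'q set \<Rightarrow> ('m \<times> 'q, 'w \<times> 'q) atlas"
  where "prod_atlas A Q = prod_chart Q ` A"

section \<open>Differential forms\<close>

text \<open>A tangent vector at a point is given by its coordinates in a chart around that point, so a
  form assigns a number to a chart, a point of its domain and a list of coordinate vectors,
  compatibly with changes of chart.  Values at all other arguments are 0, which makes
  equality of forms equality of functions.\<close>

type_synonym ('m, 'w) form = "('m, 'w) chart \<Rightarrow> 'm \<Rightarrow> 'w list \<Rightarrow> real"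

definition alternating_multilinear :: "('w::real_vector list \<Rightarrow> real) \<Rightarrow> bool"
  where "alternating_multilinear g \<longleftrightarrow>
    (\<forall>us vs. linear (\<lambda>v. g (us @ v # vs))) \<and> (\<forall>vs. \<not> distinct vs \<longrightarrow> g vs = 0)"

definition Omega :: "('m, 'w::real_normed_vector) atlas \<Rightarrow> nat \<Rightarrow> ('m, 'w) form set"
  where "Omega A k = {\<omega>.
    (\<forall>c q vs. \<omega> c q vs \<noteq> 0 \<longrightarrow> c \<in> A \<and> q \<in> fst c \<and> length vs = k) \<and>
    (\<forall>c\<in>A. \<forall>q\<in>fst c. alternating_multilinear (\<omega> c q)) \<and>
    (\<forall>c\<in>A. \<forall>c'\<in>A. \<forall>q\<in>fst c \<inter> fst c'. \<forall>vs. \<omega> c q vs = \<omega> c' q (map (tangent_map c c' id q) vs)) \<and>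
    (\<forall>c\<in>A. \<forall>vs. smooth_on (\<lambda>x. \<omega> c (inv_into (fst c) (snd c) x) vs) (snd c ` fst c))}"

definition del_nth :: "nat \<Rightarrow> 'b list \<Rightarrow> 'b list"
  where "del_nth i xs = take i xs @ drop (Suc i) xs"

definition ext_deriv :: "('m, 'w::real_normed_vector) atlas \<Rightarrow> ('m, 'w) form \<Rightarrow> ('m, 'w) form"
  where "ext_deriv A \<omega> = (\<lambda>c q vs. if c \<in> A \<and> q \<in> fst c then
    (\<Sum>i<length vs. (- 1) ^ i *
       frechet_derivative (\<lambda>x. \<omega> c (inv_into (fst c) (snd c) x) (del_nth i vs))
         (at (snd c q) within snd c ` fst c) (vs ! i))
    else 0)"

text \<open>Pullback along \<open>f\<close>.  By the compatibility condition in \<^const>\<open>Omega\<close> the result does not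
  depend on the chart chosen around the image point.\<close>

definition pullback :: "('m, 'w::real_normed_vector) atlas \<Rightarrow> ('n, 'x::real_normed_vector) atlas \<Rightarrow>
    ('m \<Rightarrow> 'n) \<Rightarrow> ('n, 'x) form \<Rightarrow> ('m, 'w) form"
  where "pullback A A' f \<omega> = (\<lambda>c q vs. if c \<in> A \<and> q \<in> fst c then
    (let c' = (SOME c'. c' \<in> A' \<and> f q \<in> fst c') in \<omega> c' (f q) (map (tangent_map c c' f q) vs))
    else 0)"

text \<open>\<open>fmul f \<omega>\<close> is \<open>f \<omega>\<close>; \<open>wedge1 \<omega> l\<close> is \<open>\<omega> \<and> \<lambda>\<close> for the 1-form \<open>\<lambda>\<close> that is given in every
  chart by the functional \<open>l\<close>, with the convention
  \<open>(\<alpha> \<and> \<beta>)(u, v) = \<alpha>(u) \<beta>(v) - \<alpha>(v) \<beta>(u)\<close> for 1-forms.\<close>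

definition fmul :: "('m \<Rightarrow> real) \<Rightarrow> ('m, 'w) form \<Rightarrow> ('m, 'w) form"
  where "fmul f \<omega> = (\<lambda>c q vs. f q * \<omega> c q vs)"

definition wedge1 :: "('m, 'w) form \<Rightarrow> ('w \<Rightarrow> real) \<Rightarrow> ('m, 'w) form"
  where "wedge1 \<omega> l = (\<lambda>c q vs.
    \<Sum>i<length vs. (- 1) ^ (length vs - 1 - i) * \<omega> c q (del_nth i vs) * l (vs ! i))"

text \<open>Integral from 0 to \<open>b q\<close> of the contraction (in the first slot) with the constant coordinate
  field \<open>e\<close>, along the coordinate line \<open>s \<mapsto> line q s\<close> through \<open>q\<close>.  It is only used for products
  with intervals, where the line stays in the domain of the chart.\<close>

definition line_integral :: "('m, 'w) atlas \<Rightarrow> ('m \<Rightarrow> real \<Rightarrow> 'm) \<Rightarrow> 'w \<Rightarrow> ('m \<Rightarrow> real) \<Rightarrow>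
    ('m, 'w) form \<Rightarrow> ('m, 'w) form"
  where "line_integral A line e b \<omega> = (\<lambda>c q vs. if c \<in> A \<and> q \<in> fst c then
    integral {0..b q} (\<lambda>s. \<omega> c (line q s) (e # vs)) else 0)"

section \<open>Cellular cochains of the interval with values in forms\<close>

datatype cell = Eps0 | Eps1 | Eps01

fun cell_dim :: "cell \<Rightarrow> nat" where
  "cell_dim Eps0 = 0" | "cell_dim Eps1 = 0" | "cell_dim Eps01 = 1"

text \<open>\<open>cell_d e e'\<close> is the coefficient of \<open>e'\<close> in \<open>d e\<close>.\<close>

fun cell_d :: "cell \<Rightarrow> cell \<Rightarrow> real" where
  "cell_d Eps0 Eps01 = - 1"
| "cell_d Eps1 Eps01 = 1"
| "cell_d _ _ = 0"

text \<open>An element of the tensor product of the forms with the cellular cochains is written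
  uniquely as the sum of \<open>\<eta> e \<otimes> e\<close> over the three basis elements \<open>e\<close>, and is represented by the
  function \<open>\<eta>\<close>.  The differential is \<open>d (\<alpha> \<otimes> e) = d\<alpha> \<otimes> e + (-1)^|\<alpha>| \<alpha> \<otimes> d e\<close>.\<close>

type_synonym ('m, 'w) cform = "cell \<Rightarrow> ('m, 'w) form"

definition OmegaC :: "('m, 'w::real_normed_vector) atlas \<Rightarrow> nat \<Rightarrow> ('m, 'w) cform set"
  where "OmegaC A k =
    {\<eta>. \<forall>e. if cell_dim e \<le> k then \<eta> e \<in> Omega A (k - cell_dim e) else \<eta> e = 0}"

definition dC :: "('m, 'w::real_normed_vector) atlas \<Rightarrow> ('m, 'w) cform \<Rightarrow> ('m, 'w) cform"
  where "dC A \<eta> = (\<lambda>e'. ext_deriv A (\<eta> e') +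
    (\<lambda>c q vs. \<Sum>e\<in>{Eps0, Eps1, Eps01}. (- 1) ^ length vs * cell_d e e' * \<eta> e c q vs))"

section \<open>The resolved product collar\<close>

definition radial_interval :: "real set \<Rightarrow> bool"
  where "radial_interval I \<longleftrightarrow> is_interval I \<and> 0 \<in> I \<and> I \<subseteq> {0..} \<and> I \<noteq> {0}"

text \<open>\<open>A\<close> is the atlas of \<open>\<Gamma>\<close>.  Points of the collar are triples \<open>(x, r, \<theta>)\<close>; the hypersurface \<open>E\<close> is
  identified with \<open>\<Gamma> \<times> [0,1]\<close>, each \<open>F\<^sub>i\<close> with \<open>\<Gamma> \<times> I\<close>, and each corner \<open>E \<inter> F\<^sub>i\<close> with \<open>\<Gamma>\<close>.\<close>

definition collar :: "('a, 'e) atlas \<Rightarrow> real set \<Rightarrow> ('a \<times> real \<times> real, 'e \<times> real \<times> real) atlas"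
  where "collar A I = prod_atlas A (I \<times> {0..1})"

definition E_atlas :: "('a, 'e) atlas \<Rightarrow> ('a \<times> real, 'e \<times> real) atlas"
  where "E_atlas A = prod_atlas A {0..1}"

definition F_atlas :: "('a, 'e) atlas \<Rightarrow> real set \<Rightarrow> ('a \<times> real, 'e \<times> real) atlas"
  where "F_atlas A I = prod_atlas A I"

context
  fixes A :: "('a, 'e::real_normed_vector) atlas" and I :: "real set"
begin

definition jE :: "('a \<times> real \<times> real, 'e \<times> real \<times> real) form \<Rightarrow> ('a \<times> real, 'e \<times> real) form"
  where "jE = pullback (E_atlas A) (collar A I) (\<lambda>(x, \<theta>). (x, 0, \<theta>))"

definition piE :: "('a \<times> real, 'e \<times> real) form \<Rightarrow> ('a \<times> real \<times> real, 'e \<times> real \<times> real) form"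
  where "piE = pullback (collar A I) (E_atlas A) (\<lambda>(x, r, \<theta>). (x, \<theta>))"

definition jF :: "real \<Rightarrow> ('a \<times> real \<times> real, 'e \<times> real \<times> real) form \<Rightarrow> ('a \<times> real, 'e \<times> real) form"
  where "jF i = pullback (F_atlas A I) (collar A I) (\<lambda>(x, r). (x, r, i))"

definition jEF :: "real \<Rightarrow> ('a \<times> real \<times> real, 'e \<times> real \<times> real) form \<Rightarrow> ('a, 'e) form"
  where "jEF i = pullback A (collar A I) (\<lambda>x. (x, 0, i))"

definition H_radial :: "('a \<times> real \<times> real, 'e \<times> real \<times> real) form \<Rightarrow> ('a \<times> real \<times> real, 'e \<times> real \<times> real) form"
  where "H_radial = line_integral (collar A I) (\<lambda>(x, r, \<theta>) s. (x, s, \<theta>)) (0, 1, 0) (\<lambda>(x, r, \<theta>). r)"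

definition H_radial_F :: "('a \<times> real, 'e \<times> real) form \<Rightarrow> ('a \<times> real, 'e \<times> real) form"
  where "H_radial_F = line_integral (F_atlas A I) (\<lambda>(x, r) s. (x, s)) (0, 1) (\<lambda>(x, r). r)"

text \<open>The angular Whitney, integration and Dupont maps act on the second factor of
  \<open>\<Omega>(\<Gamma>) \<otimes> \<Omega>([0,1])\<close>.  The integration map sends \<open>\<alpha> \<and> g d\<theta>\<close> to \<open>\<alpha> (\<integral>g) \<otimes> Eps01\<close>
  without sign, hence \<open>\<partial>\<^sub>\<theta>\<close> is inserted in the last slot.  The Dupont homotopy has degree -1 and
  carries the Koszul sign \<open>(-1)^|\<alpha>|\<close>, which contracting \<open>\<alpha> \<and> g d\<theta>\<close> with \<open>\<partial>\<^sub>\<theta>\<close> in the first slot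
  produces.\<close>

definition W_E :: "('a, 'e) cform \<Rightarrow> ('a \<times> real, 'e \<times> real) form"
  where "W_E \<eta> = (let p = pullback (E_atlas A) A fst in
    fmul (\<lambda>(x, \<theta>). 1 - \<theta>) (p (\<eta> Eps0)) + fmul (\<lambda>(x, \<theta>). \<theta>) (p (\<eta> Eps1)) + wedge1 (p (\<eta> Eps01)) snd)"

definition R_E :: "('a \<times> real, 'e \<times> real) form \<Rightarrow> ('a, 'e) cform"
  where "R_E \<omega> = (\<lambda>e. case e of
      Eps0 \<Rightarrow> pullback A (E_atlas A) (\<lambda>x. (x, 0)) \<omega>
    | Eps1 \<Rightarrow> pullback A (E_atlas A) (\<lambda>x. (x, 1)) \<omega>
    | Eps01 \<Rightarrow> (\<lambda>c x vs. if c \<in> A \<and> x \<in> fst c then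
        integral {0..1} (\<lambda>\<theta>. \<omega> (prod_chart {0..1} c) (x, \<theta>) (map (\<lambda>v. (v, 0)) vs @ [(0, 1)]))
        else 0))"

definition kappa_E :: "('a \<times> real, 'e \<times> real) form \<Rightarrow> ('a \<times> real, 'e \<times> real) form"
  where "kappa_E \<omega> =
    line_integral (E_atlas A) (\<lambda>(x, \<theta>) u. (x, u)) (0, 1) (\<lambda>(x, \<theta>). \<theta>) \<omega> -
    fmul (\<lambda>(x, \<theta>). \<theta>) (line_integral (E_atlas A) (\<lambda>(x, \<theta>) u. (x, u)) (0, 1) (\<lambda>(x, \<theta>). 1) \<omega>)"

definition incl_map :: "('a, 'e) cform \<Rightarrow> ('a \<times> real \<times> real, 'e \<times> real \<times> real) form"
  where "incl_map \<eta> = piE (W_E \<eta>)"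

definition proj_map :: "('a \<times> real \<times> real, 'e \<times> real \<times> real) form \<Rightarrow> ('a, 'e) cform"
  where "proj_map \<omega> = R_E (jE \<omega>)"

definition homotopy_map :: "('a \<times> real \<times> real, 'e \<times> real \<times> real) form \<Rightarrow> ('a \<times> real \<times> real, 'e \<times> real \<times> real) form"
  where "homotopy_map \<omega> = H_radial \<omega> + piE (kappa_E (jE \<omega>))"

end

section \<open>Special deformation retracts of cochain complexes\<close>

definition linear_between :: "'v::real_vector set \<Rightarrow> 'x::real_vector set \<Rightarrow> ('v \<Rightarrow> 'x) \<Rightarrow> bool"
  where "linear_between V X f \<longleftrightarrow> f ` V \<subseteq> X \<and>
    (\<forall>u\<in>V. \<forall>v\<in>V. f (u + v) = f u + f v) \<and> (\<forall>r. \<forall>v\<in>V. f (r *\<^sub>R v) = r *\<^sub>R f v)"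

definition cochain_complex :: "(nat \<Rightarrow> 'v::real_vector set) \<Rightarrow> ('v \<Rightarrow> 'v) \<Rightarrow> bool"
  where "cochain_complex V d \<longleftrightarrow>
    (\<forall>k. subspace (V k) \<and> linear_between (V k) (V (Suc k)) d \<and> (\<forall>v\<in>V k. d (d v) = 0))"

definition cochain_map :: "(nat \<Rightarrow> 'v::real_vector set) \<Rightarrow> ('v \<Rightarrow> 'v) \<Rightarrow>
    (nat \<Rightarrow> 'x::real_vector set) \<Rightarrow> ('x \<Rightarrow> 'x) \<Rightarrow> ('v \<Rightarrow> 'x) \<Rightarrow> bool"
  where "cochain_map V dV X dX f \<longleftrightarrow>
    (\<forall>k. linear_between (V k) (X k) f \<and> (\<forall>v\<in>V k. f (dV v) = dX (f v)))"

definition special_deformation_retract :: "(nat \<Rightarrow> 'v::real_vector set) \<Rightarrow> ('v \<Rightarrow> 'v) \<Rightarrow>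
    (nat \<Rightarrow> 'x::real_vector set) \<Rightarrow> ('x \<Rightarrow> 'x) \<Rightarrow> ('x \<Rightarrow> 'v) \<Rightarrow> ('v \<Rightarrow> 'x) \<Rightarrow> ('v \<Rightarrow> 'v) \<Rightarrow> bool"
  where "special_deformation_retract V dV X dX i p h \<longleftrightarrow>
    cochain_complex V dV \<and> cochain_complex X dX \<and>
    cochain_map X dX V dV i \<and> cochain_map V dV X dX p \<and>
    linear_between (V 0) {0} h \<and> (\<forall>k. linear_between (V (Suc k)) (V k) h) \<and>
    (\<forall>k. \<forall>v\<in>V k. dV (h v) + h (dV v) = v - i (p v)) \<and>
    (\<forall>k. \<forall>x\<in>X k. p (i x) = x) \<and>
    (\<forall>k. \<forall>v\<in>V k. h (h v) = 0) \<and>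
    (\<forall>k. \<forall>x\<in>X k. h (i x) = 0) \<and>
    (\<forall>k. \<forall>v\<in>V k. p (h v) = 0)"

end

theory Submission
  imports Defs
begin

text \<open>The retract is the composite of two: the radial integration homotopy \<open>H\<close> contracts the
  collar onto \<open>E\<close>, and Dupont's homotopy \<open>\<kappa>\<close> contracts \<open>E\<close> onto the Whitney forms; their
  sum \<open>h = H + \<pi>\<^sup>* \<kappa> j\<^sup>*\<close> satisfies \<open>d h + h d = (id - \<pi>\<^sup>* j\<^sup>*) + \<pi>\<^sup>* (id - W R) j\<^sup>*\<close>,
  and the side conditions follow from those of the two factors.  Both homotopies are built from
  integration over the slices of one coordinate, for which \<open>d \<integral> + \<integral> d\<close> is computed in one
  chart by differentiating under the integral sign and the fundamental theorem of calculus.  With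
  \<open>K \<omega>\<close> and \<open>M \<omega>\<close> the angular integrals up to \<open>\<theta>\<close> and up to \<open>1\<close>, Dupont's homotopy is
  \<open>K - \<theta> M\<close>, and the component of \<open>R\<close> along the 1-cell is \<open>\<plusminus>M\<close> restricted to \<open>\<theta> = 0\<close>.\<close>

section \<open>Derivatives on sets with corners\<close>

text \<open>The collar has boundary and corners, so derivatives are taken within sets that need not
  be open. Exterior calculus is therefore built for locally convex sets whose local differences span
  the space: such sets are stable under products and relatively open subsets, derivatives within
  them are unique, and second derivatives are symmetric up to the boundary. Second derivatives of
  coordinate changes enter only in the chart independence of \<open>d\<close>; the maps between the
  collar, \<open>E\<close>, \<open>F0\<close>, \<open>F1\<close> and the corners are the identity on
  \<Gamma> and affine in the interval coordinates. Cross terms in the side conditions vanish because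
  \<open>j pi = id\<close>, \<open>j H = 0\<close> and \<open>H pi = 0\<close>. The correction by
  \<theta> \<open>M\<close> makes \<kappa> vanish at both ends of the interval; its Leibniz term,
  \<open>d\<theta>\<close> wedge \<open>M\<close>, is precisely the Whitney form of the 1-cell
  component. The sign in front of \<open>M\<close> arises because \<open>R\<close> inserts the
  angular vector last, whereas \<kappa> inserts it first.\<close>

text \<open>By independence the norm of a combination is bounded below on each compact face of the
  coefficient cube, and dividing by the coefficient of largest modulus moves any nonzero vector to
  such a face. This makes the coordinates bounded.\<close>

lemma finite_span_coordinates:
  fixes F :: "'a::real_normed_vector set"
  assumes "finite F" "span F = UNIV"
  obtains B c where "finite B" "\<And>b::'a. bounded_linear (c b)" "\<And>v::'a. v = (\<Sum>b\<in>B. c b v *\<^sub>R b)"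
proof -
  obtain B where B: "B \<subseteq> F" "independent B" "F \<subseteq> span B"
    using maximal_independent_subset[of F] by blast
  have fB: "finite B" using B(1) assms(1) finite_subset by blast
  have sB: "span B = UNIV"
    using B(3) assms(2) span_minimal[OF B(3) subspace_span] by auto
  define c where "c b v = representation B v b" for b v
  have rep: "(\<Sum>b\<in>B. c b v *\<^sub>R b) = v" for v
    unfolding c_def using sum_representation_eq[OF B(2) _ fB order_refl, of v] sB by simp
  have lin: "linear (c b)" for b
    by (rule linearI) (auto simp: c_def representation_add[OF B(2)] representation_scale[OF B(2)] sB)
  \<comment> \<open>The face of the cube where the coefficient of \<open>b0\<close> is 1 or -1.
    Coefficients outside \<open>B\<close> are fixed at 0, so that the face is a product of compact
    sets in the full function space.\<close>
  define K :: "'a \<Rightarrow> ('a \<Rightarrow> real) set"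
    where "K b0 = PiE UNIV (\<lambda>b. if b = b0 then {-1,1} else if b \<in> B then {-1..1} else {0})" for b0
  define N where "N g = norm (\<Sum>b\<in>B. g b *\<^sub>R b)" for g :: "'a \<Rightarrow> real"
  have cK: "compact (K b0)" for b0
  proof -
    have "compactin (product_topology (\<lambda>_. euclidean) UNIV) (K b0)"
      unfolding K_def compactin_PiE by auto
    then show ?thesis by (simp add: euclidean_product_topology)
  qed
  have cN: "continuous_on X N" for X
    unfolding N_def by (intro continuous_intros continuous_on_subset[OF continuous_on_product_coordinates subset_UNIV])
  have "\<exists>m>0. \<forall>g\<in>K b0. m \<le> N g" if "b0 \<in> B" for b0
  proof -
    have "K b0 \<noteq> {}" by (auto simp: K_def PiE_eq_empty_iff)
    then obtain g0 where g0: "g0 \<in> K b0" "\<And>g. g \<in> K b0 \<Longrightarrow> N g0 \<le> N g"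
      using continuous_attains_inf[OF cK _ cN] by blast
    have "g0 b0 \<in> {-1,1}" using g0(1) by (auto simp: K_def PiE_iff dest: spec[of _ b0])
    then have "N g0 \<noteq> 0"
      using independentD[OF B(2) fB order_refl _ that, of g0] by (auto simp: N_def)
    then have "N g0 > 0" by (simp add: N_def)
    then show ?thesis using g0 by blast
  qed
  then have "\<forall>b0\<in>B. \<exists>m. m > 0 \<and> (\<forall>g\<in>K b0. m \<le> N g)" by blast
  from bchoice[OF this] obtain m
    where m: "\<And>b0. b0 \<in> B \<Longrightarrow> m b0 > 0" "\<And>b0 g. b0 \<in> B \<Longrightarrow> g \<in> K b0 \<Longrightarrow> m b0 \<le> N g"
    by blast
  \<comment> \<open>A sum instead of a maximum: it dominates every \<open>1 / m b0\<close> and is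
    defined for empty \<open>B\<close> too.\<close>
  define M where "M = (\<Sum>b\<in>B. 1 / m b)"
  have bound: "\<bar>c b v\<bar> \<le> norm v * M" if b: "b \<in> B" for b v
  proof -
    have "Max ((\<lambda>b. \<bar>c b v\<bar>) ` B) \<in> (\<lambda>b. \<bar>c b v\<bar>) ` B"
      using fB b by (intro Max_in) auto
    then obtain b0 where b0: "b0 \<in> B" "Max ((\<lambda>b. \<bar>c b v\<bar>) ` B) = \<bar>c b0 v\<bar>"
      by (rule imageE)
    have b0: "b0 \<in> B" "\<bar>c b' v\<bar> \<le> \<bar>c b0 v\<bar>" if "b' \<in> B" for b'
      using b0 Max_ge[of "(\<lambda>b. \<bar>c b v\<bar>) ` B" "\<bar>c b' v\<bar>"] fB that by auto
    note b0 = b0(1)[OF b] b0(2)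
    show ?thesis
    proof (cases "c b0 v = 0")
      case True
      then have "\<bar>c b v\<bar> \<le> 0" using b0(2)[OF b] by simp
      moreover have "M \<ge> 0" unfolding M_def using m(1) by (intro sum_nonneg) (auto simp: less_imp_le)
      ultimately show ?thesis by (meson dual_order.trans mult_nonneg_nonneg norm_ge_zero)
    next
      case False
      define g where "g b' = (if b' \<in> B then c b' v / c b0 v else 0)" for b'
      have "g b' \<in> {-1..1}" if "b' \<in> B" for b'
      proof -
        have "\<bar>g b'\<bar> \<le> 1" using b0(2)[OF that] False that by (simp add: g_def divide_le_eq)
        then show ?thesis by auto
      qed
      then have "g \<in> K b0" using False b0(1)
        by (auto simp: K_def PiE_iff g_def)
      then have "m b0 \<le> N g" using m(2) b0(1) by blast
      also have "N g = norm ((1 / c b0 v) *\<^sub>R (\<Sum>b\<in>B. c b v *\<^sub>R b))"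
        unfolding N_def scaleR_sum_right by (rule arg_cong[of _ _ norm], rule sum.cong) (auto simp: g_def)
      also have "\<dots> = norm v / \<bar>c b0 v\<bar>" by (simp add: rep)
      finally have "\<bar>c b0 v\<bar> \<le> norm v * (1 / m b0)"
        using False m(1)[OF b0(1)] by (simp add: field_simps)
      also have "\<dots> \<le> norm v * M"
        unfolding M_def using b0(1) fB m(1)
        by (intro mult_left_mono member_le_sum) (auto simp: less_imp_le)
      finally show ?thesis using b0(2)[OF b] by linarith
    qed
  qed
  have bl: "bounded_linear (c b)" for b
  proof (cases "b \<in> B")
    case True
    interpret linear "c b" by (rule lin)
    show ?thesis by unfold_locales (use bound[OF True] in auto)
  next
    case False
    then have "c b v = 0" for v using representation_ne_zero[of B v b] by (auto simp: c_def)
    then have "c b = (\<lambda>_. 0)" by blast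
    then show ?thesis by simp
  qed
  show thesis using that[of B c] fB bl rep by simp
qed

text \<open>Derivatives within corner sets are unique, and mixed second derivatives commute up to the
  boundary.\<close>

definition corner_set :: "'a::real_normed_vector set \<Rightarrow> bool" where
  "corner_set S \<longleftrightarrow>
    (\<forall>x\<in>S. \<exists>N. open N \<and> x \<in> N \<and> convex (N \<inter> S) \<and> span ((\<lambda>y. y - x) ` (N \<inter> S)) = UNIV)"

lemma corner_setE:
  assumes "corner_set S" "x \<in> S"
  obtains N where "open N" "x \<in> N" "convex (N \<inter> S)" "span ((\<lambda>y. y - x) ` (N \<inter> S)) = UNIV"
  using assms unfolding corner_set_def by blast

text \<open>By convexity every \<open>y\<close> can be contracted towards \<open>x\<close> until it
  lies in the open set; this only rescales the difference \<open>y - x\<close>.\<close>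

lemma span_differences_Int_open:
  fixes C :: "'a::real_normed_vector set"
  assumes C: "convex C" "x \<in> C" "span ((\<lambda>y. y - x) ` C) = UNIV" and O: "open O'" "x \<in> O'"
  shows "span ((\<lambda>y. y - x) ` (O' \<inter> C)) = UNIV"
proof -
  obtain e where e: "e > 0" "ball x e \<subseteq> O'" using O open_contains_ball by blast
  have "y - x \<in> span ((\<lambda>y. y - x) ` (O' \<inter> C))" if y: "y \<in> C" for y
  proof -
    \<comment> \<open>The 1 added to the norm keeps the denominator positive when
      \<open>y = x\<close>; the bound by 1 keeps \<open>z\<close> on the segment from
      \<open>x\<close> to \<open>y\<close>.\<close>
    define \<epsilon> where "\<epsilon> = min 1 (e / (2 * (norm (y - x) + 1)))"
    have \<epsilon>: "\<epsilon> > 0" "\<epsilon> \<le> 1" using e(1) by (auto simp: \<epsilon>_def add_nonneg_pos)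
    define z where "z = x + \<epsilon> *\<^sub>R (y - x)"
    have "z = (1 - \<epsilon>) *\<^sub>R x + \<epsilon> *\<^sub>R y" by (simp add: z_def algebra_simps)
    then have zC: "z \<in> C" using convexD[OF C(1,2) y, of "1 - \<epsilon>" \<epsilon>] \<epsilon> by simp
    have "\<epsilon> * norm (y - x) \<le> e / (2 * (norm (y - x) + 1)) * norm (y - x)"
      by (intro mult_right_mono) (auto simp: \<epsilon>_def)
    also have "\<dots> = e * (norm (y - x) / (2 * (norm (y - x) + 1)))" by simp
    also have "\<dots> < e * 1"
      using e(1) by (intro mult_strict_left_mono) (auto simp: divide_less_eq add_nonneg_pos)
    finally have "z \<in> O'" using e(2) \<epsilon> by (auto simp: z_def dist_norm subset_iff)
    then have "z - x \<in> span ((\<lambda>y. y - x) ` (O' \<inter> C))" using zC by (intro span_base) auto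
    from span_scale[OF this, of "1/\<epsilon>"] show ?thesis using \<epsilon> by (simp add: z_def)
  qed
  then have "(\<lambda>y. y - x) ` C \<subseteq> span ((\<lambda>y. y - x) ` (O' \<inter> C))" by blast
  from span_minimal[OF this subspace_span] show ?thesis using C(3) by auto
qed

lemma corner_set_Int_open:
  assumes S: "corner_set S" and O: "open O'"
  shows "corner_set (S \<inter> O')"
  unfolding corner_set_def
proof
  fix x assume x: "x \<in> S \<inter> O'"
  obtain N where N: "open N" "x \<in> N" "convex (N \<inter> S)" "span ((\<lambda>y. y - x) ` (N \<inter> S)) = UNIV"
    using corner_setE[OF S] x by blast
  obtain e where e: "e > 0" "ball x e \<subseteq> O'" using O x open_contains_ball by blast
  have *: "(N \<inter> ball x e) \<inter> (S \<inter> O') = ball x e \<inter> (N \<inter> S)" using e(2) by auto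
  show "\<exists>N. open N \<and> x \<in> N \<and> convex (N \<inter> (S \<inter> O')) \<and> span ((\<lambda>y. y - x) ` (N \<inter> (S \<inter> O'))) = UNIV"
  proof (intro exI[of _ "N \<inter> ball x e"] conjI)
    show "span ((\<lambda>y. y - x) ` (N \<inter> ball x e \<inter> (S \<inter> O'))) = UNIV"
      unfolding * using N x e(1) by (auto intro!: span_differences_Int_open[OF N(3) _ N(4) open_ball] simp del: Int_iff simp: IntI)
    show "convex (N \<inter> ball x e \<inter> (S \<inter> O'))" unfolding * by (rule convex_Int[OF convex_ball N(3)])
  qed (use N e in auto)
qed

lemma corner_set_UNIV: "corner_set UNIV"
  unfolding corner_set_def
proof
  fix x :: 'a
  have "(\<lambda>y. y - x) ` UNIV = UNIV" by (metis surj_diff_right)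
  then show "\<exists>N. open N \<and> x \<in> N \<and> convex (N \<inter> UNIV) \<and> span ((\<lambda>y. y - x) ` (N \<inter> UNIV)) = UNIV"
    by (intro exI[of _ UNIV]) auto
qed

lemma corner_set_open: "open S \<Longrightarrow> corner_set S"
  using corner_set_Int_open[OF corner_set_UNIV] by auto

text \<open>Two distinct points provide a nonzero difference at every \<open>x\<close>, and one such
  difference spans the line.\<close>

lemma corner_set_interval:
  fixes S :: "real set"
  assumes "is_interval S" "a \<in> S" "b \<in> S" "a \<noteq> b"
  shows "corner_set S"
  unfolding corner_set_def
proof
  fix x assume "x \<in> S"
  obtain y where y: "y \<in> S" "y \<noteq> x" using assms by metis
  have "r \<in> span ((\<lambda>y. y - x) ` S)" for r
  proof -
    have "y - x \<in> span ((\<lambda>y. y - x) ` S)" using y by (intro span_base) auto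
    from span_scale[OF this, of "r / (y - x)"] show ?thesis using y by simp
  qed
  then show "\<exists>N. open N \<and> x \<in> N \<and> convex (N \<inter> S) \<and> span ((\<lambda>y. y - x) ` (N \<inter> S)) = UNIV"
    using assms(1) by (intro exI[of _ UNIV]) (auto simp: is_interval_convex)
qed

lemma span_axes:
  assumes "span F = (UNIV::'a::real_vector set)" "span G = (UNIV::'b::real_vector set)"
  shows "span (F \<times> {0} \<union> {0} \<times> G) = UNIV"
proof -
  let ?X = "F \<times> {0::'b} \<union> {0::'a} \<times> G"
  have "(u, v) \<in> span ?X" for u v
  proof -
    have "(u, 0) \<in> (\<lambda>v. (v, 0)) ` span F" using assms(1) by auto
    also have "\<dots> = span ((\<lambda>v. (v, 0::'b)) ` F)"
      by (rule linear_span_image[symmetric]) (auto intro!: linearI)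
    also have "\<dots> \<subseteq> span ?X" by (intro span_mono) auto
    finally have 1: "(u, 0) \<in> span ?X" .
    have "(0, v) \<in> (\<lambda>v. (0, v)) ` span G" using assms(2) by auto
    also have "\<dots> = span ((\<lambda>v. (0::'a, v)) ` G)"
      by (rule linear_span_image[symmetric]) (auto intro!: linearI)
    also have "\<dots> \<subseteq> span ?X" by (intro span_mono) auto
    finally have 2: "(0, v) \<in> span ?X" .
    show ?thesis using span_add[OF 1 2] by simp
  qed
  then show ?thesis by auto
qed

lemma corner_set_Times:
  assumes "corner_set S" "corner_set T"
  shows "corner_set (S \<times> T)"
  unfolding corner_set_def
proof safe
  fix x y assume "x \<in> S" "y \<in> T"
  obtain M where M: "open M" "x \<in> M" "convex (M \<inter> S)" "span ((\<lambda>y. y - x) ` (M \<inter> S)) = UNIV"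
    using corner_setE[OF assms(1) \<open>x \<in> S\<close>] by blast
  obtain N where N: "open N" "y \<in> N" "convex (N \<inter> T)" "span ((\<lambda>z. z - y) ` (N \<inter> T)) = UNIV"
    using corner_setE[OF assms(2) \<open>y \<in> T\<close>] by blast
  have eq: "(M \<times> N) \<inter> (S \<times> T) = (M \<inter> S) \<times> (N \<inter> T)" by auto
  let ?D = "(\<lambda>z. z - (x, y)) ` ((M \<inter> S) \<times> (N \<inter> T))"
  have "(\<lambda>y. y - x) ` (M \<inter> S) \<times> {0} \<union> {0} \<times> (\<lambda>z. z - y) ` (N \<inter> T) \<subseteq> ?D"
    using \<open>x \<in> S\<close> \<open>y \<in> T\<close> M(2) N(2) by force
  from span_mono[OF this] have "span ?D = UNIV" unfolding span_axes[OF M(4) N(4)] by auto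
  then show "\<exists>N. open N \<and> (x, y) \<in> N \<and> convex (N \<inter> S \<times> T) \<and>
      span ((\<lambda>z. z - (x, y)) ` (N \<inter> S \<times> T)) = UNIV"
    using M N by (intro exI[of _ "M \<times> N"]) (auto simp: eq open_Times convex_Times)
qed

section \<open>Uniqueness of derivatives and symmetry of second derivatives\<close>

lemma has_derivative_on_segment:
  assumes f: "(f has_derivative f') (at (x + s *\<^sub>R i) within C)"
    and "\<And>s. s \<in> {0..t} \<Longrightarrow> x + s *\<^sub>R i \<in> C"
  shows "((\<lambda>s. f (x + s *\<^sub>R i)) has_derivative (\<lambda>h. f' (h *\<^sub>R i))) (at s within {0..t::real})"
proof -
  have "((\<lambda>s. x + s *\<^sub>R i) has_derivative (\<lambda>h. h *\<^sub>R i)) (at s within {0..t})"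
    by (auto intro!: derivative_eq_intros)
  moreover have "(\<lambda>s. x + s *\<^sub>R i) ` {0..t} \<subseteq> C" using assms(2) by blast
  ultimately show ?thesis
    using has_derivative_in_compose[of "\<lambda>s. x + s *\<^sub>R i" _ s "{0..t}" f f'] has_derivative_subset[OF f] by blast
qed

text \<open>Near \<open>x\<close> the segments from \<open>x\<close> to points of \<open>S\<close>
  stay in \<open>S\<close> by convexity. One-sided derivatives along them determine the derivative
  on all differences \<open>y - x\<close>, and these span.\<close>

lemma corner_set_derivative_unique:
  assumes S: "corner_set S" "x \<in> S"
    and 1: "(f has_derivative f') (at x within S)" and 2: "(f has_derivative f'') (at x within S)"
  shows "f' = f''"
proof -
  obtain N where N: "open N" "x \<in> N" "convex (N \<inter> S)" "span ((\<lambda>y. y - x) ` (N \<inter> S)) = UNIV"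
    using corner_setE[OF S] by blast
  interpret a: bounded_linear f' using 1 by (rule has_derivative_bounded_linear)
  interpret b: bounded_linear f'' using 2 by (rule has_derivative_bounded_linear)
  have eq: "f' (y - x) = f'' (y - x)" if "y \<in> N \<inter> S" for y
  proof -
    have seg: "x + s *\<^sub>R (y - x) \<in> S" if "s \<in> {0..1}" for s :: real
    proof -
      have "x + s *\<^sub>R (y - x) = (1 - s) *\<^sub>R x + s *\<^sub>R y" by (simp add: algebra_simps)
      then show ?thesis
        using convexD[OF N(3) _ \<open>y \<in> N \<inter> S\<close>, of x "1 - s" s] N(2) S(2) that by auto
    qed
    have "((\<lambda>s. f (x + s *\<^sub>R (y - x))) has_derivative (\<lambda>h. f' (h *\<^sub>R (y - x)))) (at 0 within {0..1})"
      "((\<lambda>s. f (x + s *\<^sub>R (y - x))) has_derivative (\<lambda>h. f'' (h *\<^sub>R (y - x)))) (at 0 within {0..1})"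
      using 1 2 seg by (auto intro!: has_derivative_on_segment[where C=S])
    then have "(\<lambda>h. f' (h *\<^sub>R (y - x))) = (\<lambda>h. f'' (h *\<^sub>R (y - x)))"
      using frechet_derivative_unique_within_closed_interval[of "0::real" 1 0] by (auto simp: cbox_interval)
    from fun_cong[OF this, of 1] show ?thesis by simp
  qed
  have "f' v = f'' v" for v
    by (rule linear_eq_on_span[of f' f'' "(\<lambda>y. y - x) ` (N \<inter> S)"])
      (use eq N(4) a.linear_axioms b.linear_axioms in auto)
  then show ?thesis by auto
qed

lemma corner_set_frechet_derivative:
  assumes "corner_set S" "x \<in> S" "(f has_derivative f') (at x within S)"
  shows "frechet_derivative f (at x within S) = f'"
  using corner_set_derivative_unique[OF assms(1,2) _ assms(3)] frechet_derivative_works differentiableI assms(3)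
  by blast

text \<open>The mean value inequality is applied to the increment in direction \<open>j\<close>,
  regarded as a function of the step in direction \<open>i\<close>, after subtracting its expected
  value. The derivative in direction \<open>i\<close> is differentiated only at \<open>x\<close> and
  only within \<open>C\<close>, so \<open>x\<close> may be a boundary point.\<close>

lemma second_difference_bound:
  assumes C: "convex C" "x \<in> C" "x + i \<in> C" "x + j \<in> C"
    "\<And>s t. s \<in> {0..a} \<Longrightarrow> t \<in> {0..a} \<Longrightarrow> x + s *\<^sub>R i + t *\<^sub>R j \<in> C" and a: "a > 0"
    and f: "\<And>y. y \<in> C \<Longrightarrow> (f has_derivative f' y) (at y within C)"
    and fi: "((\<lambda>y. f' y i) has_derivative fi) (at x within C)" and e: "e > 0"
  shows "\<exists>b>0. \<forall>t\<in>{0<..b}.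
     norm (f (x + t *\<^sub>R i + t *\<^sub>R j) - f (x + t *\<^sub>R i) - f (x + t *\<^sub>R j) + f x - (t * t) *\<^sub>R fi j)
       \<le> e * t * t"
proof -
  interpret bi: bounded_linear fi using fi by (rule has_derivative_bounded_linear)
  \<comment> \<open>The points \<open>y\<close> and \<open>z\<close> below satisfy
    \<open>norm (y - x) + norm (z - x) \<le> t * K\<close>; the summand 1 makes \<open>K\<close>
    positive.\<close>
  define K where "K = 2 * norm i + norm j + 1"
  have K: "K > 0" by (simp add: K_def add_nonneg_pos)
  obtain d where d: "d > 0" "\<And>y. y \<in> C \<Longrightarrow> norm (y - x) < d \<Longrightarrow>
      norm (f' y i - f' x i - fi (y - x)) \<le> e / K * norm (y - x)"
    using fi[unfolded has_derivative_within_alt, THEN conjunct2, rule_format, OF divide_pos_pos[OF e K]] by blast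
  define b where "b = min a (d / (2 * K))"
  have b: "b > 0" using a d K by (simp add: b_def)
  have "norm (f (x + t *\<^sub>R i + t *\<^sub>R j) - f (x + t *\<^sub>R i) - f (x + t *\<^sub>R j) + f x - (t * t) *\<^sub>R fi j) \<le> e * t * t"
    if t: "0 < t" "t \<le> b" for t
  proof -
    have ta: "t \<le> a" "t * K < d"
    proof -
      show "t \<le> a" using t by (simp add: b_def)
      have "t * K \<le> d / (2 * K) * K" using t K by (intro mult_right_mono) (auto simp: b_def)
      also have "\<dots> < d" using d K by simp
      finally show "t * K < d" .
    qed
    define \<phi> where "\<phi> s = f (x + t *\<^sub>R j + s *\<^sub>R i) - f (x + s *\<^sub>R i) - s *\<^sub>R (t *\<^sub>R fi j)" for s
    define \<phi>' where "\<phi>' s h = f' (x + t *\<^sub>R j + s *\<^sub>R i) (h *\<^sub>R i) - f' (x + s *\<^sub>R i) (h *\<^sub>R i) - h *\<^sub>R (t *\<^sub>R fi j)" for s h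
    have inC: "x + t *\<^sub>R j + s *\<^sub>R i \<in> C" "x + s *\<^sub>R i \<in> C" if "s \<in> {0..t}" for s
      using C(5)[of s t] C(5)[of s 0] that ta by (auto simp: algebra_simps)
    have der: "(\<phi> has_derivative \<phi>' s) (at s within {0..t})" if "s \<in> {0..t}" for s
      unfolding \<phi>_def \<phi>'_def
      by (intro has_derivative_diff has_derivative_on_segment[where C=C] f inC that)
        (auto intro!: derivative_eq_intros)
    have bd: "onorm (\<phi>' s) \<le> e * t" if s: "s \<in> {0..t}" for s
    proof -
      have l1: "linear (f' (x + t *\<^sub>R j + s *\<^sub>R i))" "linear (f' (x + s *\<^sub>R i))"
        using f[OF inC(1)[OF s]] f[OF inC(2)[OF s]] has_derivative_linear by blast+
      define y where "y = x + t *\<^sub>R j + s *\<^sub>R i"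
      define z where "z = x + s *\<^sub>R i"
      have n: "norm (y - x) \<le> t * (norm i + norm j)" "norm (z - x) \<le> t * norm i"
      proof -
        have "norm (y - x) \<le> norm (t *\<^sub>R j) + norm (s *\<^sub>R i)" unfolding y_def
          by (metis add.assoc add_diff_cancel_left' norm_triangle_ineq)
        moreover have "s * norm i \<le> t * norm i" using s by (intro mult_right_mono) auto
        ultimately show "norm (y - x) \<le> t * (norm i + norm j)" "norm (z - x) \<le> t * norm i"
          using s t by (auto simp: algebra_simps z_def)
      qed
      have nK: "norm (y - x) + norm (z - x) \<le> t * K" 
        using n t by (simp add: K_def algebra_simps)
      have "norm (y - x) < d" "norm (z - x) < d"
        using nK ta(2) norm_ge_zero[of "y - x"] norm_ge_zero[of "z - x"] by linarith+
      then have "norm (f' y i - f' x i - fi (y - x)) \<le> e / K * norm (y - x)"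
        "norm (f' z i - f' x i - fi (z - x)) \<le> e / K * norm (z - x)"
        using d(2)[of y] d(2)[of z] inC[OF s] unfolding y_def[symmetric] z_def[symmetric] by blast+
      then have "norm ((f' y i - f' x i - fi (y - x)) - (f' z i - f' x i - fi (z - x)))
          \<le> e / K * (norm (y - x) + norm (z - x))"
        using norm_triangle_ineq4[of "f' y i - f' x i - fi (y - x)" "f' z i - f' x i - fi (z - x)"]
        by (simp add: algebra_simps)
      also have "\<dots> \<le> e / K * (t * K)" using nK e K by (intro mult_left_mono) auto
      also have "\<dots> = e * t" using K by simp
      also have "(f' y i - f' x i - fi (y - x)) - (f' z i - f' x i - fi (z - x))
        = f' y i - f' z i - t *\<^sub>R fi j"
        by (simp add: y_def z_def bi.add bi.diff bi.scaleR)
      finally have main: "norm (f' y i - f' z i - t *\<^sub>R fi j) \<le> e * t" .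
      show ?thesis
      proof (rule onorm_le)
        fix h :: real
        have "\<phi>' s h = h *\<^sub>R (f' y i - f' z i - t *\<^sub>R fi j)"
          using l1 by (simp add: \<phi>'_def y_def z_def linear_scale algebra_simps)
        then show "norm (\<phi>' s h) \<le> e * t * norm h"
          using mult_left_mono[OF main, of "\<bar>h\<bar>"] by (simp add: mult.commute)
      qed
    qed
    have "norm (\<phi> t - \<phi> 0) \<le> e * t * norm (t - 0)"
      by (rule differentiable_bound[of "{0..t}" \<phi> \<phi>']) (use der bd t in auto)
    then show ?thesis using t by (simp add: \<phi>_def algebra_simps)
  qed
  then show ?thesis using b by (intro exI[of _ b]) auto
qed

text \<open>The second difference over a small parallelogram does not change when the sides are
  exchanged, yet it approximates both mixed derivatives. This settles directions that point from
  \<open>x\<close> into \<open>C\<close>; bilinearity extends the result to all vectors, since these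
  directions span.\<close>

lemma corner_set_symmetric_derivative:
  assumes S: "corner_set S" "x \<in> S"
    and f: "\<And>y. y \<in> S \<Longrightarrow> (f has_derivative f' y) (at y within S)"
    and f'': "\<And>v. ((\<lambda>y. f' y v) has_derivative (\<lambda>w. f'' w v)) (at x within S)"
  shows "f'' v w = f'' w v"
proof -
  obtain N where N: "open N" "x \<in> N" "convex (N \<inter> S)" "span ((\<lambda>y. y - x) ` (N \<inter> S)) = UNIV"
    using corner_setE[OF S] by blast
  define C where "C = N \<inter> S"
  have xC: "x \<in> C" and CC: "convex C" using N S by (auto simp: C_def)
  have fC: "(f has_derivative f' y) (at y within C)" if "y \<in> C" for y
    using that f[of y] by (auto simp: C_def intro: has_derivative_subset)
  have f''C: "((\<lambda>y. f' y v) has_derivative (\<lambda>w. f'' w v)) (at x within C)" for v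
    using f''[of v] by (auto simp: C_def intro: has_derivative_subset)
  have sym: "f'' j i = f'' i j" if ij: "x + i \<in> C" "x + j \<in> C" for i j
  proof (rule ccontr)
    assume "f'' j i \<noteq> f'' i j"
    \<comment> \<open>With a third of the gap as tolerance, the two approximations force the gap to
      be at most two thirds of itself.\<close>
    then have e: "norm (f'' j i - f'' i j) / 3 > 0" (is "?e > 0") by simp
    \<comment> \<open>With both parameters at most 1/2 the point is a convex combination of
      \<open>x\<close>, \<open>x + i\<close> and \<open>x + j\<close>.\<close>
    have par: "x + s *\<^sub>R i + t *\<^sub>R j \<in> C" "x + s *\<^sub>R j + t *\<^sub>R i \<in> C" if "s \<in> {0..1/2}" "t \<in> {0..1/2}" for s t
    proof -
      have *: "(1 - s - t) *\<^sub>R x + (s *\<^sub>R a + t *\<^sub>R b) \<in> C" if "a \<in> C" "b \<in> C" for a b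
      proof (cases "s + t = 0")
        case True then show ?thesis using \<open>s \<in> _\<close> \<open>t \<in> _\<close> xC by (auto simp: add_nonneg_eq_0_iff)
      next
        case False
        have "(s / (s + t)) *\<^sub>R a + (t / (s + t)) *\<^sub>R b \<in> C"
          using \<open>s \<in> _\<close> \<open>t \<in> _\<close> False that by (intro convexD[OF CC]) (auto simp: add_divide_distrib[symmetric])
        from convexD[OF CC xC this, of "1 - (s + t)" "s + t"]
        have "(1 - (s + t)) *\<^sub>R x + (s + t) *\<^sub>R ((s / (s + t)) *\<^sub>R a + (t / (s + t)) *\<^sub>R b) \<in> C"
          using \<open>s \<in> _\<close> \<open>t \<in> _\<close> by auto
        then show ?thesis using False by (simp add: scaleR_right_distrib diff_diff_eq)
      qed
      show "x + s *\<^sub>R i + t *\<^sub>R j \<in> C" using *[OF \<open>x + i \<in> C\<close> \<open>x + j \<in> C\<close>] by (simp add: algebra_simps)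
      show "x + s *\<^sub>R j + t *\<^sub>R i \<in> C" using *[OF \<open>x + j \<in> C\<close> \<open>x + i \<in> C\<close>] by (simp add: algebra_simps)
    qed
    obtain b where b: "b > 0" "\<And>t. t \<in> {0<..b} \<Longrightarrow>
      norm (f (x + t *\<^sub>R i + t *\<^sub>R j) - f (x + t *\<^sub>R i) - f (x + t *\<^sub>R j) + f x - (t * t) *\<^sub>R f'' j i) \<le> ?e * t * t"
      using second_difference_bound[OF CC xC ij, of "1/2" f f' "\<lambda>w. f'' w i", OF par(1) _ fC f''C e] by auto
    obtain c where c: "c > 0" "\<And>t. t \<in> {0<..c} \<Longrightarrow>
      norm (f (x + t *\<^sub>R j + t *\<^sub>R i) - f (x + t *\<^sub>R j) - f (x + t *\<^sub>R i) + f x - (t * t) *\<^sub>R f'' i j) \<le> ?e * t * t"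
      using second_difference_bound[OF CC xC ij(2,1), of "1/2" f f' "\<lambda>w. f'' w j", OF par(2) _ fC f''C e] by auto
    define t where "t = min b c"
    have t: "t > 0" "t \<in> {0<..b}" "t \<in> {0<..c}" using b c by (auto simp: t_def)
    define \<Delta> where "\<Delta> = f (x + t *\<^sub>R i + t *\<^sub>R j) - f (x + t *\<^sub>R i) - f (x + t *\<^sub>R j) + f x"
    have "norm (\<Delta> - (t * t) *\<^sub>R f'' j i) \<le> ?e * t * t" "norm (\<Delta> - (t * t) *\<^sub>R f'' i j) \<le> ?e * t * t"
      using b(2)[OF t(2)] c(2)[OF t(3)] by (simp_all add: \<Delta>_def algebra_simps)
    then have "norm ((t * t) *\<^sub>R f'' j i - (t * t) *\<^sub>R f'' i j) \<le> 2 * ?e * (t * t)"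
      using norm_triangle_ineq4[of "\<Delta> - (t * t) *\<^sub>R f'' i j" "\<Delta> - (t * t) *\<^sub>R f'' j i"] by simp
    then have "(t * t) * norm (f'' j i - f'' i j) \<le> (t * t) * (2 * ?e)"
      by (simp add: scaleR_diff_right[symmetric] mult.commute del: scaleR_scaleR)
    then have "norm (f'' j i - f'' i j) \<le> 2 * ?e" using t(1) by (simp add: mult_le_cancel_left)
    then show False using e by simp
  qed
  have l1: "linear (\<lambda>w. f'' w v)" for v using f''[of v] by (rule has_derivative_linear)
  \<comment> \<open>Linearity in the direction of the first derivative passes from
    \<open>f' y\<close> to its derivative, because the latter is unique.\<close>
  have l2: "linear (f'' w)" for w
  proof (rule linearI)
    note bl = f[THEN has_derivative_linear]
    have "((\<lambda>y. f' y (a + b)) has_derivative (\<lambda>w. f'' w a + f'' w b)) (at x within S)" for a b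
      by (rule has_derivative_transform[OF S(2) _ has_derivative_add[OF f''[of a] f''[of b]]])
        (simp add: bl linear_add)
    from corner_set_derivative_unique[OF S f'' this]
    show "f'' w (a + b) = f'' w a + f'' w b" for a b by (rule fun_cong)
    have "((\<lambda>y. f' y (r *\<^sub>R b)) has_derivative (\<lambda>w. r *\<^sub>R f'' w b)) (at x within S)" for r b
      by (rule has_derivative_transform[OF S(2) _ has_derivative_scaleR_right[OF f''[of b]]])
        (simp add: bl linear_scale)
    from corner_set_derivative_unique[OF S f'' this]
    show "f'' w (r *\<^sub>R b) = r *\<^sub>R f'' w b" for r b by (rule fun_cong)
  qed
  have eq: "f'' (y - x) w = f'' w (y - x)" if y: "y \<in> C" for y w
    by (rule linear_eq_on_span[of "f'' (y - x)" "\<lambda>w. f'' w (y - x)" "(\<lambda>y. y - x) ` C"])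
      (use sym y l1 l2 N(4) in \<open>auto simp: C_def\<close>)
  show ?thesis
    by (rule linear_eq_on_span[of "\<lambda>v. f'' v w" "\<lambda>v. f'' w v" "(\<lambda>y. y - x) ` C"])
      (use eq l1 l2 N(4) in \<open>auto simp: C_def\<close>)
qed

section \<open>Smooth functions and integrals over slices\<close>

lemma Ck_on_SucI:
  "(\<And>x. x \<in> S \<Longrightarrow> (f has_derivative f' x) (at x within S)) \<Longrightarrow> (\<And>v. Ck_on k (\<lambda>x. f' x v) S)
    \<Longrightarrow> Ck_on (Suc k) f S"
  unfolding Ck_on.simps by blast

lemma Ck_on_SucE:
  assumes "Ck_on (Suc k) f S"
  obtains f' where "\<And>x. x \<in> S \<Longrightarrow> (f has_derivative f' x) (at x within S)"
    "\<And>v. Ck_on k (\<lambda>x. f' x v) S"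
  using assms unfolding Ck_on.simps by blast

lemma Ck_on_cong:
  assumes "\<And>x. x \<in> S \<Longrightarrow> f x = g x" "Ck_on k f S"
  shows "Ck_on k g S"
  using assms
proof (induction k arbitrary: f g)
  case 0
  then show ?case using continuous_on_cong[of S S f g] by simp
next
  case (Suc k)
  from Suc.prems(2) obtain f' where f': "\<And>x. x \<in> S \<Longrightarrow> (f has_derivative f' x) (at x within S)"
    "\<And>v. Ck_on k (\<lambda>x. f' x v) S" by (rule Ck_on_SucE) blast
  show ?case
    by (rule Ck_on_SucI[OF has_derivative_transform[OF _ _ f'(1)] f'(2)]) (use Suc.prems(1) in auto)
qed

lemma Ck_on_lower: "Ck_on (Suc k) f S \<Longrightarrow> Ck_on k f S"
proof (induction k arbitrary: f)
  case 0
  then show ?case using has_derivative_continuous_on by auto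
next
  case (Suc k)
  from Suc.prems obtain f' where f': "\<And>x. x \<in> S \<Longrightarrow> (f has_derivative f' x) (at x within S)"
    "\<And>v. Ck_on (Suc k) (\<lambda>x. f' x v) S" by (rule Ck_on_SucE) blast
  show ?case by (rule Ck_on_SucI[OF f'(1) Suc.IH[OF f'(2)]])
qed

lemma Ck_on_continuous: "Ck_on k f S \<Longrightarrow> continuous_on S f"
  by (induction k) (use Ck_on_lower in auto)

lemma Ck_on_const: "Ck_on k (\<lambda>x. c) S"
  by (induction k arbitrary: c) (auto intro!: exI[of _ "\<lambda>x v. 0"])

lemma Ck_on_linear:
  assumes "bounded_linear L"
  shows "Ck_on k L S"
proof (cases k)
  case 0
  then show ?thesis using linear_continuous_on[OF assms] by simp
next
  case (Suc j)
  then show ?thesis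
    using bounded_linear_imp_has_derivative[OF assms] by (auto intro!: exI[of _ "\<lambda>x. L"] Ck_on_const)
qed

lemma Ck_on_add: "Ck_on k f S \<Longrightarrow> Ck_on k g S \<Longrightarrow> Ck_on k (\<lambda>x. f x + g x) S"
proof (induction k arbitrary: f g)
  case 0
  then show ?case by (auto intro: continuous_on_add)
next
  case (Suc k)
  from Suc.prems(1) obtain f' where f': "\<And>x. x\<in>S \<Longrightarrow> (f has_derivative f' x) (at x within S)"
    "\<And>v. Ck_on k (\<lambda>x. f' x v) S" by (rule Ck_on_SucE) blast
  from Suc.prems(2) obtain g' where g': "\<And>x. x\<in>S \<Longrightarrow> (g has_derivative g' x) (at x within S)"
    "\<And>v. Ck_on k (\<lambda>x. g' x v) S" by (rule Ck_on_SucE) blast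
  show ?case
    by (rule Ck_on_SucI[OF has_derivative_add[OF f'(1) g'(1)] Suc.IH[OF f'(2) g'(2)]])
qed

lemma Ck_on_mult:
  fixes f g :: "'w::real_normed_vector \<Rightarrow> real"
  shows "Ck_on k f S \<Longrightarrow> Ck_on k g S \<Longrightarrow> Ck_on k (\<lambda>x. f x * g x) S"
proof (induction k arbitrary: f g)
  case 0
  then show ?case by (auto intro: continuous_on_mult)
next
  case (Suc k)
  from Suc.prems(1) obtain f' where f': "\<And>x. x\<in>S \<Longrightarrow> (f has_derivative f' x) (at x within S)"
    "\<And>v. Ck_on k (\<lambda>x. f' x v) S" by (rule Ck_on_SucE) blast
  from Suc.prems(2) obtain g' where g': "\<And>x. x\<in>S \<Longrightarrow> (g has_derivative g' x) (at x within S)"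
    "\<And>v. Ck_on k (\<lambda>x. g' x v) S" by (rule Ck_on_SucE) blast
  note low = Ck_on_lower[OF Suc.prems(1)] Ck_on_lower[OF Suc.prems(2)]
  show ?case
    by (rule Ck_on_SucI[OF has_derivative_mult[OF f'(1) g'(1)]
        Ck_on_add[OF Suc.IH[OF low(1) g'(2)] Suc.IH[OF f'(2) low(2)]]])
qed

lemma has_derivative_compose_affine:
  assumes "(f has_derivative f') (at (L x + a) within S)" "bounded_linear L" "\<And>x. x \<in> T \<Longrightarrow> L x + a \<in> S"
  shows "((\<lambda>x. f (L x + a)) has_derivative (\<lambda>v. f' (L v))) (at x within T)"
proof -
  have "((\<lambda>x. L x + a) has_derivative L) (at x within T)"
    using bounded_linear_imp_has_derivative[OF assms(2)] by (auto intro!: derivative_eq_intros)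
  moreover have "(\<lambda>x. L x + a) ` T \<subseteq> S" using assms(3) by blast
  ultimately show ?thesis
    using has_derivative_in_compose[of "\<lambda>x. L x + a" L x T f f'] has_derivative_subset[OF assms(1)] by blast
qed

text \<open>An affine substitution has a constant derivative, so the derivative of the composite is
  \<open>f'\<close> after the same substitution, in the fixed direction \<open>L v\<close>; no
  product terms arise in the induction.\<close>

lemma Ck_on_compose_affine:
  assumes "Ck_on k f S" "bounded_linear L" "\<And>x. x \<in> T \<Longrightarrow> L x + a \<in> S"
  shows "Ck_on k (\<lambda>x. f (L x + a)) T"
  using assms(1)
proof (induction k arbitrary: f)
  case 0
  have "continuous_on T (\<lambda>x. L x + a)"
    using linear_continuous_on[OF assms(2)] by (intro continuous_intros)
  with 0 show ?case using assms(3) by (auto intro: continuous_on_compose2)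
next
  case (Suc k)
  from Suc.prems obtain f' where f': "\<And>x. x\<in>S \<Longrightarrow> (f has_derivative f' x) (at x within S)"
    "\<And>v. Ck_on k (\<lambda>x. f' x v) S" by (rule Ck_on_SucE) blast
  show ?case by (rule Ck_on_SucI[OF has_derivative_compose_affine[OF f'(1)[OF assms(3)] assms(2,3)] Suc.IH[OF f'(2)]])
qed

lemma Ck_on_linear_compose:
  assumes "bounded_linear L" "Ck_on k f S"
  shows "Ck_on k (\<lambda>x. L (f x)) S"
  using assms(2)
proof (induction k arbitrary: f)
  case 0
  then show ?case using bounded_linear.continuous_on[OF assms(1)] by simp
next
  case (Suc k)
  from Suc.prems obtain f' where f': "\<And>x. x \<in> S \<Longrightarrow> (f has_derivative f' x) (at x within S)"
    "\<And>v. Ck_on k (\<lambda>x. f' x v) S" by (rule Ck_on_SucE) blast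
  show ?case
    by (rule Ck_on_SucI[OF bounded_linear.has_derivative[OF assms(1) f'(1)] Suc.IH[OF f'(2)]])
qed

lemma smooth_on_cong: "smooth_on f S \<Longrightarrow> (\<And>x. x \<in> S \<Longrightarrow> f x = g x) \<Longrightarrow> smooth_on g S"
  unfolding smooth_on_def using Ck_on_cong by blast

lemma smooth_on_const: "smooth_on (\<lambda>x. c) S"
  unfolding smooth_on_def using Ck_on_const by blast

lemma smooth_on_linear: "bounded_linear L \<Longrightarrow> smooth_on L S"
  unfolding smooth_on_def using Ck_on_linear by blast

lemma smooth_on_add: "smooth_on f S \<Longrightarrow> smooth_on g S \<Longrightarrow> smooth_on (\<lambda>x. f x + g x) S"
  unfolding smooth_on_def using Ck_on_add by blast

lemma smooth_on_mult:
  fixes f g :: "'w::real_normed_vector \<Rightarrow> real"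
  shows "smooth_on f S \<Longrightarrow> smooth_on g S \<Longrightarrow> smooth_on (\<lambda>x. f x * g x) S"
  unfolding smooth_on_def using Ck_on_mult by blast

lemma smooth_on_cmult:
  fixes f :: "'w::real_normed_vector \<Rightarrow> real"
  shows "smooth_on f S \<Longrightarrow> smooth_on (\<lambda>x. c * f x) S"
  by (rule smooth_on_mult[OF smooth_on_const])

lemma smooth_on_sum:
  "(\<And>i. i \<in> X \<Longrightarrow> smooth_on (f i) S) \<Longrightarrow> smooth_on (\<lambda>x. \<Sum>i\<in>X. f i x) S"
  by (induction X rule: infinite_finite_induct) (auto simp: smooth_on_const smooth_on_add)

lemma smooth_on_compose_affine:
  assumes "smooth_on f S" "bounded_linear L" "\<And>x. x \<in> T \<Longrightarrow> L x + a \<in> S"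
  shows "smooth_on (\<lambda>x. f (L x + a)) T"
  using Ck_on_compose_affine[OF _ assms(2,3)] assms(1) unfolding smooth_on_def by blast

lemma smooth_on_linear_compose:
  "bounded_linear L \<Longrightarrow> smooth_on f S \<Longrightarrow> smooth_on (\<lambda>x. L (f x)) S"
  unfolding smooth_on_def using Ck_on_linear_compose by blast

section \<open>Rules for derivatives within corner sets\<close>

abbreviation deriv_on :: "'w set \<Rightarrow> ('w::real_normed_vector \<Rightarrow> 'b::real_normed_vector) \<Rightarrow> 'w \<Rightarrow> 'w \<Rightarrow> 'b"
  where "deriv_on S f x \<equiv> frechet_derivative f (at x within S)"

lemma smooth_on_has_derivative:
  assumes "smooth_on f S" "x \<in> S"
  shows "(f has_derivative deriv_on S f x) (at x within S)"
proof -
  have "Ck_on (Suc 0) f S" using assms(1) unfolding smooth_on_def by blast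
  then have "f differentiable (at x within S)" using assms(2) by (auto simp: differentiable_def)
  then show ?thesis by (simp add: frechet_derivative_works)
qed

lemma smooth_on_linear_deriv_on:
  "smooth_on f S \<Longrightarrow> x \<in> S \<Longrightarrow> linear (deriv_on S f x)"
  using smooth_on_has_derivative has_derivative_linear by blast

lemma deriv_onI:
  assumes "corner_set S" "x \<in> S" "(f has_derivative f') (at x within S)"
  shows "deriv_on S f x = f'"
  using corner_set_frechet_derivative[OF assms] .

text \<open>For each order \<open>Ck_on\<close> supplies its own choice of derivative; uniqueness on
  corner sets identifies all of them with \<open>deriv_on\<close>.\<close>

lemma smooth_on_deriv_on:
  assumes "corner_set S" "smooth_on f S"
  shows "smooth_on (\<lambda>x. deriv_on S f x v) S"
  unfolding smooth_on_def
proof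
  fix k
  have "Ck_on (Suc k) f S" using assms(2) unfolding smooth_on_def by blast
  then obtain f' where f': "\<And>x. x\<in>S \<Longrightarrow> (f has_derivative f' x) (at x within S)"
    "Ck_on k (\<lambda>x. f' x v) S" by auto
  show "Ck_on k (\<lambda>x. deriv_on S f x v) S"
    by (rule Ck_on_cong[OF _ f'(2)]) (simp add: deriv_onI[OF assms(1) _ f'(1)])
qed

lemma deriv_on_cong:
  assumes "corner_set S" "x \<in> S" "smooth_on g S" "\<And>y. y \<in> S \<Longrightarrow> f y = g y"
  shows "deriv_on S f x = deriv_on S g x"
  using assms by (intro deriv_onI has_derivative_transform[OF assms(2) _ smooth_on_has_derivative]) auto

lemma deriv_on_add:
  assumes "corner_set S" "x \<in> S" "smooth_on f S" "smooth_on g S"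
  shows "deriv_on S (\<lambda>x. f x + g x) x v = deriv_on S f x v + deriv_on S g x v"
  using assms by (simp add: deriv_onI[OF _ _ has_derivative_add[OF smooth_on_has_derivative smooth_on_has_derivative]])

lemma deriv_on_mult:
  fixes f g :: "'w::real_normed_vector \<Rightarrow> real"
  assumes "corner_set S" "x \<in> S" "smooth_on f S" "smooth_on g S"
  shows "deriv_on S (\<lambda>x. f x * g x) x v = f x * deriv_on S g x v + deriv_on S f x v * g x"
  using assms by (simp add: deriv_onI[OF _ _ has_derivative_mult[OF smooth_on_has_derivative smooth_on_has_derivative]])

lemma deriv_on_const:
  assumes "corner_set S" "x \<in> S"
  shows "deriv_on S (\<lambda>x. c) x v = 0"
  using assms by (simp add: deriv_onI[OF _ _ has_derivative_const])

lemma deriv_on_cmult: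
  fixes f :: "'w::real_normed_vector \<Rightarrow> real"
  assumes "corner_set S" "x \<in> S" "smooth_on f S"
  shows "deriv_on S (\<lambda>x. c * f x) x v = c * deriv_on S f x v"
  using assms by (simp add: deriv_on_mult smooth_on_const deriv_on_const)

lemma deriv_on_diff:
  fixes f :: "'w::real_normed_vector \<Rightarrow> real"
  assumes "corner_set S" "x \<in> S" "smooth_on f S" "smooth_on g S"
  shows "deriv_on S (\<lambda>x. f x - g x) x v = deriv_on S f x v - deriv_on S g x v"
  using assms by (simp add: deriv_onI[OF _ _ has_derivative_diff[OF smooth_on_has_derivative smooth_on_has_derivative]])

lemma deriv_on_sum:
  assumes "corner_set S" "x \<in> S" "\<And>i. i \<in> X \<Longrightarrow> smooth_on (f i) S"
  shows "deriv_on S (\<lambda>x. \<Sum>i\<in>X. f i x) x v = (\<Sum>i\<in>X. deriv_on S (f i) x v)"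
  using assms(3) by (induction X rule: infinite_finite_induct)
    (simp_all add: deriv_on_const deriv_on_add smooth_on_sum assms(1,2))

lemma deriv_on_compose_affine:
  assumes "corner_set T" "x \<in> T" "smooth_on f S" "bounded_linear L" "\<And>x. x \<in> T \<Longrightarrow> L x + a \<in> S"
  shows "deriv_on T (\<lambda>x. f (L x + a)) x v = deriv_on S f (L x + a) (L v)"
  using deriv_onI[OF assms(1,2) has_derivative_compose_affine[OF smooth_on_has_derivative[OF assms(3)] assms(4,5)]] assms(2,5)
  by simp

lemma deriv_on_commute:
  assumes S: "corner_set S" "x \<in> S" and f: "smooth_on f S"
  shows "deriv_on S (\<lambda>y. deriv_on S f y v) x w = deriv_on S (\<lambda>y. deriv_on S f y w) x v"
  by (rule corner_set_symmetric_derivative[OF S, of f "deriv_on S f" "\<lambda>w v. deriv_on S (\<lambda>y. deriv_on S f y v) x w", symmetric])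
    (auto intro!: smooth_on_has_derivative smooth_on_deriv_on S f)

section \<open>Differentiation of integrals over slices\<close>

text \<open>\<open>J\<close> may be unbounded or lack its right endpoint, so it is compared with a
  compact interval: either some \<open>b\<close> in \<open>J\<close> exceeds \<open>t\<close> and
  \<open>{0..b}\<close> agrees with \<open>J\<close> near \<open>t\<close>, or
  \<open>J = {0..t}\<close>.\<close>

lemma integral_upper_limit_has_derivative:
  fixes f :: "real \<Rightarrow> real"
  assumes J: "is_interval J" "0 \<in> J" "J \<subseteq> {0..}" and f: "continuous_on J f" and t: "t \<in> J"
  shows "((\<lambda>t. integral {0..t} f) has_derivative (\<lambda>h. h * f t)) (at t within J)"
proof (cases "\<exists>b\<in>J. b > t")
  case True
  then obtain b where b: "b \<in> J" "b > t" by blast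
  have sub: "{0..b} \<subseteq> J" using J b unfolding is_interval_1 by (meson atLeastAtMost_iff subsetI)
  have "at t within J = at t within {0..b}"
    by (rule at_within_nhd[of t "{..<b}"]) (use b J sub in auto)
  then show ?thesis
    using integral_has_vector_derivative[OF continuous_on_subset[OF f sub], of t] t J b
    by (auto simp: has_vector_derivative_def)
next
  case False
  have "{0..t} \<subseteq> J" using J t unfolding is_interval_1 by (meson atLeastAtMost_iff subsetI)
  then have "J = {0..t}" using False J by force
  then show ?thesis
    using integral_has_vector_derivative[of 0 t f t] f t by (auto simp: has_vector_derivative_def)
qed

text \<open>The sets \<open>S\<close> are stable under changing the coordinate \<open>l\<close> along \<open>e\<close> to any value in \<open>J\<close>;
  \<open>x \<mapsto> \<mu> x + b0\<close> is an upper integration limit.\<close>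

locale slices =
  fixes S :: "'w::banach set" and J :: "real set" and e :: 'w and l :: "'w \<Rightarrow> real"
    and \<mu> :: "'w \<Rightarrow> real" and b0 :: real
  assumes fin: "\<exists>F::'w set. finite F \<and> span F = UNIV"
    and S: "corner_set S"
    and J: "is_interval J" "0 \<in> J" "J \<subseteq> {0..}"
    and l: "bounded_linear l" "l e = 1" "\<And>x. x \<in> S \<Longrightarrow> l x \<in> J"
    and slice_in: "\<And>x s. x \<in> S \<Longrightarrow> s \<in> J \<Longrightarrow> x + (s - l x) *\<^sub>R e \<in> S"
    and \<mu>: "bounded_linear \<mu>" "\<And>x. x \<in> S \<Longrightarrow> \<mu> x + b0 \<in> J"
begin

sublocale l: bounded_linear l by (rule l(1))
sublocale \<mu>: bounded_linear \<mu> by (rule \<mu>(1))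

definition slice :: "'w \<Rightarrow> real \<Rightarrow> 'w" where "slice x s = x + (s - l x) *\<^sub>R e"
text \<open>The projection along \<open>e\<close> onto the kernel of \<open>l\<close>; it is the
  derivative of \<open>slice x s\<close> in \<open>x\<close> for fixed \<open>s\<close>.\<close>

definition shadow :: "'w \<Rightarrow> 'w" where "shadow v = v - l v *\<^sub>R e"
definition bound :: "'w \<Rightarrow> real" where "bound x = \<mu> x + b0"
definition slice_integral :: "('w \<Rightarrow> real) \<Rightarrow> 'w \<Rightarrow> real"
  where "slice_integral g x = integral {0..bound x} (\<lambda>s. g (slice x s))"

lemma slice_S: "x \<in> S \<Longrightarrow> s \<in> J \<Longrightarrow> slice x s \<in> S"
  using slice_in by (simp add: slice_def)

lemma bound_J: "x \<in> S \<Longrightarrow> bound x \<in> J"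
  using \<mu>(2) by (simp add: bound_def)

lemma segment_J: "t \<in> J \<Longrightarrow> {0..t} \<subseteq> J"
  using J unfolding is_interval_1 by (meson atLeastAtMost_iff subsetI)

lemma bounded_linear_shadow: "bounded_linear shadow"
  unfolding shadow_def
  by (intro bounded_linear_sub bounded_linear_ident bounded_linear_scaleR_const l(1))

sublocale shadow: bounded_linear shadow by (rule bounded_linear_shadow)

lemma slice_affine: "slice x s = shadow x + s *\<^sub>R e"
  by (simp add: slice_def shadow_def algebra_simps)

lemma continuous_on_slice: "continuous_on X (\<lambda>(y, s). slice y s)"
  unfolding slice_def case_prod_beta by (intro continuous_intros l.continuous_on)

lemma continuous_on_slice2:
  assumes "continuous_on S g" "U \<subseteq> S" "K \<subseteq> J"
  shows "continuous_on (U \<times> K) (\<lambda>(y, s). g (slice y s))"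
  using continuous_on_compose2[OF assms(1) continuous_on_slice, of "U \<times> K"] assms(2,3) slice_S
  by (auto simp: case_prod_beta image_subset_iff)

lemma continuous_on_slice_fixed:
  assumes "continuous_on S g" "y \<in> S" "K \<subseteq> J"
  shows "continuous_on K (\<lambda>s. g (slice y s))"
proof (rule continuous_on_compose2[OF assms(1)])
  show "continuous_on K (slice y)" unfolding slice_def by (intro continuous_intros)
qed (use assms slice_S in blast)

lemma slice_integrable:
  fixes g :: "'w \<Rightarrow> real"
  assumes "continuous_on S g" "y \<in> S" "t \<in> J"
  shows "(\<lambda>s. g (slice y s)) integrable_on {0..t}"
  by (rule integrable_continuous_real[OF continuous_on_slice_fixed[OF assms(1,2) segment_J[OF assms(3)]]])

text \<open>The Leibniz rule asks for a derivative that is continuous as an operator. It is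
  assembled from finitely many coordinates, each of which is a continuous directional
  derivative.\<close>

lemma slice_integral_fixed_has_derivative:
  fixes g :: "'w \<Rightarrow> real"
  assumes g: "\<And>x. x \<in> S \<Longrightarrow> (g has_derivative g' x) (at x within S)"
    and g': "\<And>v. continuous_on S (\<lambda>x. g' x v)"
    and U: "convex U" "U \<subseteq> S" "x \<in> U" and t: "t \<in> J"
  shows "((\<lambda>y. integral {0..t} (\<lambda>s. g (slice y s))) has_derivative
      (\<lambda>v. integral {0..t} (\<lambda>s. g' (slice x s) (shadow v)))) (at x within U)"
proof -
  obtain F :: "'w set" where F: "finite F" "span F = UNIV" using fin by blast
  obtain B c where B: "finite B" "\<And>b::'w. bounded_linear (c b)" "\<And>v::'w. v = (\<Sum>b\<in>B. c b v *\<^sub>R b)"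
    using finite_span_coordinates[OF F] by blast
  define T where "T y s = (\<Sum>b\<in>B. g' (slice y s) (shadow b) *\<^sub>R Blinfun (c b))" for y s
  have T: "blinfun_apply (T y s) = (\<lambda>v. g' (slice y s) (shadow v))" if "y \<in> S" "s \<in> J" for y s
  proof
    fix v
    have "linear (g' (slice y s))" using g[OF slice_S[OF that]] by (rule has_derivative_linear)
    then have lin: "linear (\<lambda>v. g' (slice y s) (shadow v))"
      using linear_compose[OF shadow.linear] by (simp add: o_def)
    have "g' (slice y s) (shadow v) = g' (slice y s) (shadow (\<Sum>b\<in>B. c b v *\<^sub>R b))"
      using B(3)[of v] by simp
    also have "\<dots> = (\<Sum>b\<in>B. c b v * g' (slice y s) (shadow b))"
      by (simp add: linear_sum[OF lin] linear_scale[OF lin])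
    finally show "blinfun_apply (T y s) v = g' (slice y s) (shadow v)"
      by (simp add: T_def blinfun.sum_left blinfun.scaleR_left bounded_linear_Blinfun_apply B(2) mult.commute)
  qed
  have cT: "continuous_on (U \<times> {0..t}) (\<lambda>(y, s). T y s)"
    unfolding T_def case_prod_beta
    using continuous_on_slice2[OF g' U(2) segment_J[OF t]]
    by (intro continuous_on_sum continuous_on_scaleR continuous_on_const) (auto simp: case_prod_beta)
  have cg: "continuous_on S g" using g has_derivative_continuous_on by blast
  have "((\<lambda>y. integral (cbox 0 t) (\<lambda>s. g (slice y s))) has_derivative integral (cbox 0 t) (T x)) (at x within U)"
  proof (rule leibniz_rule)
    fix y s assume "y \<in> U" "s \<in> cbox 0 t"
    then have ys: "y \<in> S" "s \<in> J" using U(2) segment_J[OF t] by auto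
    have "((\<lambda>y. g (shadow y + s *\<^sub>R e)) has_derivative (\<lambda>v. g' (slice y s) (shadow v))) (at y within U)"
      using g[OF slice_S[OF ys]] slice_S[OF _ ys(2)] U(2)
      by (intro has_derivative_compose_affine[OF _ bounded_linear_shadow]) (auto simp: slice_affine)
    then show "((\<lambda>y. g (slice y s)) has_derivative blinfun_apply (T y s)) (at y within U)"
      by (simp add: T[OF ys] slice_affine)
  next
    fix y assume "y \<in> U"
    then show "(\<lambda>s. g (slice y s)) integrable_on cbox 0 t"
      using slice_integrable[OF cg _ t] U(2) by auto
  qed (use U cT in auto)
  moreover have "blinfun_apply (integral (cbox 0 t) (T x)) = (\<lambda>v. integral {0..t} (\<lambda>s. g' (slice x s) (shadow v)))"
  proof
    fix v
    have "continuous_on {0..t} (\<lambda>s. (x, s))" "(\<lambda>s. (x, s)) ` {0..t} \<subseteq> U \<times> {0..t}"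
      using U(3) by (auto intro: continuous_on_Pair continuous_on_const continuous_on_id)
    from continuous_on_compose2[OF cT this] have "continuous_on {0..t} (T x)" by simp
    then have "T x integrable_on cbox 0 t" using integrable_continuous_real by auto
    from blinfun_apply_integral[OF this, of v]
    show "blinfun_apply (integral (cbox 0 t) (T x)) v = integral {0..t} (\<lambda>s. g' (slice x s) (shadow v))"
      using T[OF subsetD[OF U(2,3)]] segment_J[OF t]
      by (auto intro!: Henstock_Kurzweil_Integration.integral_cong)
  qed
  ultimately show ?thesis by (simp only: cbox_interval)
qed

text \<open>The integral is differentiated as a function of the point and an independent upper
  limit, and then composed with \<open>y \<mapsto> (y, bound y)\<close>. The moving limit
  contributes the term with \<mu>.\<close>

lemma slice_integral_has_derivative:
  fixes g :: "'w \<Rightarrow> real"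
  assumes g: "\<And>x. x \<in> S \<Longrightarrow> (g has_derivative g' x) (at x within S)"
    and g': "\<And>v. continuous_on S (\<lambda>x. g' x v)" and x: "x \<in> S"
  shows "(slice_integral g has_derivative
     (\<lambda>v. \<mu> v * g (slice x (bound x)) + slice_integral (\<lambda>y. g' y (shadow v)) x)) (at x within S)"
proof -
  from S x obtain N where N: "open N" "x \<in> N" "convex (N \<inter> S)"
    unfolding corner_set_def by meson
  \<comment> \<open>The Leibniz rule needs a convex domain. Since \<open>N\<close> is open,
    derivatives at \<open>x\<close> within \<open>U\<close> and within \<open>S\<close> are the
    same.\<close>
  define U where "U = N \<inter> S"
  have U: "convex U" "U \<subseteq> S" "x \<in> U" using N x by (auto simp: U_def)
  have cg: "continuous_on S g" using g has_derivative_continuous_on by blast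
  \<comment> \<open>The partial derivative in the upper limit as an operator; its continuity in both
    variables yields joint differentiability.\<close>
  define fy where "fy y t = g (slice y t) *\<^sub>R (id_blinfun :: real \<Rightarrow>\<^sub>L real)" for y and t :: real
  have joint: "((\<lambda>(y, t). integral {0..t} (\<lambda>s. g (slice y s))) has_derivative
     (\<lambda>(ty, tt). integral {0..bound x} (\<lambda>s. g' (slice x s) (shadow ty)) + blinfun_apply (fy x (bound x)) tt))
     (at (x, bound x) within U \<times> J)"
  proof (rule has_derivative_partialsI)
    show "((\<lambda>y. integral {0..bound x} (\<lambda>s. g (slice y s))) has_derivative
        (\<lambda>ty. integral {0..bound x} (\<lambda>s. g' (slice x s) (shadow ty)))) (at x within U)"
      by (rule slice_integral_fixed_has_derivative[OF g g' U bound_J[OF x]])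
    show "((\<lambda>t. integral {0..t} (\<lambda>s. g (slice y s))) has_derivative blinfun_apply (fy y t)) (at t within J)"
      if "y \<in> U" "t \<in> J" for y t
    proof -
      have "blinfun_apply (fy y t) = (\<lambda>h. h * g (slice y t))" by (auto simp: fy_def blinfun.scaleR_left)
      then show ?thesis
        using integral_upper_limit_has_derivative[OF J continuous_on_slice_fixed[OF cg] that(2)] that U(2) by auto
    qed
    have "continuous_on (U \<times> J) (\<lambda>(y, t). fy y t)"
      using continuous_on_slice2[OF cg U(2) order_refl] unfolding fy_def case_prod_beta
      by (intro continuous_on_scaleR continuous_on_const) 
    then show "continuous (at (x, bound x) within U \<times> J) (\<lambda>(y, t). fy y t)"
      using U(3) bound_J[OF x] by (simp add: continuous_on_eq_continuous_within)
  qed (use bound_J x J in \<open>auto simp: is_interval_convex\<close>)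
  have pair: "((\<lambda>y. (y, bound y)) has_derivative (\<lambda>v. (v, \<mu> v))) (at x within U)"
    unfolding bound_def using bounded_linear_imp_has_derivative[OF \<mu>(1)] by (auto intro!: derivative_eq_intros)
  have sub: "(\<lambda>y. (y, bound y)) ` U \<subseteq> U \<times> J" using U(2) bound_J by auto
  have "((\<lambda>y. (\<lambda>(y, t). integral {0..t} (\<lambda>s. g (slice y s))) (y, bound y)) has_derivative
     (\<lambda>v. (\<lambda>(ty, tt). integral {0..bound x} (\<lambda>s. g' (slice x s) (shadow ty)) + blinfun_apply (fy x (bound x)) tt)
       (v, \<mu> v))) (at x within U)"
    by (rule has_derivative_in_compose[OF pair has_derivative_subset[OF joint sub]])
  then have "(slice_integral g has_derivative
     (\<lambda>v. \<mu> v * g (slice x (bound x)) + slice_integral (\<lambda>y. g' y (shadow v)) x)) (at x within U)"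
    by (simp add: slice_integral_def[abs_def] fy_def blinfun.scaleR_left algebra_simps)
  moreover have "at x within U = at x within S"
    by (rule at_within_nhd[OF N(2,1)]) (auto simp: U_def)
  ultimately show ?thesis by simp
qed

text \<open>Giving up one derivative keeps the base case of the induction trivial; it is harmless for
  smooth functions.\<close>

lemma Ck_on_slice_integral: "Ck_on (Suc k) g S \<Longrightarrow> Ck_on k (slice_integral g) S"
proof (induction k arbitrary: g)
  case 0
  from 0 obtain g' where g': "\<And>x. x\<in>S \<Longrightarrow> (g has_derivative g' x) (at x within S)" "\<And>v. Ck_on 0 (\<lambda>x. g' x v) S"
    by (rule Ck_on_SucE) blast
  from slice_integral_has_derivative[OF g'(1) g'(2)[unfolded Ck_on.simps]]
  have "continuous_on S (slice_integral g)" by (rule has_derivative_continuous_on)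
  then show ?case by simp
next
  case (Suc k)
  from Suc.prems obtain g' where g': "\<And>x. x\<in>S \<Longrightarrow> (g has_derivative g' x) (at x within S)"
    "\<And>v. Ck_on (Suc k) (\<lambda>x. g' x v) S"
    by (rule Ck_on_SucE) blast
  have cont: "continuous_on S (\<lambda>x. g' x v)" for v
    using g'(2)[of v] by (rule Ck_on_continuous)
  have "Ck_on k (\<lambda>x. \<mu> v * g (slice x (bound x))) S" for v
  proof (rule Ck_on_mult[OF Ck_on_const])
    have eq: "slice x (bound x) = (shadow x + \<mu> x *\<^sub>R e) + b0 *\<^sub>R e" for x
      by (simp add: slice_affine bound_def algebra_simps)
    have "Ck_on k (\<lambda>x. g ((shadow x + \<mu> x *\<^sub>R e) + b0 *\<^sub>R e)) S"
      using Ck_on_lower[OF Ck_on_lower[OF Suc.prems]]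
    proof (rule Ck_on_compose_affine)
      show "bounded_linear (\<lambda>x. shadow x + \<mu> x *\<^sub>R e)"
        by (intro bounded_linear_add bounded_linear_shadow bounded_linear_scaleR_const \<mu>(1))
      show "shadow x + \<mu> x *\<^sub>R e + b0 *\<^sub>R e \<in> S" if "x \<in> S" for x
        using slice_S[OF that bound_J[OF that]] by (simp only: eq)
    qed
    then show "Ck_on k (\<lambda>x. g (slice x (bound x))) S" by (simp only: eq)
  qed
  then have "Ck_on k (\<lambda>x. \<mu> v * g (slice x (bound x)) + slice_integral (\<lambda>y. g' y (shadow v)) x) S" for v
    by (rule Ck_on_add[OF _ Suc.IH[OF g'(2)]])
  from Ck_on_SucI[OF slice_integral_has_derivative[OF g'(1) cont] this] show ?case .
qed

lemma smooth_on_slice_integral: "smooth_on g S \<Longrightarrow> smooth_on (slice_integral g) S"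
  using Ck_on_slice_integral unfolding smooth_on_def by blast

lemma smooth_on_continuous: "smooth_on g S \<Longrightarrow> continuous_on S g"
  unfolding smooth_on_def using Ck_on_continuous by blast

lemma deriv_on_slice_integral:
  assumes g: "smooth_on g S" and x: "x \<in> S"
  shows "deriv_on S (slice_integral g) x v =
    \<mu> v * g (slice x (bound x)) + slice_integral (\<lambda>y. deriv_on S g y (shadow v)) x"
  using deriv_onI[OF S x slice_integral_has_derivative[OF smooth_on_has_derivative[OF g] smooth_on_continuous[OF smooth_on_deriv_on[OF S g]] x]]
  by simp

text \<open>A slice has constant velocity \<open>e\<close>, so the integrand is the derivative of
  \<open>g\<close> along it.\<close>

lemma slice_integral_deriv_e:
  assumes g: "smooth_on g S" and x: "x \<in> S"
  shows "slice_integral (\<lambda>y. deriv_on S g y e) x = g (slice x (bound x)) - g (slice x 0)"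
proof -
  have "((\<lambda>s. g (slice x s)) has_vector_derivative deriv_on S g (slice x s) e) (at s within {0..bound x})"
    if s: "s \<in> {0..bound x}" for s
  proof -
    have sJ: "{0..bound x} \<subseteq> J" by (rule segment_J[OF bound_J[OF x]])
    have "((\<lambda>s. g (s *\<^sub>R e + shadow x)) has_derivative (\<lambda>h. deriv_on S g (slice x s) (h *\<^sub>R e))) (at s within {0..bound x})"
      using smooth_on_has_derivative[OF g slice_S[OF x subsetD[OF sJ s]]] slice_S[OF x] sJ
      by (intro has_derivative_compose_affine[OF _ bounded_linear_scaleR_left]) (auto simp: slice_affine add.commute)
    then show ?thesis
      using linear_scale[OF smooth_on_linear_deriv_on[OF g slice_S[OF x subsetD[OF sJ s]]]]
      by (simp add: has_vector_derivative_def slice_affine add.commute)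
  qed
  moreover have "0 \<le> bound x" using bound_J[OF x] J by auto
  ultimately have "((\<lambda>s. deriv_on S g (slice x s) e) has_integral g (slice x (bound x)) - g (slice x 0)) {0..bound x}"
    by (intro fundamental_theorem_of_calculus) auto
  then show ?thesis unfolding slice_integral_def by (rule integral_unique)
qed

end

section \<open>Alternating forms\<close>

lemma linear_cmult:
  fixes f :: "'a::real_vector \<Rightarrow> real"
  shows "linear f \<Longrightarrow> linear (\<lambda>x. c * f x)"
  using linear_compose_scale_right[of f c] by simp

lemma alternating_linear: "alternating_multilinear g \<Longrightarrow> linear (\<lambda>v. g (us @ v # vs))"
  by (simp add: alternating_multilinear_def)

lemma alternating_linear_Cons: "alternating_multilinear g \<Longrightarrow> linear (\<lambda>v. g (v # vs))"
  using alternating_linear[of g "[]"] by simp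

lemma alternating_not_distinct: "alternating_multilinear g \<Longrightarrow> \<not> distinct vs \<Longrightarrow> g vs = 0"
  by (simp add: alternating_multilinear_def)

lemma alternating_Cons: "alternating_multilinear g \<Longrightarrow> alternating_multilinear (\<lambda>vs. g (v # vs))"
  unfolding alternating_multilinear_def using append_Cons distinct.simps(2) by (simp del: append_Cons add: append_Cons[symmetric])

text \<open>Polarisation: the value with \<open>x + y\<close> in both slots vanishes.\<close>

lemma alternating_swap:
  assumes g: "alternating_multilinear g"
  shows "g (us @ x # y # vs) = - g (us @ y # x # vs)"
proof -
  note l1 = linear_add[OF alternating_linear[OF g, of us]]
  note l2 = linear_add[OF alternating_linear[OF g, of "us @ [_]"], simplified]
  have "g (us @ (x + y) # (x + y) # vs) = 0" "g (us @ x # x # vs) = 0" "g (us @ y # y # vs) = 0"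
    by (auto intro!: alternating_not_distinct[OF g])
  moreover have "g (us @ (x + y) # (x + y) # vs) =
      g (us @ x # x # vs) + g (us @ x # y # vs) + (g (us @ y # x # vs) + g (us @ y # y # vs))"
    by (simp only: l1 l2)
  ultimately show ?thesis by simp
qed

lemma alternating_move:
  "alternating_multilinear g \<Longrightarrow> g (us @ y # vs) = (- 1) ^ length us * g (y # us @ vs)"
proof (induction us arbitrary: g)
  case (Cons u us)
  have "g (u # us @ y # vs) = (- 1) ^ length us * g (u # y # us @ vs)"
    by (rule Cons.IH[OF alternating_Cons[OF Cons.prems]])
  also have "g (u # y # us @ vs) = - g (y # u # us @ vs)"
    using alternating_swap[OF Cons.prems, of "[]" u y "us @ vs"] by simp
  finally show ?case by simp
qed simp

text \<open>Vanishing on adjacent equal vectors gives antisymmetry under adjacent exchanges, and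
  these bring any two equal vectors together.\<close>

lemma alternatingI:
  assumes lin: "\<And>us vs. linear (\<lambda>v. g (us @ v # vs))"
    and adj: "\<And>us v vs. g (us @ v # v # vs) = 0"
  shows "alternating_multilinear g"
proof -
  have swap: "g (us @ x # y # vs) = - g (us @ y # x # vs)" for us x y vs
  proof -
    note l1 = linear_add[OF lin[of us]]
    note l2 = linear_add[OF lin[of "us @ [_]"], simplified]
    have "g (us @ (x + y) # (x + y) # vs) =
        g (us @ x # x # vs) + g (us @ x # y # vs) + (g (us @ y # x # vs) + g (us @ y # y # vs))"
      by (simp only: l1 l2)
    then show ?thesis by (simp add: adj)
  qed
  have sep: "g (us @ v # ws @ v # zs) = 0" for us v ws zs
  proof (induction ws arbitrary: us)
    case (Cons w ws)
    show ?case using swap[of us v w "ws @ v # zs"] Cons.IH[of "us @ [w]"] by simp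
  qed (simp add: adj)
  show ?thesis unfolding alternating_multilinear_def
  proof (intro conjI allI impI lin)
    fix vs :: "'a list" assume "\<not> distinct vs"
    then obtain xs y ys zs where "vs = xs @ [y] @ ys @ [y] @ zs"
      using not_distinct_decomp by blast
    then show "g vs = 0" using sep[of xs y ys zs] by simp
  qed
qed

lemma alternating_0: "alternating_multilinear (\<lambda>vs. 0)"
  by (simp add: alternating_multilinear_def module_hom_zero linear_zero)

lemma alternating_add:
  "alternating_multilinear f \<Longrightarrow> alternating_multilinear g \<Longrightarrow> alternating_multilinear (\<lambda>vs. f vs + g vs)"
  by (simp add: alternating_multilinear_def linear_compose_add)

lemma alternating_cmult:
  "alternating_multilinear f \<Longrightarrow> alternating_multilinear (\<lambda>vs. c * f vs)"
  by (simp add: alternating_multilinear_def linear_cmult)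

lemma alternating_compose_linear:
  assumes "alternating_multilinear g" "linear L"
  shows "alternating_multilinear (\<lambda>vs. g (map L vs))"
  unfolding alternating_multilinear_def
proof (intro conjI allI impI)
  show "linear (\<lambda>v. g (map L (us @ v # vs)))" for us vs
    using linear_compose[OF assms(2) alternating_linear[OF assms(1), of "map L us" "map L vs"]]
    by (simp add: o_def)
  show "g (map L vs) = 0" if "\<not> distinct vs" for vs
    using that by (intro alternating_not_distinct[OF assms(1)]) (simp add: distinct_map)
qed

section \<open>Alternating sums over an extracted vector\<close>

text \<open>The common shape of the exterior derivative and of the product with a 1-form on the
  left. The recursion \<open>altsum_Cons\<close> replaces index arithmetic by induction on the list
  of vectors.\<close>

definition altsum :: "('w \<Rightarrow> 'w list \<Rightarrow> real) \<Rightarrow> 'w list \<Rightarrow> real"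
  where "altsum F vs = (\<Sum>i<length vs. (- 1) ^ i * F (vs ! i) (del_nth i vs))"

lemma length_del_nth: "i < length vs \<Longrightarrow> length (del_nth i vs) = length vs - 1"
  by (simp add: del_nth_def min_def)

lemma map_del_nth: "map f (del_nth i vs) = del_nth i (map f vs)"
  by (simp add: del_nth_def take_map drop_map)

lemma altsum_Nil [simp]: "altsum F [] = 0"
  by (simp add: altsum_def)

lemma altsum_Cons: "altsum F (v # vs) = F v vs - altsum (\<lambda>w ws. F w (v # ws)) vs"
  unfolding altsum_def
  by (simp add: sum.lessThan_Suc_shift del_nth_def sum_negf del: sum.lessThan_Suc)

lemma altsum_cong:
  "(\<And>w ws. w \<in> set vs \<Longrightarrow> Suc (length ws) = length vs \<Longrightarrow> F w ws = G w ws) \<Longrightarrow> altsum F vs = altsum G vs"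
  unfolding altsum_def by (rule sum.cong) (auto simp: length_del_nth)

lemma altsum_zero [simp]: "altsum (\<lambda>w ws. 0) vs = 0"
  by (simp add: altsum_def)

lemma altsum_add: "altsum (\<lambda>w ws. F w ws + G w ws) vs = altsum F vs + altsum G vs"
  by (simp add: altsum_def sum.distrib algebra_simps)

lemma altsum_diff: "altsum (\<lambda>w ws. F w ws - G w ws) vs = altsum F vs - altsum G vs"
  by (simp add: altsum_def sum_subtractf algebra_simps)

lemma altsum_cmult: "altsum (\<lambda>w ws. c * F w ws) vs = c * altsum F vs"
  by (simp add: altsum_def sum_distrib_left algebra_simps)

lemma altsum_minus: "altsum (\<lambda>w ws. - F w ws) vs = - altsum F vs"
  by (simp add: altsum_def sum_negf)

lemma altsum_map: "altsum F (map L vs) = altsum (\<lambda>v ws. F (L v) (map L ws)) vs"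
  unfolding altsum_def by (intro sum.cong) (auto simp: map_del_nth)

lemma altsum_linear:
  "(\<And>w ws. linear (\<lambda>v. G v w ws)) \<Longrightarrow> linear (\<lambda>v. altsum (G v) vs)"
  unfolding altsum_def
  by (intro linear_compose_sum ballI linear_cmult)

text \<open>Induction on the vectors in front of a repeated pair. When there are none, the first two
  terms cancel and every later term still contains the pair.\<close>

lemma altsum_alternating:
  assumes "\<And>w. alternating_multilinear (F w)" "\<And>ws. linear (\<lambda>w. F w ws)"
  shows "alternating_multilinear (altsum F)"
proof (rule alternatingI)
  show "linear (\<lambda>v. altsum F (us @ v # vs))" for us vs
    using assms
  proof (induction us arbitrary: F)
    case Nil
    have "linear (\<lambda>v. altsum (\<lambda>w ws. F w (v # ws)) vs)"
      by (intro altsum_linear alternating_linear_Cons Nil(1))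
    from linear_compose_sub[OF Nil(2) this] show ?case by (simp add: altsum_Cons)
  next
    case (Cons u us)
    have "linear (\<lambda>v. altsum (\<lambda>w ws. F w (u # ws)) (us @ v # vs))"
      by (rule Cons.IH[OF alternating_Cons[OF Cons.prems(1)] Cons.prems(2)])
    from linear_compose_sub[OF alternating_linear[OF Cons.prems(1)] this] show ?case
      by (simp add: altsum_Cons)
  qed
  show "altsum F (us @ v # v # vs) = 0" for us v vs
    using assms
  proof (induction us arbitrary: F)
    case Nil
    have "F w (v # v # ws) = 0" for w ws by (rule alternating_not_distinct[OF Nil(1)]) simp
    then show ?case by (simp add: altsum_Cons)
  next
    case (Cons u us)
    have "F u (us @ v # v # vs) = 0" by (rule alternating_not_distinct[OF Cons.prems(1)]) simp
    moreover have "altsum (\<lambda>w ws. F w (u # ws)) (us @ v # v # vs) = 0"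
      by (rule Cons.IH[OF alternating_Cons[OF Cons.prems(1)] Cons.prems(2)])
    ultimately show ?case by (simp add: altsum_Cons)
  qed
qed

text \<open>Since \<open>g\<close> is alternating, only the terms with at most one factor \<open>e\<close> survive in the expansion.\<close>

lemma alternating_shadow:
  assumes "alternating_multilinear g"
  shows "g (map (\<lambda>v. v - l v *\<^sub>R e) vs) = g vs - altsum (\<lambda>w ws. l w * g (e # ws)) vs"
  using assms
proof (induction vs arbitrary: g)
  case (Cons v vs)
  let ?P = "\<lambda>v. v - l v *\<^sub>R e"
  note lin = linear_diff[OF alternating_linear_Cons[OF Cons.prems]] linear_scale[OF alternating_linear_Cons[OF Cons.prems]]
  \<comment> \<open>Adding a multiple of \<open>e\<close> to a vector does not matter next to a slot
    occupied by \<open>e\<close>.\<close>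
  have sw: "g (?P v # e # ws) = - g (e # v # ws)" for ws
    using alternating_swap[OF Cons.prems, of "[]" v e ws] alternating_not_distinct[OF Cons.prems, of "e # e # ws"]
    by (simp add: lin)
  have "g (?P v # map ?P vs) = g (?P v # vs) - altsum (\<lambda>w ws. l w * g (?P v # e # ws)) vs"
    by (rule Cons.IH[OF alternating_Cons[OF Cons.prems]])
  also have "\<dots> = g (?P v # vs) + altsum (\<lambda>w ws. l w * g (e # v # ws)) vs"
    by (simp only: sw mult_minus_right altsum_minus diff_minus_eq_add)
  also have "\<dots> = g (v # vs) - l v * g (e # vs) + altsum (\<lambda>w ws. l w * g (e # v # ws)) vs"
    by (simp add: lin)
  finally show ?case by (simp add: altsum_Cons)
qed simp

section \<open>The exterior derivative in a chart\<close>

definition d_local :: "'w set \<Rightarrow> ('w::real_normed_vector \<Rightarrow> 'w list \<Rightarrow> real) \<Rightarrow> 'w \<Rightarrow> 'w list \<Rightarrow> real"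
  where "d_local S \<omega> x = altsum (\<lambda>v vs. deriv_on S (\<lambda>y. \<omega> y vs) x v)"

text \<open>Cartan's formula for the constant field \<open>v\<close>: contraction after
  \<open>d\<close> is the Lie derivative minus \<open>d\<close> after contraction.\<close>

lemma d_local_Cons:
  "d_local S \<omega> x (v # vs) = deriv_on S (\<lambda>y. \<omega> y vs) x v - d_local S (\<lambda>y us. \<omega> y (v # us)) x vs"
  by (simp add: d_local_def altsum_Cons)

lemma smooth_on_altsum:
  assumes "\<And>v vs. smooth_on (\<lambda>x. F x v vs) S"
  shows "smooth_on (\<lambda>x. altsum (F x) vs) S"
  unfolding altsum_def by (intro smooth_on_sum smooth_on_cmult assms)

lemma deriv_on_altsum:
  assumes "corner_set S" "x \<in> S" "\<And>v vs. smooth_on (\<lambda>x. F x v vs) S"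
  shows "deriv_on S (\<lambda>x. altsum (F x) vs) x w = altsum (\<lambda>v vs. deriv_on S (\<lambda>x. F x v vs) x w) vs"
  unfolding altsum_def
  by (simp add: deriv_on_sum[OF assms(1,2)] deriv_on_cmult[OF assms(1,2)] smooth_on_cmult assms(3))

context
  fixes S :: "'w::real_normed_vector set"
  assumes S: "corner_set S"
begin

lemma smooth_on_d_local:
  assumes "\<And>vs. smooth_on (\<lambda>x. \<omega> x vs) S"
  shows "smooth_on (\<lambda>x. d_local S \<omega> x vs) S"
  unfolding d_local_def by (intro smooth_on_altsum smooth_on_deriv_on S assms)

lemma d_local_cong:
  assumes "x \<in> S" "\<And>vs. smooth_on (\<lambda>x. \<omega> x vs) S" "\<And>y vs. y \<in> S \<Longrightarrow> \<omega>' y vs = \<omega> y vs"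
  shows "d_local S \<omega>' x vs = d_local S \<omega> x vs"
proof -
  have "deriv_on S (\<lambda>y. \<omega>' y vs) x = deriv_on S (\<lambda>y. \<omega> y vs) x" for vs
    using assms by (intro deriv_on_cong S) auto
  then show ?thesis by (simp add: d_local_def)
qed

lemma d_local_diff:
  assumes "x \<in> S" "\<And>vs. smooth_on (\<lambda>x. \<alpha> x vs) S" "\<And>vs. smooth_on (\<lambda>x. \<beta> x vs) S"
  shows "d_local S (\<lambda>x vs. \<alpha> x vs - \<beta> x vs) x vs = d_local S \<alpha> x vs - d_local S \<beta> x vs"
  by (simp add: d_local_def deriv_on_diff[OF S assms] altsum_diff)

text \<open>Expanding by Cartan's formula twice, the two terms with the Lie derivative along the
  first vector cancel, since it commutes with \<open>d\<close> by symmetry of second derivatives.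
  What remains is \<open>d d\<close> of a contraction, covered by the induction hypothesis.\<close>

lemma d_local_d_local:
  assumes "x \<in> S" "\<And>vs. smooth_on (\<lambda>x. \<omega> x vs) S"
  shows "d_local S (d_local S \<omega>) x vs = 0"
  using assms
proof (induction vs arbitrary: \<omega> x)
  case Nil
  then show ?case by (simp add: d_local_def)
next
  case (Cons v vs)
  note sm = Cons.prems(2)
  have 1: "deriv_on S (\<lambda>y. d_local S \<omega> y vs) x v = d_local S (\<lambda>y us. deriv_on S (\<lambda>z. \<omega> z us) y v) x vs"
    unfolding d_local_def using Cons.prems(1)
    by (simp add: deriv_on_altsum[OF S] smooth_on_deriv_on[OF S sm] deriv_on_commute[OF S _ sm])
  have "d_local S (\<lambda>y us. d_local S \<omega> y (v # us)) x vs =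
      d_local S (\<lambda>y us. deriv_on S (\<lambda>z. \<omega> z us) y v - d_local S (\<lambda>z ws. \<omega> z (v # ws)) y us) x vs"
    by (simp add: d_local_Cons)
  also have "\<dots> = d_local S (\<lambda>y us. deriv_on S (\<lambda>z. \<omega> z us) y v) x vs
      - d_local S (d_local S (\<lambda>z ws. \<omega> z (v # ws))) x vs"
    by (rule d_local_diff) (auto intro!: smooth_on_deriv_on smooth_on_d_local S sm Cons.prems)
  also have "d_local S (d_local S (\<lambda>z ws. \<omega> z (v # ws))) x vs = 0"
    by (rule Cons.IH[OF Cons.prems(1) sm])
  finally show ?case by (simp add: d_local_Cons 1)
qed

text \<open>Directional derivatives of the coefficients inherit linearity and alternation, because
  these are identities valid on all of \<open>S\<close>.\<close>

lemma d_local_alternating: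
  assumes x: "x \<in> S" and sm: "\<And>vs. smooth_on (\<lambda>x. \<omega> x vs) S"
    and alt: "\<And>y. y \<in> S \<Longrightarrow> alternating_multilinear (\<omega> y)"
  shows "alternating_multilinear (d_local S \<omega> x)"
  unfolding d_local_def
proof (rule altsum_alternating)
  show "linear (\<lambda>w. deriv_on S (\<lambda>y. \<omega> y ws) x w)" for ws
    using smooth_on_linear_deriv_on[OF sm x] .
  show "alternating_multilinear (\<lambda>vs. deriv_on S (\<lambda>y. \<omega> y vs) x w)" for w
    unfolding alternating_multilinear_def
  proof (intro conjI allI impI)
    fix us vs
    show "linear (\<lambda>v. deriv_on S (\<lambda>y. \<omega> y (us @ v # vs)) x w)"
    proof (rule linearI)
      fix a b :: 'w and r :: real
      have "deriv_on S (\<lambda>y. \<omega> y (us @ (a + b) # vs)) x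
          = deriv_on S (\<lambda>y. \<omega> y (us @ a # vs) + \<omega> y (us @ b # vs)) x"
        by (intro deriv_on_cong S x smooth_on_add sm) (simp add: linear_add[OF alternating_linear[OF alt]])
      then show "deriv_on S (\<lambda>y. \<omega> y (us @ (a + b) # vs)) x w =
          deriv_on S (\<lambda>y. \<omega> y (us @ a # vs)) x w + deriv_on S (\<lambda>y. \<omega> y (us @ b # vs)) x w"
        by (simp add: deriv_on_add[OF S x sm sm])
      have "deriv_on S (\<lambda>y. \<omega> y (us @ (r *\<^sub>R b) # vs)) x = deriv_on S (\<lambda>y. r * \<omega> y (us @ b # vs)) x"
        by (intro deriv_on_cong S x smooth_on_cmult sm) (simp add: linear_scale[OF alternating_linear[OF alt]])
      then show "deriv_on S (\<lambda>y. \<omega> y (us @ (r *\<^sub>R b) # vs)) x w = r *\<^sub>R deriv_on S (\<lambda>y. \<omega> y (us @ b # vs)) x w"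
        by (simp add: deriv_on_cmult[OF S x sm])
    qed
  next
    fix vs :: "'w list" assume nd: "\<not> distinct vs"
    have "deriv_on S (\<lambda>y. \<omega> y vs) x = deriv_on S (\<lambda>y. 0) x"
      by (intro deriv_on_cong S x smooth_on_const) (simp add: alternating_not_distinct[OF alt nd])
    then show "deriv_on S (\<lambda>y. \<omega> y vs) x w = 0" by (simp add: deriv_on_const[OF S x])
  qed
qed

end

section \<open>Change of coordinates\<close>

text \<open>The derivative of \<open>x \<mapsto> g (map (T x) ws)\<close> when \<open>B v w\<close> is the derivative of \<open>x \<mapsto> T x w\<close>
  in the direction \<open>v\<close>: one vector after the other is differentiated.\<close>

primrec slot_deriv :: "('w \<Rightarrow> 'x) \<Rightarrow> ('w \<Rightarrow> 'x) \<Rightarrow> 'w list \<Rightarrow> ('x list \<Rightarrow> real) \<Rightarrow> real" where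
  "slot_deriv T Bv [] g = 0"
| "slot_deriv T Bv (w # ws) g = g (Bv w # map T ws) + slot_deriv T Bv ws (\<lambda>us. g (T w # us))"

text \<open>Moving the differentiated vector to the front past the vectors before it produces the
  alternating signs.\<close>

lemma slot_deriv_altsum:
  "alternating_multilinear g \<Longrightarrow> slot_deriv T Bv vs g = altsum (\<lambda>w ws. g (Bv w # map T ws)) vs"
proof (induction vs arbitrary: g)
  case (Cons u us)
  have "g (T u # Bv w # map T ws) = - g (Bv w # T u # map T ws)" for w ws
    using alternating_swap[OF Cons.prems, of "[]" "T u" "Bv w" "map T ws"] by simp
  then show ?case
    using Cons.IH[OF alternating_Cons[OF Cons.prems], of "T u"] by (simp add: altsum_Cons altsum_minus)
qed simp

text \<open>The second derivatives of a change of coordinates cancel in the exterior derivative.\<close>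

lemma altsum_slot_deriv:
  assumes "alternating_multilinear g" "\<And>v w. B v w = B w v"
  shows "altsum (\<lambda>v vs. slot_deriv T (B v) vs g) vs = 0"
  using assms(1)
proof (induction vs arbitrary: g)
  case (Cons v vs)
  have "altsum (\<lambda>w ws. slot_deriv T (B w) ws (\<lambda>us. g (T v # us))) vs = 0"
    by (rule Cons.IH[OF alternating_Cons[OF Cons.prems]])
  \<comment> \<open>By symmetry the derivative of \<open>v\<close> in direction \<open>w\<close> is
    that of \<open>w\<close> in direction \<open>v\<close>. Summed over \<open>w\<close>, these
    terms match the term of \<open>altsum_Cons\<close> that extracts \<open>v\<close>, by
    \<open>slot_deriv_altsum\<close>.\<close>
  moreover have "slot_deriv T (B w) (v # ws) g = g (B v w # map T ws) + slot_deriv T (B w) ws (\<lambda>us. g (T v # us))" for w ws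
    by (simp add: assms(2)[of w v])
  ultimately have "altsum (\<lambda>w ws. slot_deriv T (B w) (v # ws) g) vs = altsum (\<lambda>w ws. g (B v w # map T ws)) vs"
    by (simp only: altsum_add add_0_right)
  then show ?case
    by (simp only: altsum_Cons slot_deriv_altsum[OF Cons.prems, of T "B v" vs] diff_self)
qed simp

lemma slot_deriv_sum:
  "slot_deriv T Bv ws (\<lambda>us. \<Sum>b\<in>X. c b * g b us) = (\<Sum>b\<in>X. c b * slot_deriv T Bv ws (g b))"
  by (induction ws arbitrary: g) (simp_all add: sum.distrib algebra_simps)

text \<open>Smoothness of \<omega> is known only for fixed vectors, whereas here the vectors vary
  with \<open>x\<close>. The first vector is therefore expanded in a basis, which turns its
  dependence on \<open>x\<close> into scalar factors for the product rule.\<close>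

lemma change_of_coordinates_has_derivative:
  fixes \<omega> :: "'x::real_normed_vector \<Rightarrow> 'x list \<Rightarrow> real" and V :: "'w::real_normed_vector set"
  assumes fin: "\<exists>F::'x set. finite F \<and> span F = UNIV"
    and S: "corner_set S" and sm: "\<And>vs. smooth_on (\<lambda>x. \<omega> x vs) S"
    and alt: "\<And>y. y \<in> S \<Longrightarrow> alternating_multilinear (\<omega> y)"
    and \<tau>: "(\<tau> has_derivative T x) (at x within V)" "\<tau> ` V \<subseteq> S" "x \<in> V"
    and T: "\<And>w. ((\<lambda>x. T x w) has_derivative (\<lambda>v. B v w)) (at x within V)"
  shows "((\<lambda>x. \<omega> (\<tau> x) (map (T x) ws)) has_derivative
    (\<lambda>v. deriv_on S (\<lambda>y. \<omega> y (map (T x) ws)) (\<tau> x) (T x v) + slot_deriv (T x) (B v) ws (\<omega> (\<tau> x)))) (at x within V)"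
  using sm alt
proof (induction ws arbitrary: \<omega>)
  case Nil
  have "((\<lambda>y. \<omega> y []) has_derivative deriv_on S (\<lambda>y. \<omega> y []) (\<tau> x)) (at (\<tau> x) within S)"
    using \<tau> by (intro smooth_on_has_derivative Nil) auto
  from has_derivative_in_compose[OF \<tau>(1) has_derivative_subset[OF this \<tau>(2)]] show ?case by simp
next
  case (Cons w ws)
  obtain F :: "'x set" where F: "finite F" "span F = UNIV" using fin by blast
  obtain X c where X: "finite X" "\<And>b::'x. bounded_linear (c b)" "\<And>v::'x. v = (\<Sum>b\<in>X. c b v *\<^sub>R b)"
    by (rule finite_span_coordinates[OF F]) blast
  have \<tau>x: "\<tau> x \<in> S" using \<tau> by blast
  have expand: "\<omega> y (u # us) = (\<Sum>b\<in>X. c b u * \<omega> y (b # us))" if "y \<in> S" for y u us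
  proof -
    note lin = alternating_linear_Cons[OF Cons.prems(2)[OF that]]
    have "\<omega> y (u # us) = \<omega> y ((\<Sum>b\<in>X. c b u *\<^sub>R b) # us)" using X(3)[of u] by simp
    then show ?thesis by (simp add: linear_sum[OF lin] linear_scale[OF lin])
  qed
  let ?D = "\<lambda>b v. deriv_on S (\<lambda>y. \<omega> y (b # map (T x) ws)) (\<tau> x) (T x v)"
  let ?Q = "\<lambda>b v. slot_deriv (T x) (B v) ws (\<lambda>us. \<omega> (\<tau> x) (b # us))"
  have "((\<lambda>x. c b (T x w) * \<omega> (\<tau> x) (b # map (T x) ws)) has_derivative
      (\<lambda>v. c b (T x w) * (?D b v + ?Q b v) + c b (B v w) * \<omega> (\<tau> x) (b # map (T x) ws))) (at x within V)" for b
  proof (rule has_derivative_mult)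
    show "((\<lambda>x. c b (T x w)) has_derivative (\<lambda>v. c b (B v w))) (at x within V)"
      by (rule bounded_linear.has_derivative[OF X(2) T])
    show "((\<lambda>x. \<omega> (\<tau> x) (b # map (T x) ws)) has_derivative (\<lambda>v. ?D b v + ?Q b v)) (at x within V)"
      by (rule Cons.IH[OF Cons.prems(1) alternating_Cons[OF Cons.prems(2)]])
  qed
  then have "((\<lambda>x. \<Sum>b\<in>X. c b (T x w) * \<omega> (\<tau> x) (b # map (T x) ws)) has_derivative
      (\<lambda>v. \<Sum>b\<in>X. c b (T x w) * (?D b v + ?Q b v) + c b (B v w) * \<omega> (\<tau> x) (b # map (T x) ws))) (at x within V)"
    by (rule has_derivative_sum)
  moreover have "(\<Sum>b\<in>X. c b (T x w) * (?D b v + ?Q b v) + c b (B v w) * \<omega> (\<tau> x) (b # map (T x) ws))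
     = deriv_on S (\<lambda>y. \<omega> y (map (T x) (w # ws))) (\<tau> x) (T x v) + slot_deriv (T x) (B v) (w # ws) (\<omega> (\<tau> x))" for v
  proof -
    have "deriv_on S (\<lambda>y. \<omega> y (map (T x) (w # ws))) (\<tau> x)
        = deriv_on S (\<lambda>y. \<Sum>b\<in>X. c b (T x w) * \<omega> y (b # map (T x) ws)) (\<tau> x)"
      by (intro deriv_on_cong S \<tau>x smooth_on_sum smooth_on_cmult Cons.prems(1))
        (simp add: expand[of _ "T x w"])
    then have 1: "deriv_on S (\<lambda>y. \<omega> y (map (T x) (w # ws))) (\<tau> x) (T x v) = (\<Sum>b\<in>X. c b (T x w) * ?D b v)"
      by (simp add: deriv_on_sum[OF S \<tau>x] smooth_on_cmult[OF Cons.prems(1)] deriv_on_cmult[OF S \<tau>x Cons.prems(1)])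
    have "(\<lambda>us. \<omega> (\<tau> x) (T x w # us)) = (\<lambda>us. \<Sum>b\<in>X. c b (T x w) * \<omega> (\<tau> x) (b # us))"
      using expand[OF \<tau>x, of "T x w"] by blast
    then have 2: "slot_deriv (T x) (B v) ws (\<lambda>us. \<omega> (\<tau> x) (T x w # us)) = (\<Sum>b\<in>X. c b (T x w) * ?Q b v)"
      by (simp add: slot_deriv_sum)
    show ?thesis
      by (simp only: slot_deriv.simps 1 2 expand[OF \<tau>x, of "B v w"] sum.distrib distrib_left)
  qed
  ultimately have "((\<lambda>x. \<Sum>b\<in>X. c b (T x w) * \<omega> (\<tau> x) (b # map (T x) ws)) has_derivative
      (\<lambda>v. deriv_on S (\<lambda>y. \<omega> y (map (T x) (w # ws))) (\<tau> x) (T x v) + slot_deriv (T x) (B v) (w # ws) (\<omega> (\<tau> x)))) (at x within V)"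
    by (simp only:)
  from has_derivative_transform[OF \<tau>(3) _ this] show ?case
    using \<tau>(2) expand[of "\<tau> _" "T _ w"] by (simp add: image_subset_iff)
qed

section \<open>Forms on atlases with corners\<close>

abbreviation chart_image :: "('m, 'w) chart \<Rightarrow> 'w set"
  where "chart_image c \<equiv> snd c ` fst c"

definition local_form :: "('m, 'w) form \<Rightarrow> ('m, 'w) chart \<Rightarrow> 'w \<Rightarrow> 'w list \<Rightarrow> real"
  where "local_form \<omega> c x = \<omega> c (inv_into (fst c) (snd c) x)"

text \<open>The wedge product with the 1-form \<open>l\<close> on the left, where the Leibniz rule
  for \<open>d (f \<alpha>)\<close> places it; \<open>wedge1\<close> has it on the right.\<close>

definition dwedge :: "('w \<Rightarrow> real) \<Rightarrow> ('m, 'w) form \<Rightarrow> ('m, 'w) form"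
  where "dwedge l \<alpha> = (\<lambda>c q. altsum (\<lambda>v ws. l v * \<alpha> c q ws))"

lemma OmegaD:
  assumes "\<omega> \<in> Omega B k"
  shows "\<forall>c q vs. \<omega> c q vs \<noteq> 0 \<longrightarrow> c \<in> B \<and> q \<in> fst c \<and> length vs = k"
    and "\<forall>c\<in>B. \<forall>q\<in>fst c. alternating_multilinear (\<omega> c q)"
    and "\<forall>c\<in>B. \<forall>c'\<in>B. \<forall>q\<in>fst c \<inter> fst c'. \<forall>vs. \<omega> c q vs = \<omega> c' q (map (tangent_map c c' id q) vs)"
    and "\<forall>c\<in>B. \<forall>vs. smooth_on (\<lambda>x. local_form \<omega> c x vs) (chart_image c)"
proof -
  note * = assms[unfolded Omega_def mem_Collect_eq, folded local_form_def]
  from * show "\<forall>c q vs. \<omega> c q vs \<noteq> 0 \<longrightarrow> c \<in> B \<and> q \<in> fst c \<and> length vs = k" by (rule conjunct1)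
  from * show "\<forall>c\<in>B. \<forall>q\<in>fst c. alternating_multilinear (\<omega> c q)" by (elim conjE)
  from * show "\<forall>c\<in>B. \<forall>c'\<in>B. \<forall>q\<in>fst c \<inter> fst c'. \<forall>vs. \<omega> c q vs = \<omega> c' q (map (tangent_map c c' id q) vs)"
    by (elim conjE)
  from * show "\<forall>c\<in>B. \<forall>vs. smooth_on (\<lambda>x. local_form \<omega> c x vs) (chart_image c)"
    by (elim conjE)
qed

lemma Omega_support: "\<omega> \<in> Omega B k \<Longrightarrow> \<omega> c q vs \<noteq> 0 \<Longrightarrow> c \<in> B \<and> q \<in> fst c \<and> length vs = k"
  by (rule OmegaD(1)[rule_format])

lemma Omega_outside: "\<omega> \<in> Omega B k \<Longrightarrow> \<not> (c \<in> B \<and> q \<in> fst c) \<Longrightarrow> \<omega> c q vs = 0"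
  using Omega_support[of \<omega> B k c q vs] by argo

lemma Omega_length: "\<omega> \<in> Omega B k \<Longrightarrow> length vs \<noteq> k \<Longrightarrow> \<omega> c q vs = 0"
  using Omega_support[of \<omega> B k c q vs] by argo

lemma Omega_alternating:
  "\<omega> \<in> Omega B k \<Longrightarrow> c \<in> B \<Longrightarrow> q \<in> fst c \<Longrightarrow> alternating_multilinear (\<omega> c q)"
  by (rule OmegaD(2)[rule_format])

lemma Omega_compat:
  "\<omega> \<in> Omega B k \<Longrightarrow> c \<in> B \<Longrightarrow> c' \<in> B \<Longrightarrow> q \<in> fst c \<Longrightarrow> q \<in> fst c' \<Longrightarrow>
    \<omega> c q vs = \<omega> c' q (map (tangent_map c c' id q) vs)"
  by (rule OmegaD(3)[rule_format]) auto

lemma Omega_smooth: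
  "\<omega> \<in> Omega B k \<Longrightarrow> c \<in> B \<Longrightarrow> smooth_on (\<lambda>x. local_form \<omega> c x vs) (chart_image c)"
  by (rule OmegaD(4)[rule_format])

lemma Omega_local_alternating:
  assumes "\<omega> \<in> Omega B k" "c \<in> B" "x \<in> chart_image c"
  shows "alternating_multilinear (local_form \<omega> c x)"
  unfolding local_form_def by (rule Omega_alternating[OF assms(1,2)]) (rule inv_into_into[OF assms(3)])

lemma OmegaI:
  assumes "\<And>c q vs. \<omega> c q vs \<noteq> 0 \<Longrightarrow> c \<in> B \<and> q \<in> fst c \<and> length vs = k"
    and "\<And>c q. c \<in> B \<Longrightarrow> q \<in> fst c \<Longrightarrow> alternating_multilinear (\<omega> c q)"
    and "\<And>c c' q vs. c \<in> B \<Longrightarrow> c' \<in> B \<Longrightarrow> q \<in> fst c \<Longrightarrow> q \<in> fst c' \<Longrightarrow>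
      \<omega> c q vs = \<omega> c' q (map (tangent_map c c' id q) vs)"
    and "\<And>c vs. c \<in> B \<Longrightarrow> smooth_on (\<lambda>x. local_form \<omega> c x vs) (chart_image c)"
  shows "\<omega> \<in> Omega B k"
  unfolding Omega_def mem_Collect_eq local_form_def[symmetric]
proof (intro conjI ballI allI)
  show "\<omega> c q vs \<noteq> 0 \<longrightarrow> c \<in> B \<and> q \<in> fst c \<and> length vs = k" for c q vs
    using assms(1)[of c q vs] by (rule impI)
  show "\<omega> c q vs = \<omega> c' q (map (tangent_map c c' id q) vs)"
    if "c \<in> B" "c' \<in> B" "q \<in> fst c \<inter> fst c'" for c c' q vs
    using assms(3)[of c c' q vs] that by simp
qed (rule assms; assumption)+

lemma Omega_eqI:
  assumes "\<alpha> \<in> Omega B k" "\<beta> \<in> Omega B k"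
    "\<And>c q vs. c \<in> B \<Longrightarrow> q \<in> fst c \<Longrightarrow> length vs = k \<Longrightarrow> \<alpha> c q vs = \<beta> c q vs"
  shows "\<alpha> = \<beta>"
proof (intro ext)
  fix c q vs
  show "\<alpha> c q vs = \<beta> c q vs"
    using assms(3)[of c q vs] Omega_support[OF assms(1), of c q vs] Omega_support[OF assms(2), of c q vs] by argo
qed

lemma subspace_Omega: "subspace (Omega B k)"
proof (rule subspaceI)
  show "0 \<in> Omega B k"
    by (rule OmegaI) (auto simp: local_form_def smooth_on_const alternating_0[folded zero_fun_def])
next
  fix \<alpha> \<beta> assume a: "\<alpha> \<in> Omega B k" and b: "\<beta> \<in> Omega B k"
  show "\<alpha> + \<beta> \<in> Omega B k"
  proof (rule OmegaI)
    fix c q vs assume "(\<alpha> + \<beta>) c q vs \<noteq> 0"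
    then have "\<alpha> c q vs \<noteq> 0 \<or> \<beta> c q vs \<noteq> 0" by auto
    then show "c \<in> B \<and> q \<in> fst c \<and> length vs = k" using Omega_support[OF a] Omega_support[OF b] by blast
  next
    fix c q assume "c \<in> B" "q \<in> fst c"
    then show "alternating_multilinear ((\<alpha> + \<beta>) c q)"
      using alternating_add[OF Omega_alternating[OF a] Omega_alternating[OF b]] by (simp add: plus_fun_def)
  next
    fix c c' q vs assume "c \<in> B" "c' \<in> B" "q \<in> fst c" "q \<in> fst c'"
    then show "(\<alpha> + \<beta>) c q vs = (\<alpha> + \<beta>) c' q (map (tangent_map c c' id q) vs)"
      using Omega_compat[OF a, of c c' q vs] Omega_compat[OF b, of c c' q vs] by simp
  next
    fix c vs assume "c \<in> B"
    then show "smooth_on (\<lambda>x. local_form (\<alpha> + \<beta>) c x vs) (chart_image c)"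
      using smooth_on_add[OF Omega_smooth[OF a] Omega_smooth[OF b]] by (simp add: local_form_def)
  qed
next
  fix r \<alpha> assume a: "\<alpha> \<in> Omega B k"
  show "r *\<^sub>R \<alpha> \<in> Omega B k"
  proof (rule OmegaI)
    fix c q vs assume "(r *\<^sub>R \<alpha>) c q vs \<noteq> 0"
    then have "\<alpha> c q vs \<noteq> 0" by (auto simp: scaleR_fun_def)
    then show "c \<in> B \<and> q \<in> fst c \<and> length vs = k" using Omega_support[OF a] by blast
  next
    fix c q assume "c \<in> B" "q \<in> fst c"
    then show "alternating_multilinear ((r *\<^sub>R \<alpha>) c q)"
      using alternating_cmult[OF Omega_alternating[OF a], of c q r] by (simp add: scaleR_fun_def)
  next
    fix c c' q vs assume "c \<in> B" "c' \<in> B" "q \<in> fst c" "q \<in> fst c'"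
    then show "(r *\<^sub>R \<alpha>) c q vs = (r *\<^sub>R \<alpha>) c' q (map (tangent_map c c' id q) vs)"
      using Omega_compat[OF a, of c c' q vs] by (simp add: scaleR_fun_def)
  next
    fix c vs assume "c \<in> B"
    then show "smooth_on (\<lambda>x. local_form (r *\<^sub>R \<alpha>) c x vs) (chart_image c)"
      using smooth_on_cmult[OF Omega_smooth[OF a], of c r vs] by (simp add: local_form_def scaleR_fun_def)
  qed
qed

lemmas Omega_0 = subspace_0[OF subspace_Omega]
  and Omega_add = subspace_add[OF subspace_Omega]
  and Omega_diff = subspace_diff[OF subspace_Omega]
  and Omega_scale = subspace_scale[OF subspace_Omega]

section \<open>The complex of forms on an atlas with corners\<close>

text \<open>What exterior calculus uses of an atlas, shared by \<Gamma> and its products with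
  intervals. Images of overlaps are relatively open, so derivatives within an overlap agree with
  those within the whole chart.\<close>

locale corner_atlas =
  fixes B :: "('m, 'w::real_normed_vector) atlas"
  assumes fin: "\<exists>F::'w set. finite F \<and> span F = UNIV"
    and inj: "\<And>c. c \<in> B \<Longrightarrow> inj_on (snd c) (fst c)"
    and corner: "\<And>c. c \<in> B \<Longrightarrow> corner_set (chart_image c)"
    and overlap: "\<And>c c'. c \<in> B \<Longrightarrow> c' \<in> B \<Longrightarrow>
      \<exists>U. open U \<and> snd c ` (fst c \<inter> fst c') = chart_image c \<inter> U"
    and transition: "\<And>c c'. c \<in> B \<Longrightarrow> c' \<in> B \<Longrightarrow>
      smooth_on (coord_rep c c' id) (snd c ` (fst c \<inter> fst c'))"
begin

lemma inv_chart: "c \<in> B \<Longrightarrow> q \<in> fst c \<Longrightarrow> inv_into (fst c) (snd c) (snd c q) = q"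
  by (rule inv_into_f_f[OF inj])

lemma local_form_chart: "c \<in> B \<Longrightarrow> q \<in> fst c \<Longrightarrow> local_form \<omega> c (snd c q) = \<omega> c q"
  by (simp add: local_form_def inv_chart)

lemma corner_overlap: "c \<in> B \<Longrightarrow> c' \<in> B \<Longrightarrow> corner_set (snd c ` (fst c \<inter> fst c'))"
  using overlap[of c c'] corner_set_Int_open[OF corner] by metis

lemma at_within_overlap:
  assumes "c \<in> B" "c' \<in> B" "x \<in> snd c ` (fst c \<inter> fst c')"
  shows "at x within snd c ` (fst c \<inter> fst c') = at x within chart_image c"
proof -
  obtain U where U: "open U" "snd c ` (fst c \<inter> fst c') = chart_image c \<inter> U"
    using overlap[OF assms(1,2)] by blast
  show ?thesis by (rule at_within_nhd[of x U]) (use U assms(3) in auto)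
qed

lemma coord_rep_id: "c \<in> B \<Longrightarrow> q \<in> fst c \<Longrightarrow> coord_rep c c' id (snd c q) = snd c' q"
  by (simp add: coord_rep_def inv_chart)

lemma tangent_map_id: "tangent_map c c' id q = deriv_on (snd c ` (fst c \<inter> fst c')) (coord_rep c c' id) (snd c q)"
proof -
  have "{y \<in> fst c. id y \<in> fst c'} = fst c \<inter> fst c'" by auto
  then show ?thesis by (simp add: tangent_map_def)
qed

lemma ext_deriv_local:
  assumes "c \<in> B" "q \<in> fst c"
  shows "ext_deriv B \<omega> c q = d_local (chart_image c) (local_form \<omega> c) (snd c q)"
  using assms by (simp add: ext_deriv_def d_local_def altsum_def[abs_def] local_form_def)

lemma local_form_ext_deriv:
  assumes "c \<in> B" "x \<in> chart_image c"
  shows "local_form (ext_deriv B \<omega>) c x = d_local (chart_image c) (local_form \<omega> c) x"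
proof -
  obtain q where q: "q \<in> fst c" "x = snd c q" using assms(2) by (rule imageE)
  show ?thesis unfolding q(2) local_form_chart[OF assms(1) q(1)] by (rule ext_deriv_local[OF assms(1) q(1)])
qed

lemma ext_deriv_outside: "\<not> (c \<in> B \<and> q \<in> fst c) \<Longrightarrow> ext_deriv B \<omega> c q vs = 0"
  by (auto simp: ext_deriv_def)

text \<open>The chain rule gives the expected term, with all vectors transformed by the tangent map,
  plus a term in the second derivatives of the transition map; the latter cancels in the alternating
  sum by their symmetry.\<close>

lemma ext_deriv_compat:
  assumes \<omega>: "\<omega> \<in> Omega B k" and c: "c \<in> B" "c' \<in> B" "q \<in> fst c" "q \<in> fst c'"
  shows "ext_deriv B \<omega> c q vs = ext_deriv B \<omega> c' q (map (tangent_map c c' id q) vs)"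
proof -
  define V where "V = snd c ` (fst c \<inter> fst c')"
  define \<tau> where "\<tau> = coord_rep c c' id"
  define T where "T y = deriv_on V \<tau> y" for y
  define H where "H y v w = deriv_on V (\<lambda>y. T y w) y v" for y v w
  define x where "x = snd c q"
  have V: "corner_set V" and x: "x \<in> V" "x \<in> chart_image c" using corner_overlap c by (auto simp: V_def x_def)
  have sm: "smooth_on \<tau> V" using transition c by (simp add: \<tau>_def V_def)
  have T: "(\<tau> has_derivative T y) (at y within V)" if "y \<in> V" for y
    unfolding T_def by (rule smooth_on_has_derivative[OF sm that])
  have H: "((\<lambda>y. T y w) has_derivative (\<lambda>v. H x v w)) (at x within V)" for w
    unfolding H_def T_def by (rule smooth_on_has_derivative[OF smooth_on_deriv_on[OF V sm] x(1)])
  have symH: "H x v w = H x w v" for v w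
    unfolding H_def T_def by (rule deriv_on_commute[OF V x(1) sm])
  have \<tau>V: "\<tau> ` V \<subseteq> chart_image c'"
    using c by (auto simp: V_def \<tau>_def coord_rep_id)
  have \<tau>x: "\<tau> x = snd c' q" using c by (simp add: \<tau>_def x_def coord_rep_id)
  have loc: "local_form \<omega> c y ws = local_form \<omega> c' (\<tau> y) (map (T y) ws)" if "y \<in> V" for y ws
  proof -
    obtain p where p: "p \<in> fst c" "p \<in> fst c'" "y = snd c p" using \<open>y \<in> V\<close> by (auto simp: V_def)
    then show ?thesis
      using Omega_compat[OF \<omega> c(1,2) p(1,2), of ws] c
      by (simp add: local_form_chart \<tau>_def coord_rep_id T_def tangent_map_id V_def)
  qed
  let ?D = "\<lambda>v ws. deriv_on (chart_image c') (\<lambda>y. local_form \<omega> c' y ws) (\<tau> x) v"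
  have D: "deriv_on (chart_image c) (\<lambda>y. local_form \<omega> c y ws) x v
      = ?D (T x v) (map (T x) ws) + slot_deriv (T x) (H x v) ws (local_form \<omega> c' (\<tau> x))" for v ws
  proof -
    have "((\<lambda>y. local_form \<omega> c' (\<tau> y) (map (T y) ws)) has_derivative
      (\<lambda>v. ?D (T x v) (map (T x) ws) + slot_deriv (T x) (H x v) ws (local_form \<omega> c' (\<tau> x)))) (at x within V)"
      by (rule change_of_coordinates_has_derivative[where T=T and B="H x",
            OF fin corner[OF c(2)] Omega_smooth[OF \<omega> c(2)]
            Omega_local_alternating[OF \<omega> c(2)] T[OF x(1)] \<tau>V x(1) H])
    from has_derivative_transform[OF x(1) loc this]
    have "((\<lambda>y. local_form \<omega> c y ws) has_derivative
      (\<lambda>v. ?D (T x v) (map (T x) ws) + slot_deriv (T x) (H x v) ws (local_form \<omega> c' (\<tau> x)))) (at x within chart_image c)"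
      using at_within_overlap[OF c(1,2)] x(1) by (simp add: V_def)
    from deriv_onI[OF corner[OF c(1)] x(2) this] show ?thesis by simp
  qed
  have "\<tau> x \<in> chart_image c'" using \<tau>x c by simp
  from altsum_slot_deriv[OF Omega_local_alternating[OF \<omega> c(2) this], of "H x" "T x" vs] symH
  have "altsum (\<lambda>v ws. slot_deriv (T x) (H x v) ws (local_form \<omega> c' (\<tau> x))) vs = 0" by blast
  then have "ext_deriv B \<omega> c q vs = altsum (\<lambda>v ws. ?D (T x v) (map (T x) ws)) vs"
    using c by (simp add: ext_deriv_local x_def[symmetric] d_local_def D altsum_add)
  also have "\<dots> = altsum ?D (map (T x) vs)" by (simp add: altsum_map)
  also have "\<dots> = ext_deriv B \<omega> c' q (map (T x) vs)"
    using c by (simp add: ext_deriv_local \<tau>x d_local_def)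
  also have "T x = tangent_map c c' id q" by (simp add: tangent_map_id T_def V_def \<tau>_def x_def)
  finally show ?thesis .
qed

lemma ext_deriv_Omega:
  assumes \<omega>: "\<omega> \<in> Omega B k"
  shows "ext_deriv B \<omega> \<in> Omega B (Suc k)"
proof (rule OmegaI)
  fix c q vs assume nz: "ext_deriv B \<omega> c q vs \<noteq> 0"
  then have c: "c \<in> B" "q \<in> fst c" using ext_deriv_outside by blast+
  have "length vs = Suc k"
  proof (rule ccontr)
    assume l: "length vs \<noteq> Suc k"
    have "d_local (chart_image c) (local_form \<omega> c) (snd c q) vs = altsum (\<lambda>v ws. 0) vs"
      unfolding d_local_def
    proof (rule altsum_cong)
      fix w :: 'w and ws :: "'w list" assume "Suc (length ws) = length vs"
      then have "(\<lambda>y. local_form \<omega> c y ws) = (\<lambda>y. 0)"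
        using Omega_length[OF \<omega>, of ws] l by (auto simp: local_form_def)
      then show "deriv_on (chart_image c) (\<lambda>y. local_form \<omega> c y ws) (snd c q) w = 0"
        using deriv_on_const[OF corner[OF c(1)]] c by auto
    qed
    then show False using nz ext_deriv_local[OF c] by simp
  qed
  with c show "c \<in> B \<and> q \<in> fst c \<and> length vs = Suc k" by blast
next
  fix c q assume c: "c \<in> B" "q \<in> fst c"
  show "alternating_multilinear (ext_deriv B \<omega> c q)"
    unfolding ext_deriv_local[OF c]
    using c by (intro d_local_alternating corner Omega_smooth[OF \<omega>] Omega_local_alternating[OF \<omega>]) auto
next
  fix c vs assume c: "c \<in> B"
  have "smooth_on (\<lambda>x. d_local (chart_image c) (local_form \<omega> c) x vs) (chart_image c)"
    by (rule smooth_on_d_local[OF corner[OF c] Omega_smooth[OF \<omega> c]])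
  then show "smooth_on (\<lambda>x. local_form (ext_deriv B \<omega>) c x vs) (chart_image c)"
    by (rule smooth_on_cong) (simp add: local_form_ext_deriv[OF c])
qed (rule ext_deriv_compat[OF \<omega>])

lemma ext_deriv_ext_deriv:
  assumes \<omega>: "\<omega> \<in> Omega B k"
  shows "ext_deriv B (ext_deriv B \<omega>) = 0"
proof (rule Omega_eqI[OF ext_deriv_Omega[OF ext_deriv_Omega[OF \<omega>]] Omega_0])
  fix c q vs assume c: "c \<in> B" "q \<in> fst c"
  have "ext_deriv B (ext_deriv B \<omega>) c q vs =
      d_local (chart_image c) (d_local (chart_image c) (local_form \<omega> c)) (snd c q) vs"
    unfolding ext_deriv_local[OF c]
    by (rule d_local_cong[OF corner[OF c(1)]])
      (use c in \<open>auto simp: local_form_ext_deriv intro: smooth_on_d_local[OF corner] Omega_smooth[OF \<omega>]\<close>)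
  also have "\<dots> = 0"
    using c by (intro d_local_d_local corner Omega_smooth[OF \<omega>]) auto
  finally show "ext_deriv B (ext_deriv B \<omega>) c q vs = 0 c q vs" by simp
qed

lemma ext_deriv_add:
  assumes "\<alpha> \<in> Omega B j" "\<beta> \<in> Omega B k"
  shows "ext_deriv B (\<alpha> + \<beta>) = ext_deriv B \<alpha> + ext_deriv B \<beta>"
proof (intro ext)
  fix c q vs
  show "ext_deriv B (\<alpha> + \<beta>) c q vs = (ext_deriv B \<alpha> + ext_deriv B \<beta>) c q vs"
  proof (cases "c \<in> B \<and> q \<in> fst c")
    case True
    then have "deriv_on (chart_image c) (\<lambda>y. local_form (\<alpha> + \<beta>) c y ws) (snd c q) v =
      deriv_on (chart_image c) (\<lambda>y. local_form \<alpha> c y ws) (snd c q) v +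
      deriv_on (chart_image c) (\<lambda>y. local_form \<beta> c y ws) (snd c q) v" for v ws
      using deriv_on_add[OF corner _ Omega_smooth[OF assms(1)] Omega_smooth[OF assms(2)], of c "snd c q" ws ws v]
      by (auto simp: local_form_def)
    then show ?thesis using True by (simp add: ext_deriv_local d_local_def altsum_add)
  qed (simp add: ext_deriv_outside)
qed

lemma ext_deriv_scale:
  assumes "\<alpha> \<in> Omega B k"
  shows "ext_deriv B (r *\<^sub>R \<alpha>) = r *\<^sub>R ext_deriv B \<alpha>"
proof (intro ext)
  fix c q vs
  show "ext_deriv B (r *\<^sub>R \<alpha>) c q vs = (r *\<^sub>R ext_deriv B \<alpha>) c q vs"
  proof (cases "c \<in> B \<and> q \<in> fst c")
    case True
    then have "deriv_on (chart_image c) (\<lambda>y. local_form (r *\<^sub>R \<alpha>) c y ws) (snd c q) v =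
      r * deriv_on (chart_image c) (\<lambda>y. local_form \<alpha> c y ws) (snd c q) v" for v ws
      using deriv_on_cmult[OF corner _ Omega_smooth[OF assms(1)], of c "snd c q" r ws v]
      by (auto simp: local_form_def scaleR_fun_def)
    then show ?thesis using True by (simp add: ext_deriv_local d_local_def altsum_cmult scaleR_fun_def)
  qed (simp add: ext_deriv_outside scaleR_fun_def)
qed

lemma ext_deriv_diff:
  assumes "\<alpha> \<in> Omega B j" "\<beta> \<in> Omega B k"
  shows "ext_deriv B (\<alpha> - \<beta>) = ext_deriv B \<alpha> - ext_deriv B \<beta>"
  using ext_deriv_add[OF assms(1) Omega_scale[OF assms(2), of "-1"]] ext_deriv_scale[OF assms(2), of "-1"]
  by simp

lemma cochain_complex_Omega: "cochain_complex (Omega B) (ext_deriv B)"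
  unfolding cochain_complex_def linear_between_def
  using subspace_Omega ext_deriv_Omega ext_deriv_add ext_deriv_scale ext_deriv_ext_deriv by blast

context
  fixes f :: "'m \<Rightarrow> real" and l :: "'w \<Rightarrow> real" and a :: real
  assumes l: "bounded_linear l" and f: "\<And>c q. c \<in> B \<Longrightarrow> q \<in> fst c \<Longrightarrow> f q = l (snd c q) + a"
begin

lemma local_form_fmul:
  assumes "c \<in> B" "x \<in> chart_image c"
  shows "local_form (fmul f \<alpha>) c x vs = (l x + a) * local_form \<alpha> c x vs"
proof -
  obtain q where q: "q \<in> fst c" "x = snd c q" using assms(2) by (rule imageE)
  show ?thesis
    unfolding q(2) local_form_chart[OF assms(1) q(1)] fmul_def f[OF assms(1) q(1)] ..
qed

lemma fmul_Omega:
  assumes \<alpha>: "\<alpha> \<in> Omega B k"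
  shows "fmul f \<alpha> \<in> Omega B k"
proof (rule OmegaI)
  show "c \<in> B \<and> q \<in> fst c \<and> length vs = k" if "fmul f \<alpha> c q vs \<noteq> 0" for c q vs
    using Omega_support[OF \<alpha>, of c q vs] that by (auto simp: fmul_def)
  show "alternating_multilinear (fmul f \<alpha> c q)" if "c \<in> B" "q \<in> fst c" for c q
    unfolding fmul_def by (rule alternating_cmult[OF Omega_alternating[OF \<alpha> that]])
  show "fmul f \<alpha> c q vs = fmul f \<alpha> c' q (map (tangent_map c c' id q) vs)"
    if "c \<in> B" "c' \<in> B" "q \<in> fst c" "q \<in> fst c'" for c c' q vs
    using Omega_compat[OF \<alpha> that] by (simp add: fmul_def)
  show "smooth_on (\<lambda>x. local_form (fmul f \<alpha>) c x vs) (chart_image c)" if c: "c \<in> B" for c vs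
  proof (rule smooth_on_cong)
    show "smooth_on (\<lambda>x. (l x + a) * local_form \<alpha> c x vs) (chart_image c)"
      by (intro smooth_on_mult smooth_on_add smooth_on_linear l smooth_on_const Omega_smooth[OF \<alpha> c])
  qed (simp add: local_form_fmul[OF c])
qed

text \<open>Since \<open>f\<close> is affine in every chart, its differential is the constant
  covector \<open>l\<close>, and the product rule can be applied term by term.\<close>

lemma ext_deriv_fmul:
  assumes \<alpha>: "\<alpha> \<in> Omega B k"
  shows "ext_deriv B (fmul f \<alpha>) = fmul f (ext_deriv B \<alpha>) + dwedge l \<alpha>"
proof (intro ext)
  fix c q vs
  show "ext_deriv B (fmul f \<alpha>) c q vs = (fmul f (ext_deriv B \<alpha>) + dwedge l \<alpha>) c q vs"
  proof (cases "c \<in> B \<and> q \<in> fst c")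
    case True
    let ?S = "chart_image c" and ?x = "snd c q"
    have c: "c \<in> B" and x: "?x \<in> ?S" and S: "corner_set ?S" using True corner by auto
    have sl: "smooth_on (\<lambda>x. l x + a) ?S" by (intro smooth_on_add smooth_on_linear l smooth_on_const)
    have dl: "deriv_on ?S (\<lambda>x. l x + a) ?x = l"
      using bounded_linear_imp_has_derivative[OF l] by (intro deriv_onI S x) (auto intro!: derivative_eq_intros)
    have "deriv_on ?S (\<lambda>y. local_form (fmul f \<alpha>) c y ws) ?x v
        = deriv_on ?S (\<lambda>y. (l y + a) * local_form \<alpha> c y ws) ?x v" for v ws
      by (rule fun_cong[OF deriv_on_cong[OF S x]])
        (auto simp: local_form_fmul[OF c] intro!: smooth_on_mult sl Omega_smooth[OF \<alpha> c])
    also have "\<dots> v ws = f q * deriv_on ?S (\<lambda>y. local_form \<alpha> c y ws) ?x v + l v * \<alpha> c q ws" for v ws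
      using True f[of c q] by (simp add: deriv_on_mult[OF S x sl Omega_smooth[OF \<alpha> c]] dl local_form_chart)
    finally have "deriv_on ?S (\<lambda>y. local_form (fmul f \<alpha>) c y ws) ?x v
        = f q * deriv_on ?S (\<lambda>y. local_form \<alpha> c y ws) ?x v + l v * \<alpha> c q ws" for v ws .
    then show ?thesis
      using True by (simp add: ext_deriv_local d_local_def altsum_add altsum_cmult fmul_def dwedge_def)
  next
    case False
    then have "\<alpha> c q = (\<lambda>ws. 0)" using Omega_outside[OF \<alpha>] by blast
    then show ?thesis using False by (simp add: ext_deriv_outside fmul_def dwedge_def)
  qed
qed

text \<open>This expresses the wedge product through the exterior derivative and so reduces its properties
  to those of \<^const>\<open>ext_deriv\<close>.\<close>

lemma dwedge_eq:
  "\<alpha> \<in> Omega B k \<Longrightarrow> dwedge l \<alpha> = ext_deriv B (fmul f \<alpha>) - fmul f (ext_deriv B \<alpha>)"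
  using ext_deriv_fmul by simp

lemma dwedge_Omega: "\<alpha> \<in> Omega B k \<Longrightarrow> dwedge l \<alpha> \<in> Omega B (Suc k)"
  unfolding dwedge_eq by (intro Omega_diff ext_deriv_Omega fmul_Omega)

text \<open>Apply \<open>d\<close> to the Leibniz rule for \<open>fmul f \<alpha>\<close>: both
  terms with two exterior derivatives vanish.\<close>

lemma ext_deriv_dwedge:
  assumes \<alpha>: "\<alpha> \<in> Omega B k"
  shows "ext_deriv B (dwedge l \<alpha>) = - dwedge l (ext_deriv B \<alpha>)"
proof -
  note d\<alpha> = ext_deriv_Omega[OF \<alpha>]
  have "ext_deriv B (dwedge l \<alpha>) = ext_deriv B (ext_deriv B (fmul f \<alpha>)) - ext_deriv B (fmul f (ext_deriv B \<alpha>))"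
    unfolding dwedge_eq[OF \<alpha>] by (rule ext_deriv_diff[OF ext_deriv_Omega[OF fmul_Omega[OF \<alpha>]] fmul_Omega[OF d\<alpha>]])
  also have "\<dots> = - (fmul f (ext_deriv B (ext_deriv B \<alpha>)) + dwedge l (ext_deriv B \<alpha>))"
    by (simp only: ext_deriv_ext_deriv[OF fmul_Omega[OF \<alpha>]] ext_deriv_fmul[OF d\<alpha>] diff_0)
  also have "fmul f (ext_deriv B (ext_deriv B \<alpha>)) = 0"
    by (auto simp: ext_deriv_ext_deriv[OF \<alpha>] fmul_def fun_eq_iff)
  finally show ?thesis by (simp only: add_0_left)
qed

end

end

text \<open>Maps that are given by one affine map in corresponding charts \<open>c\<close> and \<open>\<psi> c\<close>.\<close>

locale affine_chart_map = dom: corner_atlas B + cod: corner_atlas B'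
  for B :: "('m, 'w::real_normed_vector) atlas" and B' :: "('n, 'x::real_normed_vector) atlas" +
  fixes f :: "'m \<Rightarrow> 'n" and \<psi> :: "('m, 'w) chart \<Rightarrow> ('n, 'x) chart" and L :: "'w \<Rightarrow> 'x" and a :: 'x
  assumes \<psi>: "\<And>c. c \<in> B \<Longrightarrow> \<psi> c \<in> B'"
    and f: "\<And>c q. c \<in> B \<Longrightarrow> q \<in> fst c \<Longrightarrow> f q \<in> fst (\<psi> c)"
    and L: "bounded_linear L"
    and coord: "\<And>c q. c \<in> B \<Longrightarrow> q \<in> fst c \<Longrightarrow> snd (\<psi> c) (f q) = L (snd c q) + a"
begin

sublocale L: bounded_linear L by (rule L)

lemma affine_in:
  assumes "c \<in> B" "x \<in> chart_image c"
  shows "L x + a \<in> chart_image (\<psi> c)"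
proof -
  obtain q where q: "q \<in> fst c" "x = snd c q" using assms(2) by (rule imageE)
  show ?thesis
    unfolding q(2) coord[OF assms(1) q(1), symmetric] by (rule imageI[OF f[OF assms(1) q(1)]])
qed

lemma affine_has_derivative: "((\<lambda>x. L x + a) has_derivative L) F"
  using bounded_linear_imp_has_derivative[OF L] by (auto intro!: derivative_eq_intros)

text \<open>\<open>pullback\<close> uses an unspecified chart around the image point. In the chart
  \<open>\<psi> c\<close> the map is affine, and any other chart differs from it by a transition
  map.\<close>

lemma tangent_map_factor:
  assumes c: "c \<in> B" "q \<in> fst c" and c'': "c'' \<in> B'" "f q \<in> fst c''"
  shows "tangent_map c c'' f q = tangent_map (\<psi> c) c'' id (f q) \<circ> L"
proof -
  define V where "V = snd c ` {y \<in> fst c. f y \<in> fst c''}"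
  define W where "W = snd (\<psi> c) ` (fst (\<psi> c) \<inter> fst c'')"
  have \<psi>c: "\<psi> c \<in> B'" by (rule \<psi>[OF c(1)])
  obtain U where U: "open U" "W = chart_image (\<psi> c) \<inter> U"
    using cod.overlap[OF \<psi>c c''(1)] unfolding W_def by blast
  have "f y \<in> fst c'' \<longleftrightarrow> L (snd c y) + a \<in> U" if y: "y \<in> fst c" for y
  proof
    assume "f y \<in> fst c''"
    then have "snd (\<psi> c) (f y) \<in> W" using f[OF c(1) y] by (auto simp: W_def)
    then show "L (snd c y) + a \<in> U" using U coord[OF c(1) y] by simp
  next
    assume "L (snd c y) + a \<in> U"
    moreover have "snd (\<psi> c) (f y) \<in> chart_image (\<psi> c)" by (rule imageI[OF f[OF c(1) y]])
    ultimately have "snd (\<psi> c) (f y) \<in> W" using U coord[OF c(1) y] by simp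
    then obtain p where p: "p \<in> fst (\<psi> c)" "p \<in> fst c''" "snd (\<psi> c) (f y) = snd (\<psi> c) p" by (auto simp: W_def)
    then show "f y \<in> fst c''" using inj_onD[OF cod.inj[OF \<psi>c] p(3)] f[OF c(1) y] by blast
  qed
  \<comment> \<open>As a relatively open part of a chart image, \<open>V\<close> is a corner set, so
    the derivative within it is unique.\<close>
  then have V_eq: "V = chart_image c \<inter> ((\<lambda>x. L x + a) -` U)" by (auto simp: V_def)
  have "open ((\<lambda>x. L x + a) -` U)"
    by (intro continuous_open_vimage U(1)) (auto intro!: continuous_intros L.isCont simp: linear_continuous_at[OF L])
  then have cV: "corner_set V" unfolding V_eq by (intro corner_set_Int_open dom.corner c)
  have xV: "snd c q \<in> V" using c c'' by (auto simp: V_def)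
  have VW: "(\<lambda>x. L x + a) ` V \<subseteq> W"
  proof
    fix z assume "z \<in> (\<lambda>x. L x + a) ` V"
    then obtain p where p: "p \<in> fst c" "f p \<in> fst c''" "z = L (snd c p) + a" by (auto simp: V_def)
    then show "z \<in> W" using f[OF c(1) p(1)] coord[OF c(1) p(1), symmetric] by (simp add: W_def)
  qed
  have "(coord_rep (\<psi> c) c'' id has_derivative tangent_map (\<psi> c) c'' id (f q)) (at (L (snd c q) + a) within W)"
    using smooth_on_has_derivative[OF cod.transition[OF \<psi>c c''(1)], of "L (snd c q) + a"] VW xV coord[OF c]
    by (auto simp: cod.tangent_map_id W_def)
  from has_derivative_in_compose[OF affine_has_derivative has_derivative_subset[OF this VW]]
  have "((\<lambda>x. coord_rep (\<psi> c) c'' id (L x + a)) has_derivative tangent_map (\<psi> c) c'' id (f q) \<circ> L) (at (snd c q) within V)"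
    by (simp add: o_def)
  then have "(coord_rep c c'' f has_derivative tangent_map (\<psi> c) c'' id (f q) \<circ> L) (at (snd c q) within V)"
  proof (rule has_derivative_transform[OF xV, rotated])
    fix x assume "x \<in> V"
    then obtain y where y: "y \<in> fst c" "x = snd c y" by (auto simp: V_def)
    then show "coord_rep c c'' f x = coord_rep (\<psi> c) c'' id (L x + a)"
      using c cod.coord_rep_id[OF \<psi>c f[OF c(1) y(1)], of c''] coord[OF c(1) y(1)]
      by (simp add: coord_rep_def dom.inv_chart)
  qed
  from deriv_onI[OF cV xV this] show ?thesis by (simp add: tangent_map_def V_def)
qed

text \<open>The compatibility of \<omega> moves the value from the chosen chart to
  \<open>\<psi> c\<close>, where the tangent map is \<open>L\<close>.\<close>

lemma pullback_eq:
  assumes \<omega>: "\<omega> \<in> Omega B' k" and c: "c \<in> B" "q \<in> fst c"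
  shows "pullback B B' f \<omega> c q vs = \<omega> (\<psi> c) (f q) (map L vs)"
proof -
  define c'' where "c'' = (SOME c'. c' \<in> B' \<and> f q \<in> fst c')"
  have "\<psi> c \<in> B' \<and> f q \<in> fst (\<psi> c)" using \<psi>[OF c(1)] f[OF c] by (rule conjI)
  from someI[of "\<lambda>c'. c' \<in> B' \<and> f q \<in> fst c'", OF this]
  have c'': "c'' \<in> B'" "f q \<in> fst c''" unfolding c''_def by auto
  have "pullback B B' f \<omega> c q vs = \<omega> c'' (f q) (map (tangent_map c c'' f q) vs)"
    using c by (simp add: pullback_def c''_def Let_def)
  also have "\<dots> = \<omega> c'' (f q) (map (tangent_map (\<psi> c) c'' id (f q)) (map L vs))"
    by (simp add: tangent_map_factor[OF c c''])
  also have "\<dots> = \<omega> (\<psi> c) (f q) (map L vs)"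
    using Omega_compat[OF \<omega> \<psi>[OF c(1)] c''(1) f[OF c] c''(2)] by simp
  finally show ?thesis .
qed

lemma pullback_outside: "\<not> (c \<in> B \<and> q \<in> fst c) \<Longrightarrow> pullback B B' f \<omega> c q vs = 0"
  by (auto simp: pullback_def)

lemma local_form_pullback:
  assumes \<omega>: "\<omega> \<in> Omega B' k" and c: "c \<in> B" "x \<in> chart_image c"
  shows "local_form (pullback B B' f \<omega>) c x vs = local_form \<omega> (\<psi> c) (L x + a) (map L vs)"
proof -
  obtain q where q: "q \<in> fst c" "x = snd c q" using c(2) by (rule imageE)
  have "local_form \<omega> (\<psi> c) (L x + a) = \<omega> (\<psi> c) (f q)"
    using cod.local_form_chart[OF \<psi>[OF c(1)] f[OF c(1) q(1)]] coord[OF c(1) q(1)] q(2) by simp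
  then show ?thesis using pullback_eq[OF \<omega> c(1) q(1)] dom.local_form_chart[OF c(1) q(1)] q(2) by simp
qed

text \<open>Both sides are derivatives of one map, the transition followed by the affine map or the
  affine map followed by the transition. This is what makes pullbacks independent of the
  chart.\<close>

lemma tangent_map_commute:
  assumes c: "c \<in> B" "c' \<in> B" "q \<in> fst c" "q \<in> fst c'"
  shows "L (tangent_map c c' id q v) = tangent_map (\<psi> c) (\<psi> c') id (f q) (L v)"
proof -
  define V where "V = snd c ` (fst c \<inter> fst c')"
  define W where "W = snd (\<psi> c) ` (fst (\<psi> c) \<inter> fst (\<psi> c'))"
  have cV: "corner_set V" and xV: "snd c q \<in> V" using dom.corner_overlap c by (auto simp: V_def)
  have VW: "(\<lambda>x. L x + a) ` V \<subseteq> W"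
  proof
    fix z assume "z \<in> (\<lambda>x. L x + a) ` V"
    then obtain p where p: "p \<in> fst c" "p \<in> fst c'" "z = L (snd c p) + a" by (auto simp: V_def)
    then show "z \<in> W"
      using f[OF c(1) p(1)] f[OF c(2) p(2)] coord[OF c(1) p(1), symmetric] by (simp add: W_def)
  qed
  have "(coord_rep (\<psi> c) (\<psi> c') id has_derivative tangent_map (\<psi> c) (\<psi> c') id (f q)) (at (L (snd c q) + a) within W)"
    using smooth_on_has_derivative[OF cod.transition[OF \<psi>[OF c(1)] \<psi>[OF c(2)]], of "L (snd c q) + a"] VW xV coord[OF c(1,3)]
    by (auto simp: cod.tangent_map_id W_def)
  from has_derivative_in_compose[OF affine_has_derivative has_derivative_subset[OF this VW]]
  have 1: "((\<lambda>x. coord_rep (\<psi> c) (\<psi> c') id (L x + a)) has_derivative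
      (\<lambda>v. tangent_map (\<psi> c) (\<psi> c') id (f q) (L v))) (at (snd c q) within V)" .
  have "(coord_rep c c' id has_derivative tangent_map c c' id q) (at (snd c q) within V)"
    using smooth_on_has_derivative[OF dom.transition[OF c(1,2)]] xV by (simp add: dom.tangent_map_id V_def)
  from has_derivative_add_const[OF L.has_derivative[OF this], of a]
  have "((\<lambda>x. L (coord_rep c c' id x) + a) has_derivative (\<lambda>v. L (tangent_map c c' id q v))) (at (snd c q) within V)" .
  then have 2: "((\<lambda>x. coord_rep (\<psi> c) (\<psi> c') id (L x + a)) has_derivative (\<lambda>v. L (tangent_map c c' id q v))) (at (snd c q) within V)"
  proof (rule has_derivative_transform[OF xV, rotated])
    fix x assume "x \<in> V"
    then obtain y where y: "y \<in> fst c" "y \<in> fst c'" "x = snd c y" by (auto simp: V_def)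
    then show "coord_rep (\<psi> c) (\<psi> c') id (L x + a) = L (coord_rep c c' id x) + a"
      using cod.coord_rep_id[OF \<psi>[OF c(1)] f[OF c(1) y(1)], of "\<psi> c'"] coord[OF c(1) y(1)] coord[OF c(2) y(2)]
        dom.coord_rep_id[OF c(1) y(1), of c'] by simp
  qed
  from fun_cong[OF corner_set_derivative_unique[OF cV xV 2 1], of v] show ?thesis .
qed

lemma pullback_Omega:
  assumes \<omega>: "\<omega> \<in> Omega B' k"
  shows "pullback B B' f \<omega> \<in> Omega B k"
proof (rule OmegaI)
  fix c q vs assume nz: "pullback B B' f \<omega> c q vs \<noteq> 0"
  then have c: "c \<in> B" "q \<in> fst c" using pullback_outside by blast+
  then show "c \<in> B \<and> q \<in> fst c \<and> length vs = k"
    using Omega_support[OF \<omega>, of "\<psi> c" "f q" "map L vs"] nz pullback_eq[OF \<omega> c] by simp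
next
  fix c q assume c: "c \<in> B" "q \<in> fst c"
  show "alternating_multilinear (pullback B B' f \<omega> c q)"
    unfolding pullback_eq[OF \<omega> c]
    using alternating_compose_linear[OF Omega_alternating[OF \<omega> \<psi>[OF c(1)] f[OF c]] L.linear] .
next
  fix c c' q vs assume c: "c \<in> B" "c' \<in> B" "q \<in> fst c" "q \<in> fst c'"
  have "map L (map (tangent_map c c' id q) vs) = map (tangent_map (\<psi> c) (\<psi> c') id (f q)) (map L vs)"
    using tangent_map_commute[OF c] by simp
  then show "pullback B B' f \<omega> c q vs = pullback B B' f \<omega> c' q (map (tangent_map c c' id q) vs)"
    using Omega_compat[OF \<omega> \<psi>[OF c(1)] \<psi>[OF c(2)] f[OF c(1,3)] f[OF c(2,4)], of "map L vs"]
    by (simp only: pullback_eq[OF \<omega> c(1,3)] pullback_eq[OF \<omega> c(2,4)])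
next
  fix c vs assume c: "c \<in> B"
  have "smooth_on (\<lambda>x. local_form \<omega> (\<psi> c) (L x + a) (map L vs)) (chart_image c)"
    by (rule smooth_on_compose_affine[OF Omega_smooth[OF \<omega> \<psi>[OF c]] L affine_in[OF c]])
  then show "smooth_on (\<lambda>x. local_form (pullback B B' f \<omega>) c x vs) (chart_image c)"
    by (rule smooth_on_cong) (simp add: local_form_pullback[OF \<omega> c])
qed

text \<open>\<open>L\<close> does not depend on the point, so differentiation leaves the transformed
  vectors alone and no second derivatives occur.\<close>

lemma pullback_ext_deriv:
  assumes \<omega>: "\<omega> \<in> Omega B' k"
  shows "pullback B B' f (ext_deriv B' \<omega>) = ext_deriv B (pullback B B' f \<omega>)"
proof (rule Omega_eqI[OF pullback_Omega[OF cod.ext_deriv_Omega[OF \<omega>]] dom.ext_deriv_Omega[OF pullback_Omega[OF \<omega>]]])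
  fix c q vs assume c: "c \<in> B" "q \<in> fst c"
  let ?x = "snd c q"
  have x: "?x \<in> chart_image c" using c by blast
  have "deriv_on (chart_image c) (\<lambda>y. local_form (pullback B B' f \<omega>) c y ws) ?x v
      = deriv_on (chart_image (\<psi> c)) (\<lambda>y. local_form \<omega> (\<psi> c) y (map L ws)) (L ?x + a) (L v)" for v ws
  proof -
    have "deriv_on (chart_image c) (\<lambda>y. local_form (pullback B B' f \<omega>) c y ws) ?x
      = deriv_on (chart_image c) (\<lambda>y. local_form \<omega> (\<psi> c) (L y + a) (map L ws)) ?x"
      by (rule deriv_on_cong[OF dom.corner[OF c(1)] x smooth_on_compose_affine[OF Omega_smooth[OF \<omega> \<psi>[OF c(1)]] L affine_in[OF c(1)]]
            local_form_pullback[OF \<omega> c(1)]])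
    then show ?thesis
      using deriv_on_compose_affine[OF dom.corner[OF c(1)] x Omega_smooth[OF \<omega> \<psi>[OF c(1)]] L affine_in[OF c(1)]] by simp
  qed
  then have "ext_deriv B (pullback B B' f \<omega>) c q vs
    = d_local (chart_image (\<psi> c)) (local_form \<omega> (\<psi> c)) (L ?x + a) (map L vs)"
    by (simp add: dom.ext_deriv_local[OF c] d_local_def altsum_map)
  also have "\<dots> = ext_deriv B' \<omega> (\<psi> c) (f q) (map L vs)"
    by (simp add: cod.ext_deriv_local[OF \<psi>[OF c(1)] f[OF c]] coord[OF c])
  finally show "pullback B B' f (ext_deriv B' \<omega>) c q vs = ext_deriv B (pullback B B' f \<omega>) c q vs"
    by (simp add: pullback_eq[OF cod.ext_deriv_Omega[OF \<omega>] c])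
qed

end

lemma pullback_add: "pullback B B' f (\<alpha> + \<beta>) = pullback B B' f \<alpha> + pullback B B' f \<beta>"
  by (auto simp: pullback_def Let_def fun_eq_iff)

lemma pullback_scale: "pullback B B' f (r *\<^sub>R \<alpha>) = r *\<^sub>R pullback B B' f \<alpha>"
  by (auto simp: pullback_def Let_def fun_eq_iff scaleR_fun_def)

lemma pullback_diff: "pullback B B' f (\<alpha> - \<beta>) = pullback B B' f \<alpha> - pullback B B' f \<beta>"
  by (auto simp: pullback_def Let_def fun_eq_iff)

section \<open>The homotopy formula for slice integrals\<close>

context slices
begin

lemma slice_integral_add:
  assumes "smooth_on f S" "smooth_on g S" "x \<in> S"
  shows "slice_integral (\<lambda>y. f y + g y) x = slice_integral f x + slice_integral g x"
  unfolding slice_integral_def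
  by (intro integral_add slice_integrable smooth_on_continuous assms bound_J)

lemma slice_integral_cmult: "slice_integral (\<lambda>y. c * f y) x = c * slice_integral f x"
  by (simp add: slice_integral_def)

lemma slice_integral_zero: "slice_integral (\<lambda>y. 0) x = 0"
  by (simp add: slice_integral_def)

lemma slice_integral_diff:
  assumes "smooth_on f S" "smooth_on g S" "x \<in> S"
  shows "slice_integral (\<lambda>y. f y - g y) x = slice_integral f x - slice_integral g x"
  unfolding slice_integral_def
  by (intro integral_diff slice_integrable smooth_on_continuous assms bound_J)

lemma slice_integral_sum:
  assumes "\<And>i. i \<in> X \<Longrightarrow> smooth_on (f i) S" "x \<in> S"
  shows "slice_integral (\<lambda>y. \<Sum>i\<in>X. f i y) x = (\<Sum>i\<in>X. slice_integral (f i) x)"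
  using assms(1)
  by (induction X rule: infinite_finite_induct)
    (simp_all add: slice_integral_zero slice_integral_add smooth_on_sum assms(2))

lemma slice_integral_altsum:
  assumes "\<And>v vs. smooth_on (\<lambda>y. F y v vs) S" "x \<in> S"
  shows "slice_integral (\<lambda>y. altsum (F y) vs) x = altsum (\<lambda>v ws. slice_integral (\<lambda>y. F y v ws) x) vs"
  unfolding altsum_def
  by (simp add: slice_integral_sum[OF _ assms(2)] smooth_on_cmult[OF assms(1)] slice_integral_cmult)

lemma slice_integral_cong:
  assumes "x \<in> S" "\<And>y. y \<in> S \<Longrightarrow> f y = g y"
  shows "slice_integral f x = slice_integral g x"
  unfolding slice_integral_def
  by (rule Henstock_Kurzweil_Integration.integral_cong)
    (use assms slice_S[OF assms(1)] segment_J[OF bound_J[OF assms(1)]] in blast)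

lemma slice_integral_alternating:
  fixes \<omega> :: "'w \<Rightarrow> 'w list \<Rightarrow> real"
  assumes sm: "\<And>vs. smooth_on (\<lambda>x. \<omega> x vs) S"
    and alt: "\<And>y. y \<in> S \<Longrightarrow> alternating_multilinear (\<omega> y)" and x: "x \<in> S"
  shows "alternating_multilinear (\<lambda>vs. slice_integral (\<lambda>y. \<omega> y vs) x)"
  unfolding alternating_multilinear_def
proof (intro conjI allI impI)
  show "linear (\<lambda>v. slice_integral (\<lambda>y. \<omega> y (us @ v # vs)) x)" for us vs
  proof (rule linearI)
    fix a b :: 'w and r :: real
    have "slice_integral (\<lambda>y. \<omega> y (us @ (a + b) # vs)) x =
        slice_integral (\<lambda>y. \<omega> y (us @ a # vs) + \<omega> y (us @ b # vs)) x"
      by (rule slice_integral_cong[OF x]) (rule linear_add[OF alternating_linear[OF alt]])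
    then show "slice_integral (\<lambda>y. \<omega> y (us @ (a + b) # vs)) x =
        slice_integral (\<lambda>y. \<omega> y (us @ a # vs)) x + slice_integral (\<lambda>y. \<omega> y (us @ b # vs)) x"
      by (simp only: slice_integral_add[OF sm sm x])
    have "slice_integral (\<lambda>y. \<omega> y (us @ (r *\<^sub>R b) # vs)) x = slice_integral (\<lambda>y. r * \<omega> y (us @ b # vs)) x"
      by (rule slice_integral_cong[OF x]) (simp add: linear_scale[OF alternating_linear[OF alt]])
    then show "slice_integral (\<lambda>y. \<omega> y (us @ (r *\<^sub>R b) # vs)) x = r *\<^sub>R slice_integral (\<lambda>y. \<omega> y (us @ b # vs)) x"
      by (simp add: slice_integral_cmult)
  qed
next
  fix vs :: "'w list" assume nd: "\<not> distinct vs"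
  have "slice_integral (\<lambda>y. \<omega> y vs) x = slice_integral (\<lambda>y. 0) x"
    by (rule slice_integral_cong[OF x]) (rule alternating_not_distinct[OF alt nd])
  then show "slice_integral (\<lambda>y. \<omega> y vs) x = 0" by (simp only: slice_integral_zero)
qed

text \<open>Differentiating the integral gives the boundary term with \<mu> and an integral of
  derivatives along \<open>shadow v = v - l v *\<^sub>R e\<close>. The part along \<open>v\<close>
  cancels against the integral of \<open>d \<omega>\<close>. The part along \<open>e\<close>
  integrates to end values, which are the corrections turning \<open>vs\<close> into
  \<open>map shadow vs\<close> by \<open>alternating_shadow\<close>.\<close>

lemma slice_integral_homotopy:
  fixes \<omega> :: "'w \<Rightarrow> 'w list \<Rightarrow> real"
  assumes sm: "\<And>vs. smooth_on (\<lambda>x. \<omega> x vs) S"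
    and alt: "\<And>y. y \<in> S \<Longrightarrow> alternating_multilinear (\<omega> y)" and x: "x \<in> S"
  shows "d_local S (\<lambda>x vs. slice_integral (\<lambda>y. \<omega> y (e # vs)) x) x vs
      + slice_integral (\<lambda>y. d_local S \<omega> y (e # vs)) x
    = \<omega> (slice x (bound x)) (map shadow vs) - \<omega> (slice x 0) (map shadow vs)
      + altsum (\<lambda>v ws. \<mu> v * \<omega> (slice x (bound x)) (e # ws)) vs"
proof -
  let ?b = "slice x (bound x)" and ?z = "slice x 0"
  let ?D = "\<lambda>y ws v. deriv_on S (\<lambda>z. \<omega> z (e # ws)) y v"
  have smD: "smooth_on (\<lambda>y. deriv_on S (\<lambda>z. \<omega> z ws) y v) S" for ws v
    by (rule smooth_on_deriv_on[OF S sm])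
  have in_S: "?b \<in> S" "?z \<in> S" using slice_S[OF x] bound_J[OF x] J(2) by blast+
  have "d_local S (\<lambda>x vs. slice_integral (\<lambda>y. \<omega> y (e # vs)) x) x vs
      = altsum (\<lambda>v ws. \<mu> v * \<omega> ?b (e # ws) + slice_integral (\<lambda>y. ?D y ws (shadow v)) x) vs"
    by (simp add: d_local_def deriv_on_slice_integral[OF sm x])
  also have "(\<lambda>v ws. slice_integral (\<lambda>y. ?D y ws (shadow v)) x)
      = (\<lambda>v ws. slice_integral (\<lambda>y. ?D y ws v) x - (l v * \<omega> ?b (e # ws) - l v * \<omega> ?z (e # ws)))"
  proof (intro ext)
    fix v ws
    have "slice_integral (\<lambda>y. ?D y ws (shadow v)) x = slice_integral (\<lambda>y. ?D y ws v - l v * ?D y ws e) x"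
    proof (rule slice_integral_cong[OF x])
      fix y assume "y \<in> S"
      note lin = smooth_on_linear_deriv_on[OF sm this]
      show "?D y ws (shadow v) = ?D y ws v - l v * ?D y ws e"
        by (simp add: shadow_def linear_diff[OF lin] linear_scale[OF lin])
    qed
    then show "slice_integral (\<lambda>y. ?D y ws (shadow v)) x
        = slice_integral (\<lambda>y. ?D y ws v) x - (l v * \<omega> ?b (e # ws) - l v * \<omega> ?z (e # ws))"
      by (simp add: slice_integral_diff[OF smD smooth_on_cmult[OF smD] x] slice_integral_cmult
          slice_integral_deriv_e[OF sm x] right_diff_distrib)
  qed
  finally have 1: "d_local S (\<lambda>x vs. slice_integral (\<lambda>y. \<omega> y (e # vs)) x) x vs
     = altsum (\<lambda>v ws. \<mu> v * \<omega> ?b (e # ws)) vs + (altsum (\<lambda>v ws. slice_integral (\<lambda>y. ?D y ws v) x) vs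
       - (altsum (\<lambda>v ws. l v * \<omega> ?b (e # ws)) vs - altsum (\<lambda>v ws. l v * \<omega> ?z (e # ws)) vs))"
    by (simp only: altsum_add altsum_diff)
  have "slice_integral (\<lambda>y. d_local S \<omega> y (e # vs)) x
    = slice_integral (\<lambda>y. deriv_on S (\<lambda>z. \<omega> z vs) y e - altsum (\<lambda>v ws. ?D y ws v) vs) x"
    unfolding d_local_Cons unfolding d_local_def ..
  also have "\<dots> = \<omega> ?b vs - \<omega> ?z vs - altsum (\<lambda>v ws. slice_integral (\<lambda>y. ?D y ws v) x) vs"
    by (simp add: slice_integral_diff[OF smD smooth_on_altsum x] smD slice_integral_deriv_e[OF sm x]
        slice_integral_altsum[OF _ x])
  finally have 2: "slice_integral (\<lambda>y. d_local S \<omega> y (e # vs)) x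
    = \<omega> ?b vs - \<omega> ?z vs - altsum (\<lambda>v ws. slice_integral (\<lambda>y. ?D y ws v) x) vs" .
  have 3: "\<omega> y (map shadow vs) = \<omega> y vs - altsum (\<lambda>v ws. l v * \<omega> y (e # ws)) vs" if "y \<in> S" for y
    unfolding shadow_def by (rule alternating_shadow[OF alt[OF that]])
  show ?thesis unfolding 1 2 3[OF in_S(1)] 3[OF in_S(2)] by simp
qed

end

section \<open>Products of an atlas with a set\<close>

lemma corner_atlas_manifold:
  assumes "smooth_manifold \<Gamma> A"
  shows "corner_atlas A"
proof -
  have top: "openin \<Gamma> (fst c)" "open (chart_image c)"
    "homeomorphic_map (subtopology \<Gamma> (fst c)) (top_of_set (chart_image c)) (snd c)" if "c \<in> A" for c
    using assms that unfolding smooth_manifold_def by auto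
  have ts: "topspace (subtopology \<Gamma> (fst c)) = fst c" if "c \<in> A" for c
    using openin_subset[OF top(1)[OF that]] by (simp add: topspace_subtopology Int_absorb1)
  show ?thesis
  proof
    show "\<exists>F::'b set. finite F \<and> span F = UNIV" using assms unfolding smooth_manifold_def by blast
    show "inj_on (snd c) (fst c)" if "c \<in> A" for c
      using homeomorphic_imp_injective_map[OF top(3)[OF that]] ts[OF that] by simp
    show "corner_set (chart_image c)" if "c \<in> A" for c
      by (rule corner_set_open[OF top(2)[OF that]])
    show "\<exists>U. open U \<and> snd c ` (fst c \<inter> fst c') = chart_image c \<inter> U" if c: "c \<in> A" "c' \<in> A" for c c'
    proof (intro exI conjI)
      have "openin (subtopology \<Gamma> (fst c)) (fst c \<inter> fst c')"
        using openin_subtopology_Int2[OF top(1)[OF c(2)]] by simp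
      then have "openin (top_of_set (chart_image c)) (snd c ` (fst c \<inter> fst c'))"
        using homeomorphic_imp_open_map[OF top(3)[OF c(1)]] by (simp add: open_map_def)
      then show "open (snd c ` (fst c \<inter> fst c'))"
        using openin_open_eq[OF top(2)[OF c(1)]] by blast
      show "snd c ` (fst c \<inter> fst c') = chart_image c \<inter> snd c ` (fst c \<inter> fst c')" by auto
    qed
    show "smooth_on (coord_rep c c' id) (snd c ` (fst c \<inter> fst c'))" if "c \<in> A" "c' \<in> A" for c c'
      using assms that unfolding smooth_manifold_def by blast
  qed
qed

section \<open>Product charts and affine maps between products\<close>

lemma fst_prod_chart [simp]: "fst (prod_chart Q c) = fst c \<times> Q"
  and snd_prod_chart [simp]: "snd (prod_chart Q c) (x, p) = (snd c x, p)"
  by (simp_all add: prod_chart_def)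

lemma chart_image_prod: "chart_image (prod_chart Q c) = chart_image c \<times> Q"
  by (force simp: prod_chart_def)

lemma image_prod_chart [simp]: "snd (prod_chart Q c) ` (fst c \<times> Q) = chart_image c \<times> Q"
  using chart_image_prod[of Q c] by simp

lemma prod_atlasE:
  assumes "d \<in> prod_atlas A Q"
  obtains c where "c \<in> A" "d = prod_chart Q c"
  using assms unfolding prod_atlas_def by (rule imageE) 

lemma prod_chart_in: "c \<in> A \<Longrightarrow> prod_chart Q c \<in> prod_atlas A Q"
  unfolding prod_atlas_def by (rule imageI)

text \<open>This lets \<open>base_chart\<close> recover the base chart. Coordinate maps must agree
  also outside the domains, which holds because \<open>map_prod\<close> keeps all their values; the
  domains are compared through a point of \<open>Q\<close>.\<close>

lemma inj_on_prod_chart: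
  assumes "Q \<noteq> {}"
  shows "inj_on (prod_chart Q) A"
proof (rule inj_onI)
  fix c c' assume eq: "prod_chart Q c = prod_chart Q c'"
  have 1: "fst c \<times> Q = fst c' \<times> Q" using arg_cong[OF eq, of fst] by simp
  have "snd c x = snd c' x" for x
    using fun_cong[OF arg_cong[OF eq, of snd], of "(x, undefined)"] by simp
  moreover obtain p where p: "p \<in> Q" using assms by blast
  have "x \<in> fst c \<longleftrightarrow> x \<in> fst c'" for x using arg_cong[OF 1, of "\<lambda>S. (x, p) \<in> S"] p by simp
  then have "fst c = fst c'" by (rule set_eqI)
  ultimately show "c = c'" by (simp add: prod_eq_iff fun_eq_iff)
qed

lemma finite_span_prod:
  assumes "finite F" "span F = (UNIV::'a::real_vector set)" "finite G" "span G = (UNIV::'b::real_vector set)"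
  shows "finite (F \<times> {0} \<union> {0} \<times> G)" "span (F \<times> {0} \<union> {0} \<times> G) = UNIV"
  using assms span_axes[OF assms(2,4)] by simp_all

locale corner_factor =
  fixes Q :: "'q::real_normed_vector set"
  assumes fin_factor: "\<exists>F::'q set. finite F \<and> span F = UNIV"
    and corner_factor: "corner_set Q" and nonempty_factor: "Q \<noteq> {}"

locale corner_product = A: corner_atlas A + Q: corner_factor Q
  for A :: "('a, 'e::real_normed_vector) atlas" and Q :: "'q::real_normed_vector set"
begin

lemma prod_overlap: "snd (prod_chart Q c) ` (fst (prod_chart Q c) \<inter> fst (prod_chart Q c')) =
    snd c ` (fst c \<inter> fst c') \<times> Q"
  by (force simp: prod_chart_def)

lemma coord_rep_prod:
  assumes "c \<in> A" "c' \<in> A" "y \<in> snd c ` (fst c \<inter> fst c')" "p \<in> Q"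
  shows "coord_rep (prod_chart Q c) (prod_chart Q c') id (y, p) = (coord_rep c c' id y, p)"
proof -
  obtain x where x: "x \<in> fst c" "y = snd c x" using assms(3) by blast
  have "inj_on (snd (prod_chart Q c)) (fst (prod_chart Q c))"
    using A.inj[OF assms(1)] by (auto simp: inj_on_def)
  from inv_into_f_f[OF this, of "(x, p)"] have "inv_into (fst c \<times> Q) (snd (prod_chart Q c)) (y, p) = (x, p)"
    using x assms(4) by simp
  then show ?thesis by (simp add: coord_rep_def x A.inv_chart[OF assms(1) x(1)])
qed

sublocale prod: corner_atlas "prod_atlas A Q"
proof
  obtain F :: "'e set" and G :: "'q set"
    where FG: "finite F" "span F = UNIV" "finite G" "span G = UNIV"
    using A.fin Q.fin_factor by (elim exE conjE)
  show "\<exists>F::('e \<times> 'q) set. finite F \<and> span F = UNIV"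
    by (rule exI, rule conjI[OF finite_span_prod[OF FG]])
next
  fix d assume "d \<in> prod_atlas A Q"
  then obtain c where c: "c \<in> A" "d = prod_chart Q c" by (rule prod_atlasE)
  show "inj_on (snd d) (fst d)" using A.inj[OF c(1)] unfolding c(2) by (auto simp: inj_on_def)
  show "corner_set (chart_image d)"
    unfolding c(2) chart_image_prod by (rule corner_set_Times[OF A.corner[OF c(1)] Q.corner_factor])
next
  fix d d' assume "d \<in> prod_atlas A Q" "d' \<in> prod_atlas A Q"
  then obtain c c' where c: "c \<in> A" "d = prod_chart Q c" "c' \<in> A" "d' = prod_chart Q c'"
    by (elim prod_atlasE)
  obtain U where U: "open U" "snd c ` (fst c \<inter> fst c') = chart_image c \<inter> U"
    using A.overlap[OF c(1,3)] by blast
  show "\<exists>U. open U \<and> snd d ` (fst d \<inter> fst d') = chart_image d \<inter> U"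
    unfolding c(2,4) prod_overlap chart_image_prod U(2)
    by (intro exI[of _ "U \<times> UNIV"]) (auto intro: open_Times U(1))
  \<comment> \<open>The transition map of the product is the sum of its base component paired with 0
    and of the linear map \<open>z \<mapsto> (0, snd z)\<close>.\<close>
  have "bounded_linear (\<lambda>y::'e. (y, 0::'q))" by (intro bounded_linear_Pair bounded_linear_ident bounded_linear_zero)
  moreover have "smooth_on (\<lambda>z. coord_rep c c' id (fst z + 0)) (snd c ` (fst c \<inter> fst c') \<times> Q)"
    by (rule smooth_on_compose_affine[OF A.transition[OF c(1,3)] bounded_linear_fst]) auto
  ultimately have "smooth_on (\<lambda>z. (coord_rep c c' id (fst z + 0), 0::'q)) (snd c ` (fst c \<inter> fst c') \<times> Q)"
    by (rule smooth_on_linear_compose)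
  moreover have "bounded_linear (\<lambda>z::'e \<times> 'q. (0::'e, snd z))"
    by (intro bounded_linear_Pair bounded_linear_snd bounded_linear_zero)
  ultimately have "smooth_on (\<lambda>z. (coord_rep c c' id (fst z + 0), 0) + (0, snd z)) (snd c ` (fst c \<inter> fst c') \<times> Q)"
    by (intro smooth_on_add[OF _ smooth_on_linear])
  then show "smooth_on (coord_rep d d' id) (snd d ` (fst d \<inter> fst d'))"
    unfolding c(2,4) prod_overlap
    by (rule smooth_on_cong) (use coord_rep_prod[OF c(1,3)] in auto)
qed

text \<open>The transition is a product with the identity, so its tangent map fixes fibre directions
  and is the same at every fibre point. Both facts let it pass through fibre integrals.\<close>

lemma tangent_map_prod:
  assumes c: "c \<in> A" "c' \<in> A" "x \<in> fst c" "x \<in> fst c'" "p \<in> Q"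
  shows "tangent_map (prod_chart Q c) (prod_chart Q c') id (x, p) (v, w) = (tangent_map c c' id x v, w)"
proof -
  define V where "V = snd c ` (fst c \<inter> fst c')"
  have S: "corner_set (V \<times> Q)" and xV: "snd c x \<in> V" "(snd c x, p) \<in> V \<times> Q"
    using corner_set_Times[OF A.corner_overlap[OF c(1,2)] Q.corner_factor] c by (auto simp: V_def)
  have "(coord_rep c c' id has_derivative tangent_map c c' id x) (at (fst (snd c x, p)) within V)"
    using smooth_on_has_derivative[OF A.transition[OF c(1,2)]] xV(1) by (simp add: A.tangent_map_id V_def)
  from has_derivative_in_compose[of fst fst _ _ _ _, OF bounded_linear_imp_has_derivative[OF bounded_linear_fst] has_derivative_subset[OF this]]
  have "((\<lambda>z. coord_rep c c' id (fst z)) has_derivative (\<lambda>z. tangent_map c c' id x (fst z))) (at (snd c x, p) within V \<times> Q)"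
    by auto
  from has_derivative_Pair[OF this bounded_linear_imp_has_derivative[OF bounded_linear_snd]]
  have "(coord_rep (prod_chart Q c) (prod_chart Q c') id has_derivative
      (\<lambda>z. (tangent_map c c' id x (fst z), snd z))) (at (snd c x, p) within V \<times> Q)"
    by (rule has_derivative_transform[OF xV(2), rotated]) (use coord_rep_prod[OF c(1,2)] in \<open>auto simp: V_def\<close>)
  from deriv_onI[OF S xV(2) this]
  have "tangent_map (prod_chart Q c) (prod_chart Q c') id (x, p) = (\<lambda>z. (tangent_map c c' id x (fst z), snd z))"
    unfolding prod.tangent_map_id prod_overlap by (simp add: V_def)
  then show ?thesis by simp
qed

abbreviation base_chart :: "('a \<times> 'q, 'e \<times> 'q) chart \<Rightarrow> ('a, 'e) chart"
  where "base_chart \<equiv> inv_into A (prod_chart Q)"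

lemma base_chart: "c \<in> A \<Longrightarrow> base_chart (prod_chart Q c) = c"
  by (rule inv_into_f_f[OF inj_on_prod_chart[OF Q.nonempty_factor]])

lemma affine_chart_map_fst: "affine_chart_map (prod_atlas A Q) A fst base_chart fst 0"
proof (rule affine_chart_map.intro[OF prod.corner_atlas_axioms A.corner_atlas_axioms], rule affine_chart_map_axioms.intro)
  fix d assume "d \<in> prod_atlas A Q"
  then obtain c where c: "c \<in> A" "d = prod_chart Q c" by (rule prod_atlasE)
  show "base_chart d \<in> A" using c by (simp add: base_chart)
  show "fst q \<in> fst (base_chart d)" "snd (base_chart d) (fst q) = fst (snd d q) + 0" if "q \<in> fst d" for q
    using c that by (auto simp: base_chart)
qed (rule bounded_linear_fst)

lemma affine_chart_map_section:
  assumes "p \<in> Q"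
  shows "affine_chart_map A (prod_atlas A Q) (\<lambda>x. (x, p)) (prod_chart Q) (\<lambda>v. (v, 0)) (0, p)"
  by (rule affine_chart_map.intro[OF A.corner_atlas_axioms prod.corner_atlas_axioms], rule affine_chart_map_axioms.intro)
    (use assms in \<open>auto intro!: prod_chart_in bounded_linear_Pair bounded_linear_ident bounded_linear_zero\<close>)

end

text \<open>Covers the maps between the collar, \<open>E\<close> and the \<open>F\<close> faces.
  Corresponding charts are the products over one base chart, so only the fibre coordinates
  change.\<close>

lemma affine_chart_map_prod:
  fixes Q :: "'q::real_normed_vector set" and Q' :: "'r::real_normed_vector set"
  assumes "corner_product A Q" "corner_product A Q'"
    and M: "bounded_linear M" "\<And>p. p \<in> Q \<Longrightarrow> M p + a \<in> Q'"
    and f: "\<And>x p. p \<in> Q \<Longrightarrow> f (x, p) = (x, M p + a)"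
  shows "affine_chart_map (prod_atlas A Q) (prod_atlas A Q') f
    (\<lambda>d. prod_chart Q' (inv_into A (prod_chart Q) d)) (\<lambda>z. (fst z, M (snd z))) (0, a)"
proof -
  interpret Q: corner_product A Q by fact
  interpret Q': corner_product A Q' by fact
  show ?thesis
  proof (rule affine_chart_map.intro[OF Q.prod.corner_atlas_axioms Q'.prod.corner_atlas_axioms], rule affine_chart_map_axioms.intro)
    fix d assume "d \<in> prod_atlas A Q"
    then obtain c where c: "c \<in> A" "d = prod_chart Q c" by (rule prod_atlasE)
    show "prod_chart Q' (Q.base_chart d) \<in> prod_atlas A Q'" using c by (simp add: Q.base_chart prod_chart_in)
    show "f q \<in> fst (prod_chart Q' (Q.base_chart d))"
      "snd (prod_chart Q' (Q.base_chart d)) (f q) = (fst (snd d q), M (snd (snd d q))) + (0, a)" if "q \<in> fst d" for q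
      using c that M(2) by (auto simp: Q.base_chart f)
  qed (intro bounded_linear_Pair bounded_linear_fst bounded_linear_compose[OF M(1) bounded_linear_snd])
qed

context corner_product
begin

text \<open>Values are compared on vector lists of every length, so the degrees \<open>j\<close> and
  \<open>k\<close> may differ.\<close>

lemma prod_eqI:
  assumes "\<alpha> \<in> Omega (prod_atlas A Q) j" "\<beta> \<in> Omega (prod_atlas A Q) k"
    and "\<And>c x p vs. c \<in> A \<Longrightarrow> x \<in> fst c \<Longrightarrow> p \<in> Q \<Longrightarrow>
      \<alpha> (prod_chart Q c) (x, p) vs = \<beta> (prod_chart Q c) (x, p) vs"
  shows "\<alpha> = \<beta>"
proof (intro ext)
  fix d q vs
  show "\<alpha> d q vs = \<beta> d q vs"
  proof (cases "d \<in> prod_atlas A Q \<and> q \<in> fst d")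
    case True
    then obtain c where c: "c \<in> A" "d = prod_chart Q c" by (auto elim: prod_atlasE)
    moreover obtain x p where "q = (x, p)" "x \<in> fst c" "p \<in> Q" using True c(2) by auto
    ultimately show ?thesis using assms(3) by simp
  next
    case False
    then show ?thesis by (simp add: Omega_outside[OF assms(1) False] Omega_outside[OF assms(2) False])
  qed
qed

lemma tangent_map_linear: "c \<in> A \<Longrightarrow> c' \<in> A \<Longrightarrow> x \<in> fst c \<Longrightarrow> x \<in> fst c' \<Longrightarrow> linear (tangent_map c c' id x)"
  unfolding A.tangent_map_id by (rule smooth_on_linear_deriv_on[OF A.transition]) auto

end

section \<open>Integration along a fibre coordinate\<close>

text \<open>The affine upper limit \<open>m p + b0\<close> covers all three integrals: the radial
  one up to \<open>r\<close> and the angular one up to \<theta> with \<open>m = l\<close> and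
  \<open>b0 = 0\<close>, and the angular one up to 1 with \<open>m = 0\<close> and
  \<open>b0 = 1\<close>.\<close>

locale product_slices = corner_product A Q
  for A :: "('a, 'e::banach) atlas" and Q :: "'q::banach set" +
  fixes J :: "real set" and e :: 'q and l :: "'q \<Rightarrow> real" and m :: "'q \<Rightarrow> real" and b0 :: real
  assumes J: "is_interval J" "0 \<in> J" "J \<subseteq> {0..}"
    and l: "bounded_linear l" "l e = 1" "\<And>p. p \<in> Q \<Longrightarrow> l p \<in> J"
    and step_in: "\<And>p s. p \<in> Q \<Longrightarrow> s \<in> J \<Longrightarrow> p + (s - l p) *\<^sub>R e \<in> Q"
    and m: "bounded_linear m" "\<And>p. p \<in> Q \<Longrightarrow> m p + b0 \<in> J"
begin

abbreviation prod_J :: "('a \<times> 'q, 'e \<times> 'q) atlas" where "prod_J \<equiv> prod_atlas A Q"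

definition step :: "'q \<Rightarrow> real \<Rightarrow> 'q" where "step p s = p + (s - l p) *\<^sub>R e"

definition flat :: "'e \<times> 'q \<Rightarrow> 'e \<times> 'q" where "flat z = (fst z, snd z - l (snd z) *\<^sub>R e)"

definition fibre_integral :: "('a \<times> 'q, 'e \<times> 'q) form \<Rightarrow> ('a \<times> 'q, 'e \<times> 'q) form"
  where "fibre_integral = line_integral prod_J (\<lambda>q s. (fst q, step (snd q) s)) (0, e) (\<lambda>q. m (snd q) + b0)"

lemma step_Q: "p \<in> Q \<Longrightarrow> s \<in> J \<Longrightarrow> step p s \<in> Q"
  unfolding step_def by (rule step_in)

lemma segment_J: "t \<in> J \<Longrightarrow> {0..t} \<subseteq> J"
  using J unfolding is_interval_1 by (meson atLeastAtMost_iff subsetI)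

lemma chart_slices:
  assumes "c \<in> A"
  shows "slices (chart_image (prod_chart Q c)) J (0, e) (\<lambda>z. l (snd z)) (\<lambda>z. m (snd z)) b0"
proof (rule slices.intro)
  show "corner_set (chart_image (prod_chart Q c))" by (rule prod.corner[OF prod_chart_in[OF assms]])
  show "bounded_linear (\<lambda>z::'e \<times> 'q. l (snd z))" by (rule bounded_linear_compose[OF l(1) bounded_linear_snd])
  show "bounded_linear (\<lambda>z::'e \<times> 'q. m (snd z))" by (rule bounded_linear_compose[OF m(1) bounded_linear_snd])
qed (use prod.fin J l m step_in in \<open>auto simp: chart_image_prod\<close>)

abbreviation SI :: "('e \<times> 'q \<Rightarrow> real) \<Rightarrow> 'e \<times> 'q \<Rightarrow> real"
  where "SI \<equiv> slices.slice_integral (0, e) (\<lambda>z. l (snd z)) (\<lambda>z. m (snd z)) b0"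

lemma fibre_integral_eq:
  assumes "c \<in> A" "x \<in> fst c" "p \<in> Q"
  shows "fibre_integral \<omega> (prod_chart Q c) (x, p) vs =
    integral {0..m p + b0} (\<lambda>s. \<omega> (prod_chart Q c) (x, step p s) ((0, e) # vs))"
  using assms by (simp add: fibre_integral_def line_integral_def prod_chart_in)

lemma fibre_integral_outside: "\<not> (d \<in> prod_J \<and> q \<in> fst d) \<Longrightarrow> fibre_integral \<omega> d q vs = 0"
  by (auto simp: fibre_integral_def line_integral_def)

lemma fibre_integral_cong:
  assumes "p \<in> Q" "\<And>s. s \<in> J \<Longrightarrow> step p s \<in> Q \<Longrightarrow> f s = g s"
  shows "integral {0..m p + b0} f = integral {0..m p + b0} g"
  by (rule Henstock_Kurzweil_Integration.integral_cong)
    (use assms segment_J[OF m(2)[OF assms(1)]] step_Q[OF assms(1)] in blast)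

lemma local_form_step:
  assumes "c \<in> A" "x \<in> fst c" "p \<in> Q" "s \<in> J"
  shows "local_form \<omega> (prod_chart Q c) (slices.slice (0, e) (\<lambda>z. l (snd z)) (snd c x, p) s)
    = \<omega> (prod_chart Q c) (x, step p s)"
proof -
  interpret s: slices "chart_image (prod_chart Q c)" J "(0, e)" "\<lambda>z. l (snd z)" "\<lambda>z. m (snd z)" b0
    by (rule chart_slices[OF assms(1)])
  have "s.slice (snd c x, p) s = snd (prod_chart Q c) (x, step p s)"
    by (simp add: s.slice_def step_def)
  then show ?thesis
    using prod.local_form_chart[OF prod_chart_in[OF assms(1)], of "(x, step p s)"] assms step_Q by simp
qed

lemma local_form_fibre_integral:
  assumes "c \<in> A" "y \<in> chart_image (prod_chart Q c)"
  shows "local_form (fibre_integral \<omega>) (prod_chart Q c) y vs =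
    SI (\<lambda>z. local_form \<omega> (prod_chart Q c) z ((0, e) # vs)) y"
proof -
  interpret s: slices "chart_image (prod_chart Q c)" J "(0, e)" "\<lambda>z. l (snd z)" "\<lambda>z. m (snd z)" b0
    by (rule chart_slices[OF assms(1)])
  obtain x p where xp: "x \<in> fst c" "p \<in> Q" "y = (snd c x, p)" using assms(2) by (auto simp: chart_image_prod)
  have "local_form (fibre_integral \<omega>) (prod_chart Q c) y vs = fibre_integral \<omega> (prod_chart Q c) (x, p) vs"
    using prod.local_form_chart[OF prod_chart_in[OF assms(1)], of "(x, p)"] xp by simp
  also have "\<dots> = SI (\<lambda>z. local_form \<omega> (prod_chart Q c) z ((0, e) # vs)) y"
    unfolding fibre_integral_eq[OF assms(1) xp(1,2)] s.slice_integral_def s.bound_def xp(3) snd_conv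
    by (rule fibre_integral_cong[OF xp(2)]) (simp add: local_form_step[OF assms(1) xp(1,2)])
  finally show ?thesis .
qed

text \<open>The integrated direction occupies two slots of \<omega>. This is the source of the
  vanishing squares of the homotopies.\<close>

lemma fibre_integral_Cons:
  assumes "\<omega> \<in> Omega prod_J k"
  shows "fibre_integral \<omega> d q ((0, e) # vs) = 0"
proof (cases "d \<in> prod_J \<and> q \<in> fst d")
  case True
  then obtain c where c: "c \<in> A" "d = prod_chart Q c" by (auto elim: prod_atlasE)
  then obtain x p where q: "q = (x, p)" "x \<in> fst c" "p \<in> Q" using True by auto
  have "fibre_integral \<omega> d q ((0, e) # vs) = integral {0..m p + b0} (\<lambda>s. 0)"
    unfolding c(2) q(1) fibre_integral_eq[OF c(1) q(2,3)]
  proof (rule fibre_integral_cong[OF q(3)])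
    fix s assume "step p s \<in> Q"
    then show "\<omega> (prod_chart Q c) (x, step p s) ((0, e) # (0, e) # vs) = 0"
      using q by (intro alternating_not_distinct[OF Omega_alternating[OF assms prod_chart_in[OF c(1)]]]) auto
  qed
  then show ?thesis by simp
qed (rule fibre_integral_outside)

lemma fibre_integral_0form:
  assumes "\<omega> \<in> Omega prod_J 0"
  shows "fibre_integral \<omega> = 0"
proof (intro ext)
  fix d q vs
  have "\<omega> d q' ((0, e) # vs) = 0" for q' by (rule Omega_length[OF assms]) simp
  then show "fibre_integral \<omega> d q vs = 0 d q vs" by (simp add: fibre_integral_def line_integral_def)
qed

lemma fibre_integral_Omega:
  assumes \<omega>: "\<omega> \<in> Omega prod_J (Suc k)"
  shows "fibre_integral \<omega> \<in> Omega prod_J k"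
proof (rule OmegaI)
  fix d q vs assume nz: "fibre_integral \<omega> d q vs \<noteq> 0"
  then have "d \<in> prod_J \<and> q \<in> fst d" using fibre_integral_outside by blast
  moreover have "length vs = k"
  proof (rule ccontr)
    assume "length vs \<noteq> k"
    then have "\<omega> d q' ((0, e) # vs) = 0" for q' by (intro Omega_length[OF \<omega>]) simp
    then show False using nz by (simp add: fibre_integral_def line_integral_def split: if_splits)
  qed
  ultimately show "d \<in> prod_J \<and> q \<in> fst d \<and> length vs = k" by blast
next
  fix d q assume d: "d \<in> prod_J" "q \<in> fst d"
  then obtain c where c: "c \<in> A" "d = prod_chart Q c" by (auto elim: prod_atlasE)
  interpret s: slices "chart_image (prod_chart Q c)" J "(0, e)" "\<lambda>z. l (snd z)" "\<lambda>z. m (snd z)" b0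
    by (rule chart_slices[OF c(1)])
  have x: "snd d q \<in> chart_image (prod_chart Q c)" using d c by blast
  note dc = prod_chart_in[OF c(1)]
  have "alternating_multilinear (\<lambda>vs. SI (\<lambda>y. local_form \<omega> (prod_chart Q c) y ((0, e) # vs)) (snd d q))"
    by (rule s.slice_integral_alternating[OF Omega_smooth[OF \<omega> dc] alternating_Cons[OF Omega_local_alternating[OF \<omega> dc]] x])
  moreover have "fibre_integral \<omega> d q = (\<lambda>vs. SI (\<lambda>y. local_form \<omega> (prod_chart Q c) y ((0, e) # vs)) (snd d q))"
    using local_form_fibre_integral[OF c(1) x, of \<omega>] prod.local_form_chart[OF d, of "fibre_integral \<omega>"] c(2) by auto
  ultimately show "alternating_multilinear (fibre_integral \<omega> d q)" by simp
next
  fix d d' q vs assume d: "d \<in> prod_J" "d' \<in> prod_J" "q \<in> fst d" "q \<in> fst d'"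
  from d obtain c c' where c: "c \<in> A" "d = prod_chart Q c" "c' \<in> A" "d' = prod_chart Q c'"
    by (elim prod_atlasE)
  then obtain x p where q: "q = (x, p)" "x \<in> fst c" "x \<in> fst c'" "p \<in> Q" using d by auto
  let ?T = "\<lambda>p. tangent_map (prod_chart Q c) (prod_chart Q c') id (x, p)"
  have T: "?T p' z = (tangent_map c c' id x (fst z), snd z)" if "p' \<in> Q" for p' z
    using tangent_map_prod[OF c(1,3) q(2,3) that, of "fst z" "snd z"] by simp
  have "fibre_integral \<omega> d q vs = fibre_integral \<omega> d' q (map (?T p) vs)"
    unfolding c(2,4) q(1) fibre_integral_eq[OF c(1) q(2,4)] fibre_integral_eq[OF c(3) q(3,4)]
  proof (rule fibre_integral_cong[OF q(4)])
    fix s assume s: "step p s \<in> Q"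
    \<comment> \<open>The transition fixes the integrated direction and acts on the other vectors
      independently of \<open>s\<close>, so the two integrands agree point by point.\<close>
    have eq: "map (?T (step p s)) ((0, e) # vs) = (0, e) # map (?T p) vs"
      using T[OF s] T[OF q(4)] linear_0[OF tangent_map_linear[OF c(1,3) q(2,3)]] by simp
    show "\<omega> (prod_chart Q c) (x, step p s) ((0, e) # vs) =
        \<omega> (prod_chart Q c') (x, step p s) ((0, e) # map (?T p) vs)"
      using Omega_compat[OF \<omega> prod_chart_in[OF c(1)] prod_chart_in[OF c(3)], of "(x, step p s)" "(0, e) # vs"] q s
      unfolding eq by simp
  qed
  then show "fibre_integral \<omega> d q vs = fibre_integral \<omega> d' q (map (tangent_map d d' id q) vs)"
    by (simp only: c(2,4) q(1))
next
  fix d vs assume "d \<in> prod_J"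
  then obtain c where c: "c \<in> A" "d = prod_chart Q c" by (rule prod_atlasE)
  interpret s: slices "chart_image (prod_chart Q c)" J "(0, e)" "\<lambda>z. l (snd z)" "\<lambda>z. m (snd z)" b0
    by (rule chart_slices[OF c(1)])
  have "smooth_on (SI (\<lambda>z. local_form \<omega> (prod_chart Q c) z ((0, e) # vs))) (chart_image (prod_chart Q c))"
    by (rule s.smooth_on_slice_integral[OF Omega_smooth[OF \<omega> prod_chart_in[OF c(1)]]])
  then show "smooth_on (\<lambda>x. local_form (fibre_integral \<omega>) d x vs) (chart_image d)"
    unfolding c(2) by (rule smooth_on_cong) (simp add: local_form_fibre_integral[OF c(1)])
qed

lemma fibre_integral_homotopy:
  assumes \<omega>: "\<omega> \<in> Omega prod_J k" and c: "c \<in> A" "x \<in> fst c" and p: "p \<in> Q"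
  shows "ext_deriv prod_J (fibre_integral \<omega>) (prod_chart Q c) (x, p) vs
      + fibre_integral (ext_deriv prod_J \<omega>) (prod_chart Q c) (x, p) vs
    = \<omega> (prod_chart Q c) (x, step p (m p + b0)) (map flat vs) - \<omega> (prod_chart Q c) (x, step p 0) (map flat vs)
      + altsum (\<lambda>v ws. m (snd v) * \<omega> (prod_chart Q c) (x, step p (m p + b0)) ((0, e) # ws)) vs"
proof -
  interpret s: slices "chart_image (prod_chart Q c)" J "(0, e)" "\<lambda>z. l (snd z)" "\<lambda>z. m (snd z)" b0
    by (rule chart_slices[OF c(1)])
  let ?d = "prod_chart Q c" and ?y = "(snd c x, p)"
  let ?S = "chart_image ?d"
  note d = prod_chart_in[OF c(1), of Q]
  have q: "(x, p) \<in> fst ?d" "snd ?d (x, p) = ?y" using c p by simp_all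
  have y: "?y \<in> ?S" using imageI[OF q(1), of "snd ?d"] q(2) by simp
  note sm = Omega_smooth[OF \<omega> d]
  have 1: "ext_deriv prod_J (fibre_integral \<omega>) ?d (x, p) vs
      = d_local ?S (\<lambda>y vs. SI (\<lambda>z. local_form \<omega> ?d z ((0, e) # vs)) y) ?y vs"
    unfolding prod.ext_deriv_local[OF d q(1)] q(2)
    by (rule d_local_cong[OF s.S y s.smooth_on_slice_integral[OF sm] local_form_fibre_integral[OF c(1)]])
  have "fibre_integral (ext_deriv prod_J \<omega>) ?d (x, p) vs = SI (\<lambda>z. local_form (ext_deriv prod_J \<omega>) ?d z ((0, e) # vs)) ?y"
    using local_form_fibre_integral[OF c(1) y] prod.local_form_chart[OF d q(1)] q(2) by metis
  also have "\<dots> = SI (\<lambda>z. d_local ?S (local_form \<omega> ?d) z ((0, e) # vs)) ?y"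
    by (rule s.slice_integral_cong[OF y]) (simp only: prod.local_form_ext_deriv[OF d])
  finally have 2: "fibre_integral (ext_deriv prod_J \<omega>) ?d (x, p) vs = \<dots>" .
  have b: "s.bound ?y = m p + b0" by (simp add: s.bound_def)
  have fl: "s.shadow = flat" by (rule ext) (simp add: s.shadow_def flat_def prod_eq_iff)
  show ?thesis
    using s.slice_integral_homotopy[OF sm Omega_local_alternating[OF \<omega> d] y, of vs]
    unfolding 1 2 b fl local_form_step[OF c p m(2)[OF p]] local_form_step[OF c p J(2)] .
qed

lemma fibre_integrand_integrable:
  assumes \<omega>: "\<omega> \<in> Omega prod_J k" and c: "c \<in> A" "x \<in> fst c" and p: "p \<in> Q"
  shows "(\<lambda>s. \<omega> (prod_chart Q c) (x, step p s) vs) integrable_on {0..m p + b0}"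
proof -
  interpret s: slices "chart_image (prod_chart Q c)" J "(0, e)" "\<lambda>z. l (snd z)" "\<lambda>z. m (snd z)" b0
    by (rule chart_slices[OF c(1)])
  have "(snd c x, p) \<in> chart_image (prod_chart Q c)" using c p by (simp add: chart_image_prod)
  from s.slice_integrable[OF s.smooth_on_continuous[OF Omega_smooth[OF \<omega> prod_chart_in[OF c(1)]]] this m(2)[OF p]]
  show ?thesis
    by (rule integrable_eq) (use local_form_step[OF c p] segment_J[OF m(2)[OF p]] in auto)
qed

lemma fibre_integral_add:
  assumes "\<alpha> \<in> Omega prod_J j" "\<beta> \<in> Omega prod_J k"
  shows "fibre_integral (\<alpha> + \<beta>) = fibre_integral \<alpha> + fibre_integral \<beta>"
proof (intro ext)
  fix d q vs
  show "fibre_integral (\<alpha> + \<beta>) d q vs = (fibre_integral \<alpha> + fibre_integral \<beta>) d q vs"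
  proof (cases "d \<in> prod_J \<and> q \<in> fst d")
    case True
    then obtain c where c: "c \<in> A" "d = prod_chart Q c" by (auto elim: prod_atlasE)
    then obtain x p where q: "q = (x, p)" "x \<in> fst c" "p \<in> Q" using True by auto
    show ?thesis
      unfolding c(2) q(1) plus_fun_apply fibre_integral_eq[OF c(1) q(2,3)]
      by (intro integral_add fibre_integrand_integrable[OF assms(1) c(1) q(2,3)] fibre_integrand_integrable[OF assms(2) c(1) q(2,3)])
  qed (simp add: fibre_integral_outside)
qed

lemma fibre_integral_scale: "fibre_integral (r *\<^sub>R \<alpha>) = r *\<^sub>R fibre_integral \<alpha>"
  by (auto simp: fibre_integral_def line_integral_def scaleR_fun_def fun_eq_iff)

text \<open>Removing components along \<open>e\<close> changes the value by terms with
  \<open>(0, e)\<close> in a slot, on which the integral vanishes.\<close>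

lemma fibre_integral_flat:
  assumes \<omega>: "\<omega> \<in> Omega prod_J (Suc k)" and d: "d \<in> prod_J" "q \<in> fst d"
  shows "fibre_integral \<omega> d q (map flat vs) = fibre_integral \<omega> d q vs"
proof -
  have fl: "flat = (\<lambda>v. v - l (snd v) *\<^sub>R (0, e))" by (rule ext) (simp add: flat_def prod_eq_iff)
  show ?thesis
    unfolding fl alternating_shadow[OF Omega_alternating[OF fibre_integral_Omega[OF \<omega>] d]]
    by (simp add: fibre_integral_Cons[OF \<omega>])
qed

end

text \<open>With \<open>l\<close> as upper limit the integral ends at \<open>p\<close> itself, and
  the boundary term restores exactly the components along \<open>e\<close> that \<open>flat\<close>
  removes.\<close>

lemma fibre_integral_homotopy_id:
  assumes "product_slices A Q J e l l 0"
    and \<omega>: "\<omega> \<in> Omega (prod_atlas A Q) k" and c: "c \<in> A" "x \<in> fst c" and p: "p \<in> Q"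
  shows "ext_deriv (prod_atlas A Q) (product_slices.fibre_integral A Q e l l 0 \<omega>) (prod_chart Q c) (x, p) vs
      + product_slices.fibre_integral A Q e l l 0 (ext_deriv (prod_atlas A Q) \<omega>) (prod_chart Q c) (x, p) vs
    = \<omega> (prod_chart Q c) (x, p) vs
      - \<omega> (prod_chart Q c) (x, product_slices.step e l p 0) (map (product_slices.flat e l) vs)"
proof -
  interpret product_slices A Q J e l l 0 by fact
  have fl: "flat = (\<lambda>v. v - l (snd v) *\<^sub>R (0, e))" by (rule ext) (simp add: flat_def prod_eq_iff)
  have st: "step p (l p + 0) = p" by (simp add: step_def)
  have "(x, p) \<in> fst (prod_chart Q c)" using c p by simp
  note sh = alternating_shadow[OF Omega_alternating[OF \<omega> prod_chart_in[OF c(1)] this], of "\<lambda>v. l (snd v)" "(0, e)" vs]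
  show ?thesis
    unfolding fibre_integral_homotopy[OF \<omega> c p] st by (simp only: fl sh)
qed

lemma finite_span_real: "\<exists>F::real set. finite F \<and> span F = UNIV"
proof -
  have "r \<in> span {1}" for r :: real using span_scale[OF span_base, of "1::real" "{1}" r] by simp
  then show ?thesis by (intro exI[of _ "{1}"]) auto
qed

section \<open>Wedge products with a 1-form\<close>

text \<open>The 1-form is moved from the right to the left of a form of degree \<open>k\<close>; the
  left product has the Leibniz rule.\<close>

lemma wedge1_dwedge:
  assumes "\<alpha> \<in> Omega B k"
  shows "wedge1 \<alpha> l = (- 1) ^ k *\<^sub>R dwedge l \<alpha>"
proof (intro ext)
  fix c q vs
  show "wedge1 \<alpha> l c q vs = ((- 1) ^ k *\<^sub>R dwedge l \<alpha>) c q vs"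
  proof (cases "length vs = Suc k")
    case True
    have "(- 1) ^ (length vs - 1 - i) * \<alpha> c q (del_nth i vs) * l (vs ! i)
        = (- 1) ^ k * ((- 1) ^ i * (l (vs ! i) * \<alpha> c q (del_nth i vs)))" if "i < length vs" for i
    proof -
      have "(- 1::real) ^ (k - i) = (- 1) ^ (k + i)"
        using that True by (auto simp: minus_one_power_iff)
      then show ?thesis using True by (simp add: power_add)
    qed
    then have "wedge1 \<alpha> l c q vs = (\<Sum>i<length vs. (- 1) ^ k * ((- 1) ^ i * (l (vs ! i) * \<alpha> c q (del_nth i vs))))"
      unfolding wedge1_def by (intro sum.cong) simp_all
    then show ?thesis
      by (simp add: dwedge_def altsum_def scaleR_fun_def sum_distrib_left)
  next
    case False
    have "\<alpha> c q (del_nth i vs) = 0" if "i < length vs" for i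
      using that False by (intro Omega_length[OF assms]) (simp add: length_del_nth)
    then show ?thesis by (simp add: wedge1_def dwedge_def altsum_def scaleR_fun_def)
  qed
qed

lemma dwedge_add: "dwedge l (\<alpha> + \<beta>) = dwedge l \<alpha> + dwedge l \<beta>"
  by (auto simp: dwedge_def fun_eq_iff distrib_left altsum_add)

lemma dwedge_scale: "dwedge l (r *\<^sub>R \<alpha>) = r *\<^sub>R dwedge l \<alpha>"
  by (auto simp: dwedge_def fun_eq_iff scaleR_fun_def mult.left_commute altsum_cmult)

lemma wedge1_add: "wedge1 (\<alpha> + \<beta>) l = wedge1 \<alpha> l + wedge1 \<beta> l"
  by (auto simp: wedge1_def fun_eq_iff sum.distrib algebra_simps)

lemma wedge1_scale: "wedge1 (r *\<^sub>R \<alpha>) l = r *\<^sub>R wedge1 \<alpha> l"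
  by (auto simp: wedge1_def fun_eq_iff scaleR_fun_def sum_distrib_left algebra_simps)

lemma fmul_add: "fmul f (\<alpha> + \<beta>) = fmul f \<alpha> + fmul f \<beta>"
  by (auto simp: fmul_def fun_eq_iff algebra_simps)

lemma fmul_scale: "fmul f (r *\<^sub>R \<alpha>) = r *\<^sub>R fmul f \<alpha>"
  by (auto simp: fmul_def fun_eq_iff scaleR_fun_def)

lemma form_scaleR [simp]: "(r *\<^sub>R \<omega>) c q vs = r * (\<omega> c q vs :: real)"
  by (simp add: scaleR_fun_def)

section \<open>Forms with values in cellular cochains\<close>

text \<open>With truncated subtraction the 1-cell component has degree \<open>k - 1\<close> for
  every \<open>k\<close>; the last clause records that for \<open>k = 0\<close> it is the zero
  form.\<close>

lemma OmegaCD: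
  assumes "\<eta> \<in> OmegaC A k"
  shows "\<eta> Eps0 \<in> Omega A k" "\<eta> Eps1 \<in> Omega A k" "\<eta> Eps01 \<in> Omega A (k - 1)" "k = 0 \<Longrightarrow> \<eta> Eps01 = 0"
proof -
  have *: "if cell_dim e \<le> k then \<eta> e \<in> Omega A (k - cell_dim e) else \<eta> e = 0" for e
    using assms by (simp add: OmegaC_def)
  show "\<eta> Eps0 \<in> Omega A k" "\<eta> Eps1 \<in> Omega A k" using *[of Eps0] *[of Eps1] by simp_all
  show "\<eta> Eps01 \<in> Omega A (k - 1)" using *[of Eps01] Omega_0 by (cases k) auto
  show "k = 0 \<Longrightarrow> \<eta> Eps01 = 0" using *[of Eps01] by simp
qed

lemma OmegaCI:
  assumes "\<eta> Eps0 \<in> Omega A k" "\<eta> Eps1 \<in> Omega A k" "\<eta> Eps01 \<in> Omega A (k - 1)" "k = 0 \<Longrightarrow> \<eta> Eps01 = 0"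
  shows "\<eta> \<in> OmegaC A k"
  unfolding OmegaC_def mem_Collect_eq
proof
  fix e show "if cell_dim e \<le> k then \<eta> e \<in> Omega A (k - cell_dim e) else \<eta> e = 0"
    using assms by (cases e; cases k) auto
qed

lemma cform_eqI:
  "\<eta> Eps0 = \<zeta> Eps0 \<Longrightarrow> \<eta> Eps1 = \<zeta> Eps1 \<Longrightarrow> \<eta> Eps01 = \<zeta> Eps01 \<Longrightarrow> \<eta> = (\<zeta> :: ('m, 'w) cform)"
  by (rule ext) (metis cell.exhaust)

text \<open>The sign in \<open>dC\<close> is read off from the number of vectors. The vertex
  components live on lists of length \<open>k\<close>, so it may be replaced by
  \<open>(-1) ^ k\<close>.\<close>

lemma dC_eq:
  assumes "\<eta> \<in> OmegaC A k"
  shows "dC A \<eta> Eps0 = ext_deriv A (\<eta> Eps0)" "dC A \<eta> Eps1 = ext_deriv A (\<eta> Eps1)"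
    "dC A \<eta> Eps01 = ext_deriv A (\<eta> Eps01) + (- 1) ^ k *\<^sub>R (\<eta> Eps1 - \<eta> Eps0)"
proof -
  show "dC A \<eta> Eps0 = ext_deriv A (\<eta> Eps0)" "dC A \<eta> Eps1 = ext_deriv A (\<eta> Eps1)"
    by (auto simp: dC_def fun_eq_iff)
  have "(- 1) ^ length vs * \<eta> Eps1 c q vs - (- 1) ^ length vs * \<eta> Eps0 c q vs =
      (- 1) ^ k * (\<eta> Eps1 c q vs - \<eta> Eps0 c q vs)" for c q vs
  proof (cases "length vs = k")
    case False
    then show ?thesis by (simp add: Omega_length[OF OmegaCD(1)[OF assms]] Omega_length[OF OmegaCD(2)[OF assms]])
  qed (simp add: algebra_simps)
  then show "dC A \<eta> Eps01 = ext_deriv A (\<eta> Eps01) + (- 1) ^ k *\<^sub>R (\<eta> Eps1 - \<eta> Eps0)"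
    by (auto simp: dC_def fun_eq_iff)
qed

lemma cform_scaleR [simp]: "(r *\<^sub>R \<eta>) e = r *\<^sub>R (\<eta> e :: ('m, 'w) form)"
  by (simp add: scaleR_fun_def)

context corner_atlas
begin

lemma ext_deriv_0: "ext_deriv B 0 = 0"
  using ext_deriv_scale[OF Omega_0, of 0] by simp

lemma dC_OmegaC:
  assumes \<eta>: "\<eta> \<in> OmegaC B k"
  shows "dC B \<eta> \<in> OmegaC B (Suc k)"
proof (rule OmegaCI)
  note D = OmegaCD[OF \<eta>]
  show "dC B \<eta> Eps0 \<in> Omega B (Suc k)" "dC B \<eta> Eps1 \<in> Omega B (Suc k)"
    unfolding dC_eq[OF \<eta>] by (intro ext_deriv_Omega D)+
  have "ext_deriv B (\<eta> Eps01) \<in> Omega B k"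
  proof (cases k)
    case 0
    then show ?thesis using D(4) ext_deriv_0 Omega_0 by simp
  next
    case (Suc j)
    then show ?thesis using ext_deriv_Omega[OF D(3)] by simp
  qed
  then show "dC B \<eta> Eps01 \<in> Omega B (Suc k - 1)"
    unfolding dC_eq[OF \<eta>] using D by (simp add: Omega_add Omega_scale Omega_diff)
qed simp

text \<open>The vertex terms of the two applications carry the signs \<open>(-1) ^ k\<close> and
  \<open>(-1) ^ Suc k\<close> and cancel.\<close>

lemma dC_dC:
  assumes \<eta>: "\<eta> \<in> OmegaC B k"
  shows "dC B (dC B \<eta>) = 0"
proof -
  note D = OmegaCD[OF \<eta>]
  note d\<eta> = dC_OmegaC[OF \<eta>]
  have "ext_deriv B (dC B \<eta> Eps01) = ext_deriv B (ext_deriv B (\<eta> Eps01)) + (- 1) ^ k *\<^sub>R (ext_deriv B (\<eta> Eps1) - ext_deriv B (\<eta> Eps0))"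
    unfolding dC_eq[OF \<eta>] ext_deriv_add[OF ext_deriv_Omega[OF D(3)] Omega_scale[OF Omega_diff[OF D(2,1)]]]
      ext_deriv_scale[OF Omega_diff[OF D(2,1)]] ext_deriv_diff[OF D(2,1)] ..
  then have "dC B (dC B \<eta>) Eps01 = 0"
    unfolding dC_eq(3)[OF d\<eta>] by (simp add: dC_eq(1,2)[OF \<eta>] ext_deriv_ext_deriv[OF D(3)])
  then show ?thesis
    by (intro cform_eqI) (simp_all add: dC_eq(1,2)[OF d\<eta>] dC_eq(1,2)[OF \<eta>] ext_deriv_ext_deriv[OF D(1)] ext_deriv_ext_deriv[OF D(2)])
qed

lemma subspace_OmegaC: "subspace (OmegaC B k)"
proof (rule subspaceI)
  show "0 \<in> OmegaC B k" by (rule OmegaCI) (simp_all add: Omega_0)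
  show "\<eta> + \<zeta> \<in> OmegaC B k" if "\<eta> \<in> OmegaC B k" "\<zeta> \<in> OmegaC B k" for \<eta> \<zeta>
    by (rule OmegaCI) (simp_all add: Omega_add OmegaCD[OF that(1)] OmegaCD[OF that(2)] del: One_nat_def)
  show "r *\<^sub>R \<eta> \<in> OmegaC B k" if "\<eta> \<in> OmegaC B k" for r \<eta>
    by (rule OmegaCI) (simp_all add: Omega_scale OmegaCD[OF that] del: One_nat_def)
qed

lemma cochain_complex_OmegaC: "cochain_complex (OmegaC B) (dC B)"
  unfolding cochain_complex_def linear_between_def
proof (intro allI conjI ballI subspace_OmegaC)
  show "dC B ` OmegaC B k \<subseteq> OmegaC B (Suc k)" for k using dC_OmegaC by blast
  show "dC B (\<eta> + \<zeta>) = dC B \<eta> + dC B \<zeta>" if \<eta>: "\<eta> \<in> OmegaC B k" and \<zeta>: "\<zeta> \<in> OmegaC B k" for k \<eta> \<zeta>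
  proof -
    note D = OmegaCD[OF \<eta>] and D' = OmegaCD[OF \<zeta>]
    note s = subspace_add[OF subspace_OmegaC \<eta> \<zeta>]
    show ?thesis
      by (rule cform_eqI)
        (simp_all add: dC_eq[OF s] dC_eq[OF \<eta>] dC_eq[OF \<zeta>] ext_deriv_add[OF D(1) D'(1)]
          ext_deriv_add[OF D(2) D'(2)] ext_deriv_add[OF D(3) D'(3)] scaleR_diff_right scaleR_add_right)
  qed
  show "dC B (r *\<^sub>R \<eta>) = r *\<^sub>R dC B \<eta>" if \<eta>: "\<eta> \<in> OmegaC B k" for k r \<eta>
  proof -
    note D = OmegaCD[OF \<eta>]
    note s = subspace_scale[OF subspace_OmegaC \<eta>]
    show ?thesis
      by (rule cform_eqI)
        (simp_all add: dC_eq[OF s] dC_eq[OF \<eta>] ext_deriv_scale[OF D(1)] ext_deriv_scale[OF D(2)]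
          ext_deriv_scale[OF D(3)] scaleR_diff_right scaleR_add_right mult.commute)
  qed
  show "dC B (dC B \<eta>) = 0" if "\<eta> \<in> OmegaC B k" for k \<eta> by (rule dC_dC[OF that])
qed

end

section \<open>The retraction\<close>

locale collar_setup = A: corner_atlas A
  for A :: "('a, 'e::banach) atlas" + fixes I :: "real set"
  assumes I: "radial_interval I"
begin

abbreviation U01 :: "real set" where "U01 \<equiv> {0..1}"

lemma corner_factor_U01: "corner_factor U01"
  by (rule corner_factor.intro[OF finite_span_real corner_set_interval[of _ 0 1]]) (auto simp: is_interval_cc)

lemma I_props: "is_interval I" "0 \<in> I" "I \<subseteq> {0..}"
  using I by (auto simp: radial_interval_def)

lemma corner_factor_I: "corner_factor I"
proof -
  obtain b where "b \<in> I" "b \<noteq> 0" using I unfolding radial_interval_def by blast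
  then show ?thesis
    using corner_factor.intro[OF finite_span_real corner_set_interval[OF I_props(1,2), of b]] I_props(2) by auto
qed

lemma corner_factor_C: "corner_factor (I \<times> U01)"
proof (rule corner_factor.intro)
  obtain F :: "real set" where F: "finite F" "span F = UNIV" using finite_span_real by blast
  show "\<exists>F::(real \<times> real) set. finite F \<and> span F = UNIV"
    by (rule exI, rule conjI[OF finite_span_prod[OF F F]])
  show "corner_set (I \<times> U01)"
    by (rule corner_set_Times[OF corner_factor.corner_factor[OF corner_factor_I] corner_factor.corner_factor[OF corner_factor_U01]])
  show "I \<times> U01 \<noteq> {}" using I_props(2) by auto
qed

sublocale E: corner_product A U01 by (rule corner_product.intro[OF A.corner_atlas_axioms corner_factor_U01])
sublocale F: corner_product A I by (rule corner_product.intro[OF A.corner_atlas_axioms corner_factor_I])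
sublocale C: corner_product A "I \<times> U01" by (rule corner_product.intro[OF A.corner_atlas_axioms corner_factor_C])

sublocale H: product_slices A "I \<times> U01" I "(1, 0)" fst fst 0
  by (rule product_slices.intro[OF C.corner_product_axioms], rule product_slices_axioms.intro)
    (use I_props in \<open>auto simp: bounded_linear_fst\<close>)

sublocale K: product_slices A U01 U01 1 "\<lambda>t. t" "\<lambda>t. t" 0
  by (rule product_slices.intro[OF E.corner_product_axioms], rule product_slices_axioms.intro)
    (auto simp: is_interval_cc bounded_linear_ident)

sublocale M: product_slices A U01 U01 1 "\<lambda>t. t" "\<lambda>t. 0" 1
  by (rule product_slices.intro[OF E.corner_product_axioms], rule product_slices_axioms.intro)
    (auto simp: is_interval_cc bounded_linear_ident bounded_linear_zero)

abbreviation "EA \<equiv> prod_atlas A U01"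
abbreviation "FA \<equiv> prod_atlas A I"
abbreviation "CA \<equiv> prod_atlas A (I \<times> U01)"
abbreviation "cE \<equiv> prod_chart U01"
abbreviation "cF \<equiv> prod_chart I"
abbreviation "cC \<equiv> prod_chart (I \<times> U01)"

lemma atlases: "E_atlas A = EA" "F_atlas A I = FA" "collar A I = CA"
  by (simp_all add: E_atlas_def F_atlas_def collar_def)

section \<open>Restrictions and projections of the collar in charts\<close>

lemma map_jE: "affine_chart_map EA CA (\<lambda>(x, \<theta>). (x, 0, \<theta>))
    (\<lambda>d. cC (E.base_chart d)) (\<lambda>z. (fst z, (0, snd z))) (0, (0, 0))"
  by (rule affine_chart_map_prod[OF E.corner_product_axioms C.corner_product_axioms])
    (use I_props in \<open>auto intro: bounded_linear_Pair bounded_linear_zero bounded_linear_ident\<close>)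

lemma map_piE: "affine_chart_map CA EA (\<lambda>(x, r, \<theta>). (x, \<theta>))
    (\<lambda>d. cE (C.base_chart d)) (\<lambda>z. (fst z, snd (snd z))) (0, 0)"
  by (rule affine_chart_map_prod[OF C.corner_product_axioms E.corner_product_axioms bounded_linear_snd]) auto

lemma map_jF: "i \<in> U01 \<Longrightarrow> affine_chart_map FA CA (\<lambda>(x, r). (x, r, i))
    (\<lambda>d. cC (F.base_chart d)) (\<lambda>z. (fst z, (snd z, 0))) (0, (0, i))"
  by (rule affine_chart_map_prod[OF F.corner_product_axioms C.corner_product_axioms])
    (auto intro: bounded_linear_Pair bounded_linear_zero bounded_linear_ident)

lemma map_jEF: "i \<in> U01 \<Longrightarrow> affine_chart_map A CA (\<lambda>x. (x, 0, i)) cC (\<lambda>v. (v, 0)) (0, (0, i))"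
  by (rule C.affine_chart_map_section) (use I_props in auto)

lemmas map_p = E.affine_chart_map_fst
lemmas map_s = E.affine_chart_map_section

lemma jE_eq:
  assumes "\<omega> \<in> Omega CA k" "c \<in> A" "x \<in> fst c" "\<theta> \<in> U01"
  shows "jE A I \<omega> (cE c) (x, \<theta>) vs = \<omega> (cC c) (x, 0, \<theta>) (map (\<lambda>z. (fst z, 0, snd z)) vs)"
  using affine_chart_map.pullback_eq[OF map_jE assms(1) prod_chart_in[OF assms(2)], of "(x, \<theta>)" vs] assms(2-)
  by (simp add: jE_def atlases E.base_chart)

lemma piE_eq:
  assumes "\<omega> \<in> Omega EA k" "c \<in> A" "x \<in> fst c" "r \<in> I" "\<theta> \<in> U01"
  shows "piE A I \<omega> (cC c) (x, r, \<theta>) vs = \<omega> (cE c) (x, \<theta>) (map (\<lambda>z. (fst z, snd (snd z))) vs)"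
  using affine_chart_map.pullback_eq[OF map_piE assms(1) prod_chart_in[OF assms(2)], of "(x, r, \<theta>)" vs] assms(2-)
  by (simp add: piE_def atlases C.base_chart)

lemma jF_eq:
  assumes "i \<in> U01" "\<omega> \<in> Omega CA k" "c \<in> A" "x \<in> fst c" "r \<in> I"
  shows "jF A I i \<omega> (cF c) (x, r) vs = \<omega> (cC c) (x, r, i) (map (\<lambda>z. (fst z, snd z, 0)) vs)"
  using affine_chart_map.pullback_eq[OF map_jF[OF assms(1)] assms(2) prod_chart_in[OF assms(3)], of "(x, r)" vs] assms(3-)
  by (simp add: jF_def atlases F.base_chart)

lemma jEF_eq:
  assumes "i \<in> U01" "\<omega> \<in> Omega CA k" "c \<in> A" "x \<in> fst c"
  shows "jEF A I i \<omega> c x vs = \<omega> (cC c) (x, 0, i) (map (\<lambda>v. (v, 0)) vs)"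
  using affine_chart_map.pullback_eq[OF map_jEF[OF assms(1)] assms(2-), of vs]
  by (simp add: jEF_def atlases)

lemma p_eq:
  assumes "\<eta> \<in> Omega A k" "c \<in> A" "x \<in> fst c" "\<theta> \<in> U01"
  shows "pullback EA A fst \<eta> (cE c) (x, \<theta>) vs = \<eta> c x (map fst vs)"
  using affine_chart_map.pullback_eq[OF map_p assms(1) prod_chart_in[OF assms(2)], of "(x, \<theta>)" vs] assms(2-)
  by (simp add: E.base_chart)

lemma s_eq:
  assumes "t \<in> U01" "\<omega> \<in> Omega EA k" "c \<in> A" "x \<in> fst c"
  shows "pullback A EA (\<lambda>x. (x, t)) \<omega> c x vs = \<omega> (cE c) (x, t) (map (\<lambda>v. (v, 0)) vs)"
  by (rule affine_chart_map.pullback_eq[OF map_s[OF assms(1)] assms(2-)])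

lemma jE_Omega: "\<omega> \<in> Omega CA k \<Longrightarrow> jE A I \<omega> \<in> Omega EA k"
  unfolding jE_def atlases by (rule affine_chart_map.pullback_Omega[OF map_jE])

lemma piE_Omega: "\<omega> \<in> Omega EA k \<Longrightarrow> piE A I \<omega> \<in> Omega CA k"
  unfolding piE_def atlases by (rule affine_chart_map.pullback_Omega[OF map_piE])

lemma p_Omega: "\<eta> \<in> Omega A k \<Longrightarrow> pullback EA A fst \<eta> \<in> Omega EA k"
  by (rule affine_chart_map.pullback_Omega[OF map_p])

lemma s_Omega: "t \<in> U01 \<Longrightarrow> \<omega> \<in> Omega EA k \<Longrightarrow> pullback A EA (\<lambda>x. (x, t)) \<omega> \<in> Omega A k"
  by (rule affine_chart_map.pullback_Omega[OF map_s])

lemma jE_d: "\<omega> \<in> Omega CA k \<Longrightarrow> jE A I (ext_deriv CA \<omega>) = ext_deriv EA (jE A I \<omega>)"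
  unfolding jE_def atlases by (rule affine_chart_map.pullback_ext_deriv[OF map_jE])

lemma piE_d: "\<omega> \<in> Omega EA k \<Longrightarrow> piE A I (ext_deriv EA \<omega>) = ext_deriv CA (piE A I \<omega>)"
  unfolding piE_def atlases by (rule affine_chart_map.pullback_ext_deriv[OF map_piE])

lemma p_d: "\<eta> \<in> Omega A k \<Longrightarrow> pullback EA A fst (ext_deriv A \<eta>) = ext_deriv EA (pullback EA A fst \<eta>)"
  by (rule affine_chart_map.pullback_ext_deriv[OF map_p])

lemma s_d: "t \<in> U01 \<Longrightarrow> \<omega> \<in> Omega EA k \<Longrightarrow>
    pullback A EA (\<lambda>x. (x, t)) (ext_deriv EA \<omega>) = ext_deriv A (pullback A EA (\<lambda>x. (x, t)) \<omega>)"
  by (rule affine_chart_map.pullback_ext_deriv[OF map_s])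

lemma jE_add: "jE A I (\<alpha> + \<beta>) = jE A I \<alpha> + jE A I \<beta>"
  and jE_scale: "jE A I (r *\<^sub>R \<alpha>) = r *\<^sub>R jE A I \<alpha>"
  and piE_add: "piE A I (\<gamma> + \<delta>) = piE A I \<gamma> + piE A I \<delta>"
  and piE_diff: "piE A I (\<gamma> - \<delta>) = piE A I \<gamma> - piE A I \<delta>"
  and piE_scale: "piE A I (r *\<^sub>R \<gamma>) = r *\<^sub>R piE A I \<gamma>"
  by (simp_all add: jE_def piE_def pullback_add pullback_scale pullback_diff)

lemma piE_0: "piE A I 0 = 0"
  using piE_scale[of 0 0] by simp

lemma jE_piE:
  assumes "\<omega> \<in> Omega EA k"
  shows "jE A I (piE A I \<omega>) = \<omega>"
  by (rule E.prod_eqI[OF jE_Omega[OF piE_Omega[OF assms]] assms])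
    (simp add: jE_eq[OF piE_Omega[OF assms]] piE_eq[OF assms] I_props o_def)

lemma H_step: "H.step (r, \<theta>) s = (s, \<theta>)"
  by (simp add: H.step_def)

lemma K_step: "K.step \<theta> s = s" "M.step \<theta> s = s"
  by (simp_all add: K.step_def M.step_def)

lemma flat_eq: "K.flat = (\<lambda>z. (fst z, 0))" "M.flat = (\<lambda>z. (fst z, 0))" "H.flat = (\<lambda>z. (fst z, 0, snd (snd z)))"
  by (auto simp: K.flat_def M.flat_def H.flat_def fun_eq_iff prod_eq_iff)

lemma H_radial_eq: "H_radial A I = H.fibre_integral"
proof -
  have "(\<lambda>(x::'a, r::real, \<theta>::real) s. (x, s, \<theta>)) = (\<lambda>q s. (fst q, H.step (snd q) s))"
    by (auto simp: fun_eq_iff H.step_def)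
  moreover have "(\<lambda>(x::'a, r::real, \<theta>::real). r) = (\<lambda>q. fst (snd q) + 0)" by auto
  ultimately show ?thesis by (simp only: H_radial_def H.fibre_integral_def atlases)
qed

section \<open>Dupont's homotopy on \<open>E\<close>\<close>

definition \<kappa> :: "('a \<times> real, 'e \<times> real) form \<Rightarrow> ('a \<times> real, 'e \<times> real) form"
  where "\<kappa> \<omega> = K.fibre_integral \<omega> - fmul snd (M.fibre_integral \<omega>)"

lemma kappa_E_eq: "kappa_E A = \<kappa>"
proof (rule ext)
  fix \<omega>
  have 1: "(\<lambda>(x::'a, \<theta>::real) u. (x, u)) = (\<lambda>q s. (fst q, K.step (snd q) s))"
    "(\<lambda>(x::'a, \<theta>::real) u. (x, u)) = (\<lambda>q s. (fst q, M.step (snd q) s))"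
    by (auto simp: fun_eq_iff K_step)
  have 2: "(\<lambda>(x::'a, \<theta>::real). \<theta>) = (\<lambda>q. snd q + 0)" "(\<lambda>(x::'a, \<theta>::real). 1) = (\<lambda>q. 0 + (1::real))"
    by auto
  have "K.fibre_integral \<omega> = line_integral EA (\<lambda>(x, \<theta>) u. (x, u)) (0, 1) (\<lambda>(x, \<theta>). \<theta>) \<omega>"
    by (simp only: K.fibre_integral_def 1(1) 2(1))
  moreover have "M.fibre_integral \<omega> = line_integral EA (\<lambda>(x, \<theta>) u. (x, u)) (0, 1) (\<lambda>(x, \<theta>). 1) \<omega>"
    by (simp only: M.fibre_integral_def 1(2) 2(2))
  moreover have "(\<lambda>(x::'a, \<theta>::real). \<theta>) = snd" by auto
  ultimately show "kappa_E A \<omega> = \<kappa> \<omega>" by (simp only: kappa_E_def \<kappa>_def atlases)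
qed

lemma E_snd: "d \<in> EA \<Longrightarrow> q \<in> fst d \<Longrightarrow> snd q = snd (snd d q) + 0"
  by (auto elim!: prod_atlasE)

lemma E_one_minus: "d \<in> EA \<Longrightarrow> q \<in> fst d \<Longrightarrow> (case q of (x, \<theta>) \<Rightarrow> 1 - \<theta>) = - snd (snd d q) + 1"
  by (auto elim!: prod_atlasE)

lemma bounded_linear_minus_snd: "bounded_linear (\<lambda>z::'e \<times> real. - snd z)"
  by (rule bounded_linear_minus[OF bounded_linear_snd])

lemma fmul_snd_Omega: "\<alpha> \<in> Omega EA k \<Longrightarrow> fmul snd \<alpha> \<in> Omega EA k"
  by (rule E.prod.fmul_Omega[OF bounded_linear_snd E_snd])

lemma d_fmul_snd: "\<alpha> \<in> Omega EA k \<Longrightarrow> ext_deriv EA (fmul snd \<alpha>) = fmul snd (ext_deriv EA \<alpha>) + dwedge snd \<alpha>"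
  by (rule E.prod.ext_deriv_fmul[OF bounded_linear_snd E_snd])

lemma dwedge_snd_Omega: "\<alpha> \<in> Omega EA k \<Longrightarrow> dwedge snd \<alpha> \<in> Omega EA (Suc k)"
  by (rule E.prod.dwedge_Omega[OF bounded_linear_snd E_snd])

lemma d_dwedge_snd: "\<alpha> \<in> Omega EA k \<Longrightarrow> ext_deriv EA (dwedge snd \<alpha>) = - dwedge snd (ext_deriv EA \<alpha>)"
  by (rule E.prod.ext_deriv_dwedge[OF bounded_linear_snd E_snd])

lemma fmul_one_minus_Omega: "\<alpha> \<in> Omega EA k \<Longrightarrow> fmul (\<lambda>(x, \<theta>). 1 - \<theta>) \<alpha> \<in> Omega EA k"
  by (rule E.prod.fmul_Omega[OF bounded_linear_minus_snd E_one_minus])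

lemma d_fmul_one_minus: "\<alpha> \<in> Omega EA k \<Longrightarrow> ext_deriv EA (fmul (\<lambda>(x, \<theta>). 1 - \<theta>) \<alpha>)
    = fmul (\<lambda>(x, \<theta>). 1 - \<theta>) (ext_deriv EA \<alpha>) + dwedge (\<lambda>z. - snd z) \<alpha>"
  by (rule E.prod.ext_deriv_fmul[OF bounded_linear_minus_snd E_one_minus])

text \<open>For \<open>k = 0\<close> the truncated degree \<open>k - 1\<close> is again 0, and the
  integral is the zero form, which has every degree.\<close>

lemma K_Omega: "\<omega> \<in> Omega EA k \<Longrightarrow> K.fibre_integral \<omega> \<in> Omega EA (k - 1)"
  and M_Omega: "\<omega> \<in> Omega EA k \<Longrightarrow> M.fibre_integral \<omega> \<in> Omega EA (k - 1)"
  and H_Omega: "\<omega>' \<in> Omega CA k \<Longrightarrow> H.fibre_integral \<omega>' \<in> Omega CA (k - 1)"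
  by (cases k; simp add: K.fibre_integral_0form M.fibre_integral_0form H.fibre_integral_0form Omega_0
      K.fibre_integral_Omega M.fibre_integral_Omega H.fibre_integral_Omega)+

lemma \<kappa>_Omega: "\<omega> \<in> Omega EA k \<Longrightarrow> \<kappa> \<omega> \<in> Omega EA (k - 1)"
  unfolding \<kappa>_def by (intro Omega_diff fmul_snd_Omega K_Omega M_Omega)

lemma \<kappa>_0form: "\<omega> \<in> Omega EA 0 \<Longrightarrow> \<kappa> \<omega> = 0"
  by (simp add: \<kappa>_def K.fibre_integral_0form M.fibre_integral_0form fmul_def fun_eq_iff)

lemma \<kappa>_add:
  assumes "\<alpha> \<in> Omega EA j" "\<beta> \<in> Omega EA k"
  shows "\<kappa> (\<alpha> + \<beta>) = \<kappa> \<alpha> + \<kappa> \<beta>"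
  by (simp add: \<kappa>_def K.fibre_integral_add[OF assms] M.fibre_integral_add[OF assms] fmul_add)

lemma \<kappa>_scale: "\<kappa> (r *\<^sub>R \<alpha>) = r *\<^sub>R \<kappa> \<alpha>"
  by (simp add: \<kappa>_def K.fibre_integral_scale M.fibre_integral_scale fmul_scale scaleR_diff_right)

lemma K_eq:
  assumes "c \<in> A" "x \<in> fst c" "\<theta> \<in> U01"
  shows "K.fibre_integral \<omega> (cE c) (x, \<theta>) vs = integral {0..\<theta>} (\<lambda>s. \<omega> (cE c) (x, s) ((0, 1) # vs))"
    and "M.fibre_integral \<omega> (cE c) (x, \<theta>) vs = integral {0..1} (\<lambda>s. \<omega> (cE c) (x, s) ((0, 1) # vs))"
  using K.fibre_integral_eq[OF assms] M.fibre_integral_eq[OF assms] by (simp_all add: K_step)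

lemma \<kappa>_eq:
  assumes "c \<in> A" "x \<in> fst c" "\<theta> \<in> U01"
  shows "\<kappa> \<omega> (cE c) (x, \<theta>) vs = integral {0..\<theta>} (\<lambda>s. \<omega> (cE c) (x, s) ((0, 1) # vs))
    - \<theta> * integral {0..1} (\<lambda>s. \<omega> (cE c) (x, s) ((0, 1) # vs))"
  using K_eq[OF assms] by (simp add: \<kappa>_def fmul_def)

lemma \<kappa>_Cons: "\<omega> \<in> Omega EA k \<Longrightarrow> \<kappa> \<omega> d q ((0, 1) # vs) = 0"
  using K.fibre_integral_Cons M.fibre_integral_Cons by (simp add: \<kappa>_def fmul_def)

text \<open>At \<theta> = 0 the integral is over a point and the correction has the factor 0; at
  \<theta> = 1 the two integrals coincide. Hence the vertex components of \<open>R \<kappa>\<close>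
  vanish and only the radial homotopy is left on \<open>F0\<close> and \<open>F1\<close>.\<close>

lemma \<kappa>_ends: "c \<in> A \<Longrightarrow> x \<in> fst c \<Longrightarrow> i \<in> {0, 1} \<Longrightarrow> \<kappa> \<omega> (cE c) (x, i) vs = 0"
  using \<kappa>_eq[of c x i \<omega> vs] by auto

section \<open>The integration map\<close>

lemma R_E_simps: "R_E A \<omega> Eps0 = pullback A EA (\<lambda>x. (x, 0)) \<omega>" "R_E A \<omega> Eps1 = pullback A EA (\<lambda>x. (x, 1)) \<omega>"
  by (simp_all add: R_E_def atlases)

text \<open>Moving the angular vector from the last slot to the first, past \<open>k - 1\<close>
  vectors, gives the sign, since \<open>Suc k\<close> has the parity of \<open>k - 1\<close> for
  positive \<open>k\<close>. For lists of any other length both integrands vanish. The integral over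
  the whole interval is constant in \<theta>, so the section \<theta> = 0 reads it off.\<close>

lemma R_E_Eps01:
  assumes \<omega>: "\<omega> \<in> Omega EA k"
  shows "R_E A \<omega> Eps01 = (- 1) ^ Suc k *\<^sub>R pullback A EA (\<lambda>x. (x, 0)) (M.fibre_integral \<omega>)"
proof (intro ext)
  fix c x vs
  show "R_E A \<omega> Eps01 c x vs = ((- 1) ^ Suc k *\<^sub>R pullback A EA (\<lambda>x. (x, 0)) (M.fibre_integral \<omega>)) c x vs"
  proof (cases "c \<in> A \<and> x \<in> fst c")
    case True
    then have c: "c \<in> A" "x \<in> fst c" by auto
    let ?vs = "map (\<lambda>v. (v, 0)) vs"
    have eq: "\<omega> (cE c) (x, \<theta>) (?vs @ [(0, 1)]) = (- 1) ^ Suc k * \<omega> (cE c) (x, \<theta>) ((0, 1) # ?vs)" if "\<theta> \<in> U01" for \<theta>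
    proof (cases "k = Suc (length vs)")
      case True
      have "alternating_multilinear (\<omega> (cE c) (x, \<theta>))"
        using c that by (intro Omega_alternating[OF \<omega> prod_chart_in]) auto
      from alternating_move[OF this, of ?vs "(0, 1)" "[]"] show ?thesis using True by simp
    next
      case False
      then show ?thesis by (simp add: Omega_length[OF \<omega>])
    qed
    have "R_E A \<omega> Eps01 c x vs = integral {0..1} (\<lambda>\<theta>. \<omega> (cE c) (x, \<theta>) (?vs @ [(0, 1)]))"
      using c by (simp add: R_E_def)
    also have "\<dots> = integral {0..1} (\<lambda>\<theta>. (- 1) ^ Suc k * \<omega> (cE c) (x, \<theta>) ((0, 1) # ?vs))"
      by (rule Henstock_Kurzweil_Integration.integral_cong) (rule eq)
    also have "\<dots> = (- 1) ^ Suc k * M.fibre_integral \<omega> (cE c) (x, 0) ?vs"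
      by (simp add: K_eq(2)[OF c])
    finally show ?thesis using s_eq[OF _ M_Omega[OF \<omega>] c, of 0] by simp
  next
    case False
    then show ?thesis by (auto simp: R_E_def pullback_def)
  qed
qed

lemma R_E_OmegaC:
  assumes \<omega>: "\<omega> \<in> Omega EA k"
  shows "R_E A \<omega> \<in> OmegaC A k"
proof (rule OmegaCI)
  show "R_E A \<omega> Eps01 = 0" if "k = 0"
  proof -
    have "\<omega> \<in> Omega EA 0" using \<omega> that by simp
    then show ?thesis
      unfolding R_E_Eps01[OF \<omega>] by (simp add: M.fibre_integral_0form) (simp add: pullback_def fun_eq_iff)
  qed
  show "R_E A \<omega> Eps01 \<in> Omega A (k - 1)"
    unfolding R_E_Eps01[OF \<omega>] by (intro Omega_scale s_Omega M_Omega \<omega>) simp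
qed (auto simp: R_E_simps intro: s_Omega \<omega>)

lemma M_homotopy:
  assumes \<omega>: "\<omega> \<in> Omega EA k" and c: "c \<in> A" "x \<in> fst c" "\<theta> \<in> U01"
  shows "ext_deriv EA (M.fibre_integral \<omega>) (cE c) (x, \<theta>) vs + M.fibre_integral (ext_deriv EA \<omega>) (cE c) (x, \<theta>) vs
    = \<omega> (cE c) (x, 1) (map (\<lambda>z. (fst z, 0)) vs) - \<omega> (cE c) (x, 0) (map (\<lambda>z. (fst z, 0)) vs)"
  using M.fibre_integral_homotopy[OF assms] by (simp add: K_step flat_eq)

text \<open>Stokes' theorem along the interval: the boundary terms of \<open>M_homotopy\<close> at 1
  and 0 are the two coefficients of the cellular differential.\<close>

lemma R_E_d:
  assumes \<omega>: "\<omega> \<in> Omega EA k"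
  shows "R_E A (ext_deriv EA \<omega>) = dC A (R_E A \<omega>)"
proof (rule cform_eqI)
  note R = R_E_OmegaC[OF \<omega>] and d\<omega> = E.prod.ext_deriv_Omega[OF \<omega>]
  show "R_E A (ext_deriv EA \<omega>) Eps0 = dC A (R_E A \<omega>) Eps0" "R_E A (ext_deriv EA \<omega>) Eps1 = dC A (R_E A \<omega>) Eps1"
    by (simp_all add: dC_eq[OF R] R_E_simps s_d[OF _ \<omega>])
  let ?s = "\<lambda>t. pullback A EA (\<lambda>x. (x, t))"
  have t: "0 \<in> U01" "1 \<in> U01" by simp_all
  have "?s 0 (M.fibre_integral (ext_deriv EA \<omega>)) c x vs =
      ?s 1 \<omega> c x vs - ?s 0 \<omega> c x vs - ?s 0 (ext_deriv EA (M.fibre_integral \<omega>)) c x vs" for c x vs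
  proof (cases "c \<in> A \<and> x \<in> fst c")
    case True
    then have c: "c \<in> A" "x \<in> fst c" by auto
    show ?thesis
      using M_homotopy[OF \<omega> c t(1), of "map (\<lambda>v. (v, 0)) vs"]
      by (simp add: s_eq[OF t(1) M_Omega[OF d\<omega>] c] s_eq[OF t(1) \<omega> c] s_eq[OF t(2) \<omega> c]
          s_eq[OF t(1) E.prod.ext_deriv_Omega[OF M_Omega[OF \<omega>]] c] o_def)
  qed (auto simp: pullback_def)
  then have "?s 0 (M.fibre_integral (ext_deriv EA \<omega>)) = ?s 1 \<omega> - ?s 0 \<omega> - ext_deriv A (?s 0 (M.fibre_integral \<omega>))"
    by (simp add: fun_eq_iff s_d[OF t(1) M_Omega[OF \<omega>]])
  then show "R_E A (ext_deriv EA \<omega>) Eps01 = dC A (R_E A \<omega>) Eps01"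
    by (simp add: dC_eq[OF R] R_E_Eps01[OF \<omega>] R_E_Eps01[OF d\<omega>] R_E_simps
        A.ext_deriv_scale[OF s_Omega[OF t(1) M_Omega[OF \<omega>]]] scaleR_diff_right
        del: scaleR_minus_left) (simp add: algebra_simps)
qed

lemma R_E_add:
  assumes "\<alpha> \<in> Omega EA k" "\<beta> \<in> Omega EA k"
  shows "R_E A (\<alpha> + \<beta>) = R_E A \<alpha> + R_E A \<beta>"
  by (rule cform_eqI) (simp_all add: R_E_simps R_E_Eps01[OF Omega_add[OF assms]] R_E_Eps01[OF assms(1)]
      R_E_Eps01[OF assms(2)] pullback_add M.fibre_integral_add[OF assms] scaleR_add_right)

lemma R_E_scale:
  assumes "\<alpha> \<in> Omega EA k"
  shows "R_E A (r *\<^sub>R \<alpha>) = r *\<^sub>R R_E A \<alpha>"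
  by (rule cform_eqI) (simp_all add: R_E_simps R_E_Eps01[OF Omega_scale[OF assms]] R_E_Eps01[OF assms]
      pullback_scale M.fibre_integral_scale)

section \<open>The Whitney map\<close>

abbreviation p :: "('a, 'e) form \<Rightarrow> ('a \<times> real, 'e \<times> real) form" where "p \<equiv> pullback EA A fst"

abbreviation one_minus :: "'a \<times> real \<Rightarrow> real" where "one_minus \<equiv> (\<lambda>(x, \<theta>). 1 - \<theta>)"

text \<open>The 1-cell component has degree \<open>k - 1\<close>, so moving \<open>d\<theta>\<close>
  to its left gives \<open>(-1) ^ (k - 1)\<close>, written with \<open>Suc k\<close> to avoid
  truncated subtraction. For \<open>k = 0\<close> the component is 0.\<close>

lemma W_E_eq:
  assumes \<eta>: "\<eta> \<in> OmegaC A k"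
  shows "W_E A \<eta> = fmul one_minus (p (\<eta> Eps0)) + fmul snd (p (\<eta> Eps1)) + (- 1) ^ Suc k *\<^sub>R dwedge snd (p (\<eta> Eps01))"
proof -
  have "wedge1 (p (\<eta> Eps01)) snd = (- 1) ^ Suc k *\<^sub>R dwedge snd (p (\<eta> Eps01))"
  proof (cases k)
    case 0
    then have "\<eta> Eps01 = 0" using OmegaCD[OF \<eta>] by simp
    then have "p (\<eta> Eps01) = 0" using pullback_scale[of EA A fst 0 0] by simp
    then show ?thesis by (simp add: wedge1_def dwedge_def fun_eq_iff)
  next
    case (Suc j)
    then have "p (\<eta> Eps01) \<in> Omega EA j" using p_Omega[OF OmegaCD(3)[OF \<eta>]] by simp
    from wedge1_dwedge[OF this] show ?thesis using Suc by simp
  qed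
  moreover have "(\<lambda>(x::'a, \<theta>::real). \<theta>) = snd" by auto
  ultimately show ?thesis by (simp add: W_E_def atlases Let_def)
qed

lemma W_E_Omega:
  assumes \<eta>: "\<eta> \<in> OmegaC A k"
  shows "W_E A \<eta> \<in> Omega EA k"
proof -
  note D = OmegaCD[OF \<eta>]
  have "dwedge snd (p (\<eta> Eps01)) \<in> Omega EA k"
  proof (cases k)
    case 0
    then have "p (\<eta> Eps01) = 0" using pullback_scale[of EA A fst 0 0] D(4) by simp
    moreover have "dwedge snd (0 :: ('a \<times> real, 'e \<times> real) form) = 0" by (simp add: dwedge_def fun_eq_iff)
    ultimately show ?thesis by (simp add: Omega_0)
  next
    case (Suc j)
    then show ?thesis using dwedge_snd_Omega[OF p_Omega[OF D(3)]] by simp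
  qed
  then show ?thesis
    unfolding W_E_eq[OF \<eta>]
    by (intro Omega_add Omega_scale fmul_snd_Omega fmul_one_minus_Omega p_Omega D)
qed

text \<open>The derivatives of the factors \<open>1 - \<theta>\<close> and \<theta> contribute
  \<open>d\<theta>\<close> wedge the difference of the vertex components, which is the Whitney form
  of the cellular part of \<open>dC\<close>.\<close>

lemma W_E_d:
  assumes \<eta>: "\<eta> \<in> OmegaC A k"
  shows "W_E A (dC A \<eta>) = ext_deriv EA (W_E A \<eta>)"
proof -
  note D = OmegaCD[OF \<eta>] and dO = E.prod.ext_deriv_Omega
  note P = p_Omega[OF D(1)] p_Omega[OF D(2)] p_Omega[OF D(3)]
  let ?\<alpha> = "p (\<eta> Eps0)" and ?\<beta> = "p (\<eta> Eps1)" and ?\<gamma> = "p (\<eta> Eps01)" and ?d = "ext_deriv EA"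
  have dw: "dwedge (\<lambda>z. - snd z) ?\<alpha> = - dwedge snd ?\<alpha>"
    by (auto simp: dwedge_def fun_eq_iff altsum_minus)
  have "?d (W_E A \<eta>) = ?d (fmul one_minus ?\<alpha>) + ?d (fmul snd ?\<beta>) + (- 1) ^ Suc k *\<^sub>R ?d (dwedge snd ?\<gamma>)"
    unfolding W_E_eq[OF \<eta>]
      E.prod.ext_deriv_add[OF Omega_add[OF fmul_one_minus_Omega[OF P(1)] fmul_snd_Omega[OF P(2)]] Omega_scale[OF dwedge_snd_Omega[OF P(3)]]]
      E.prod.ext_deriv_add[OF fmul_one_minus_Omega[OF P(1)] fmul_snd_Omega[OF P(2)]]
      E.prod.ext_deriv_scale[OF dwedge_snd_Omega[OF P(3)]] ..
  also have "\<dots> = (fmul one_minus (?d ?\<alpha>) - dwedge snd ?\<alpha>) + (fmul snd (?d ?\<beta>) + dwedge snd ?\<beta>)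
      + (- 1) ^ k *\<^sub>R dwedge snd (?d ?\<gamma>)"
    by (simp add: d_fmul_one_minus[OF P(1)] d_fmul_snd[OF P(2)] d_dwedge_snd[OF P(3)] dw)
  finally have 1: "?d (W_E A \<eta>) = \<dots>" .
  have "p (dC A \<eta> Eps01) = ?d ?\<gamma> + (- 1) ^ k *\<^sub>R (?\<beta> - ?\<alpha>)"
    unfolding dC_eq(3)[OF \<eta>] pullback_add pullback_scale pullback_diff p_d[OF D(3)] ..
  then have "dwedge snd (p (dC A \<eta> Eps01)) = dwedge snd (?d ?\<gamma>) + (- 1) ^ k *\<^sub>R (dwedge snd ?\<beta> - dwedge snd ?\<alpha>)"
    using dwedge_add[of snd "?\<beta> - ?\<alpha>" ?\<alpha>] by (simp add: dwedge_add dwedge_scale)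
  then show ?thesis
    unfolding 1 W_E_eq[OF A.dC_OmegaC[OF \<eta>]]
    by (simp add: dC_eq(1,2)[OF \<eta>] p_d[OF D(1)] p_d[OF D(2)] scaleR_add_right)
qed

lemma W_E_chart:
  assumes \<eta>: "\<eta> \<in> OmegaC A k" and c: "c \<in> A" "x \<in> fst c" "\<theta> \<in> U01"
  shows "W_E A \<eta> (cE c) (x, \<theta>) vs = (1 - \<theta>) * \<eta> Eps0 c x (map fst vs) + \<theta> * \<eta> Eps1 c x (map fst vs)
    + (- 1) ^ Suc k * altsum (\<lambda>v ws. snd v * \<eta> Eps01 c x (map fst ws)) vs"
  unfolding W_E_eq[OF \<eta>] using OmegaCD[OF \<eta>] c
  by (simp add: fmul_def dwedge_def p_eq)

text \<open>Only the 1-cell component survives contraction: the vertex components are pulled back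
  from \<Gamma>, where the angular vector becomes 0. The result is constant in \<theta>.\<close>

lemma W_E_Cons:
  assumes \<eta>: "\<eta> \<in> OmegaC A k" and c: "c \<in> A" "x \<in> fst c" "\<theta> \<in> U01"
  shows "W_E A \<eta> (cE c) (x, \<theta>) ((0, 1) # vs) = (- 1) ^ Suc k * \<eta> Eps01 c x (map fst vs)"
proof -
  have "\<eta> e c x (0 # us) = 0" for e us
    using linear_0[OF alternating_linear_Cons[OF Omega_alternating[OF OmegaCD(1)[OF \<eta>] c(1,2)]]]
      linear_0[OF alternating_linear_Cons[OF Omega_alternating[OF OmegaCD(2)[OF \<eta>] c(1,2)]]]
      linear_0[OF alternating_linear_Cons[OF Omega_alternating[OF OmegaCD(3)[OF \<eta>] c(1,2)]]]
    by (cases e) simp_all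
  then show ?thesis by (simp add: W_E_chart[OF assms] altsum_Cons)
qed

lemma W_E_add:
  assumes "\<eta> \<in> OmegaC A k" "\<zeta> \<in> OmegaC A k"
  shows "W_E A (\<eta> + \<zeta>) = W_E A \<eta> + W_E A \<zeta>"
  by (simp add: W_E_def Let_def pullback_add fmul_add wedge1_add)

lemma W_E_scale: "W_E A (r *\<^sub>R \<eta>) = r *\<^sub>R W_E A \<eta>"
  by (simp add: W_E_def Let_def pullback_scale fmul_scale wedge1_scale scaleR_add_right)

lemma R_E_W_E:
  assumes \<eta>: "\<eta> \<in> OmegaC A k"
  shows "R_E A (W_E A \<eta>) = \<eta>"
proof (rule cform_eqI)
  note D = OmegaCD[OF \<eta>] and W = W_E_Omega[OF \<eta>]
  note R = OmegaCD[OF R_E_OmegaC[OF W]]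
  \<comment> \<open>Vectors tangent to a section of constant \<theta> have no angular
    component.\<close>
  have z: "altsum (\<lambda>v ws. snd v * \<eta> Eps01 c x (map fst ws)) (map (\<lambda>v. (v, 0)) vs) = 0" for c x vs
    by (simp add: altsum_map)
  show "R_E A (W_E A \<eta>) Eps0 = \<eta> Eps0"
  proof (rule Omega_eqI[OF R(1) D(1)])
    fix c x vs assume c: "c \<in> A" "x \<in> fst c"
    show "R_E A (W_E A \<eta>) Eps0 c x vs = \<eta> Eps0 c x vs"
      using s_eq[OF _ W c, of 0] by (simp add: R_E_simps W_E_chart[OF \<eta> c] z o_def)
  qed
  show "R_E A (W_E A \<eta>) Eps1 = \<eta> Eps1"
  proof (rule Omega_eqI[OF R(2) D(2)])
    fix c x vs assume c: "c \<in> A" "x \<in> fst c"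
    show "R_E A (W_E A \<eta>) Eps1 c x vs = \<eta> Eps1 c x vs"
      using s_eq[OF _ W c, of 1] by (simp add: R_E_simps W_E_chart[OF \<eta> c] z o_def)
  qed
  show "R_E A (W_E A \<eta>) Eps01 = \<eta> Eps01"
  proof (rule Omega_eqI[OF R(3) D(3)])
    fix c x vs assume c: "c \<in> A" "x \<in> fst c"
    have "integral {0..1} (\<lambda>s. W_E A \<eta> (cE c) (x, s) ((0, 1) # map (\<lambda>v. (v, 0)) vs))
       = integral {0..1::real} (\<lambda>s. (- 1) ^ Suc k * \<eta> Eps01 c x vs)"
      by (rule Henstock_Kurzweil_Integration.integral_cong) (simp add: W_E_Cons[OF \<eta> c] o_def)
    then show "R_E A (W_E A \<eta>) Eps01 c x vs = \<eta> Eps01 c x vs"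
      using s_eq[OF _ M_Omega[OF W] c, of 0] by (simp add: R_E_Eps01[OF W] K_eq(2)[OF c])
  qed
qed

section \<open>Side conditions and homotopy formula on \<open>E\<close>\<close>

text \<open>Contracted Whitney forms are constant in \<theta>, so the integral up to \<theta> is
  \<theta> times the integral up to 1.\<close>

lemma \<kappa>_W_E:
  assumes \<eta>: "\<eta> \<in> OmegaC A k"
  shows "\<kappa> (W_E A \<eta>) = 0"
proof (rule E.prod_eqI[OF \<kappa>_Omega[OF W_E_Omega[OF \<eta>]] Omega_0])
  fix c x \<theta> vs assume c: "c \<in> A" "x \<in> fst c" "\<theta> \<in> U01"
  have "integral {0..t} (\<lambda>s. W_E A \<eta> (cE c) (x, s) ((0, 1) # vs))
     = integral {0..t} (\<lambda>s. (- 1) ^ Suc k * \<eta> Eps01 c x (map fst vs))" if "t \<in> U01" for t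
    by (rule Henstock_Kurzweil_Integration.integral_cong) (use that W_E_Cons[OF \<eta> c(1,2)] in auto)
  then show "\<kappa> (W_E A \<eta>) (cE c) (x, \<theta>) vs = 0 (cE c) (x, \<theta>) vs"
    using c by (simp add: \<kappa>_eq[OF c])
qed

text \<open>The vertex components vanish by \<open>\<kappa>_ends\<close>, the 1-cell component
  because the angular vector is inserted twice.\<close>

lemma R_E_\<kappa>:
  assumes \<omega>: "\<omega> \<in> Omega EA k"
  shows "R_E A (\<kappa> \<omega>) = 0"
proof -
  note k = \<kappa>_Omega[OF \<omega>]
  note R = OmegaCD[OF R_E_OmegaC[OF k]]
  have e0: "R_E A (\<kappa> \<omega>) Eps0 = 0"
  proof (rule Omega_eqI[OF R(1) Omega_0])
    fix c x vs assume "c \<in> A" "x \<in> fst c"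
    then show "R_E A (\<kappa> \<omega>) Eps0 c x vs = 0 c x vs" using s_eq[OF _ k, of 0 c x] by (simp add: R_E_simps \<kappa>_ends)
  qed
  have e1: "R_E A (\<kappa> \<omega>) Eps1 = 0"
  proof (rule Omega_eqI[OF R(2) Omega_0])
    fix c x vs assume "c \<in> A" "x \<in> fst c"
    then show "R_E A (\<kappa> \<omega>) Eps1 c x vs = 0 c x vs" using s_eq[OF _ k, of 1 c x] by (simp add: R_E_simps \<kappa>_ends)
  qed
  have e01: "R_E A (\<kappa> \<omega>) Eps01 = 0"
  proof (rule Omega_eqI[OF R(3) Omega_0])
    fix c x vs assume c: "c \<in> A" "x \<in> fst c"
    then show "R_E A (\<kappa> \<omega>) Eps01 c x vs = 0 c x vs"
      using s_eq[OF _ M_Omega[OF k] c, of 0] by (simp add: R_E_Eps01[OF k] K_eq(2) \<kappa>_Cons[OF \<omega>])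
  qed
  show ?thesis by (rule cform_eqI) (simp_all add: e0 e1 e01)
qed

lemma \<kappa>_\<kappa>:
  assumes \<omega>: "\<omega> \<in> Omega EA k"
  shows "\<kappa> (\<kappa> \<omega>) = 0"
  by (rule E.prod_eqI[OF \<kappa>_Omega[OF \<kappa>_Omega[OF \<omega>]] Omega_0]) (simp add: \<kappa>_eq \<kappa>_Cons[OF \<omega>])

text \<open>The integral up to \<theta> contributes \<omega> minus its flattened value at 0. The
  correction contributes \<theta> times the difference of the flattened end values and, by the
  Leibniz rule, \<open>d\<theta>\<close> wedge \<open>M \<omega>\<close>. The end values combine to
  the affine interpolation of the vertex components, and the last term is the Whitney form of the
  1-cell component, as the signs in \<open>R_E\<close> and \<open>W_E\<close> cancel.\<close>

lemma \<kappa>_homotopy: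
  assumes \<omega>: "\<omega> \<in> Omega EA k"
  shows "ext_deriv EA (\<kappa> \<omega>) + \<kappa> (ext_deriv EA \<omega>) = \<omega> - W_E A (R_E A \<omega>)"
proof -
  let ?d = "ext_deriv EA"
  note d\<omega> = E.prod.ext_deriv_Omega[OF \<omega>] and R = R_E_OmegaC[OF \<omega>]
  have d\<kappa>: "?d (\<kappa> \<omega>) = ?d (K.fibre_integral \<omega>) - (fmul snd (?d (M.fibre_integral \<omega>)) + dwedge snd (M.fibre_integral \<omega>))"
    unfolding \<kappa>_def E.prod.ext_deriv_diff[OF K_Omega[OF \<omega>] fmul_snd_Omega[OF M_Omega[OF \<omega>]]] d_fmul_snd[OF M_Omega[OF \<omega>]] ..
  have main: "(?d (\<kappa> \<omega>) + \<kappa> (?d \<omega>)) (cE c) (x, \<theta>) vs = (\<omega> - W_E A (R_E A \<omega>)) (cE c) (x, \<theta>) vs"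
    if c: "c \<in> A" "x \<in> fst c" and \<theta>: "\<theta> \<in> U01" for c x \<theta> vs
  proof -
    let ?f = "map (\<lambda>z::'e \<times> real. (fst z, 0::real))"
    have t: "0 \<in> U01" "1 \<in> U01" by simp_all
    have K: "?d (K.fibre_integral \<omega>) (cE c) (x, \<theta>) vs + K.fibre_integral (?d \<omega>) (cE c) (x, \<theta>) vs
        = \<omega> (cE c) (x, \<theta>) vs - \<omega> (cE c) (x, 0) (?f vs)"
      using fibre_integral_homotopy_id[OF K.product_slices_axioms \<omega> c \<theta>] by (simp add: K_step flat_eq)
    \<comment> \<open>\<open>M \<omega>\<close> depends neither on \<theta> nor on angular
      components of its arguments, so restricting it to \<theta> = 0 and pulling it back recovers
      it.\<close>
    have M: "M.fibre_integral \<omega> (cE c) (x, 0) (?f ws) = M.fibre_integral \<omega> (cE c) (x, \<theta>) ws" for ws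
    proof -
      have "M.fibre_integral \<omega> (cE c) (x, 0) (?f ws) = M.fibre_integral \<omega> (cE c) (x, \<theta>) (?f ws)"
        by (simp add: K_eq(2)[OF c t(1)] K_eq(2)[OF c \<theta>])
      also have "\<dots> = M.fibre_integral \<omega> (cE c) (x, \<theta>) ws"
      proof (cases k)
        case 0
        then show ?thesis using M.fibre_integral_0form \<omega> by simp
      next
        case (Suc j)
        then show ?thesis
          using M.fibre_integral_flat[OF _ prod_chart_in[OF c(1)], of \<omega> j "(x, \<theta>)" ws] \<omega> c \<theta> by (simp add: flat_eq)
      qed
      finally show ?thesis .
    qed
    have R01: "R_E A \<omega> Eps01 c x (map fst ws) = (- 1) ^ Suc k * M.fibre_integral \<omega> (cE c) (x, \<theta>) ws" for ws
      unfolding R_E_Eps01[OF \<omega>] form_scaleR s_eq[OF t(1) M_Omega[OF \<omega>] c] using M[of ws] by (simp add: o_def)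
    have R0: "R_E A \<omega> Eps0 c x (map fst vs) = \<omega> (cE c) (x, 0) (?f vs)"
      "R_E A \<omega> Eps1 c x (map fst vs) = \<omega> (cE c) (x, 1) (?f vs)"
      by (simp_all add: R_E_simps s_eq[OF t(1) \<omega> c] s_eq[OF t(2) \<omega> c] o_def)
    have WR: "W_E A (R_E A \<omega>) (cE c) (x, \<theta>) vs = (1 - \<theta>) * \<omega> (cE c) (x, 0) (?f vs) + \<theta> * \<omega> (cE c) (x, 1) (?f vs)
        + dwedge snd (M.fibre_integral \<omega>) (cE c) (x, \<theta>) vs"
    proof -
      have "altsum (\<lambda>v ws. snd v * R_E A \<omega> Eps01 c x (map fst ws)) vs
          = (- 1) ^ Suc k * dwedge snd (M.fibre_integral \<omega>) (cE c) (x, \<theta>) vs"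
        unfolding R01 dwedge_def altsum_cmult[symmetric] by (simp add: mult.left_commute)
      then show ?thesis unfolding W_E_chart[OF R c \<theta>] R0 by simp
    qed
    have "(?d (\<kappa> \<omega>) + \<kappa> (?d \<omega>)) (cE c) (x, \<theta>) vs =
       (?d (K.fibre_integral \<omega>) (cE c) (x, \<theta>) vs + K.fibre_integral (?d \<omega>) (cE c) (x, \<theta>) vs)
       - \<theta> * (?d (M.fibre_integral \<omega>) (cE c) (x, \<theta>) vs + M.fibre_integral (?d \<omega>) (cE c) (x, \<theta>) vs)
       - dwedge snd (M.fibre_integral \<omega>) (cE c) (x, \<theta>) vs"
      unfolding d\<kappa> by (simp add: \<kappa>_def fmul_def algebra_simps)
    then show ?thesis
      unfolding K M_homotopy[OF \<omega> c \<theta>] by (simp add: WR algebra_simps)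
  qed
  \<comment> \<open>In degree 0 truncated subtraction would place
    \<open>d (\<kappa> \<omega>)\<close> in degree 1; it is 0 there.\<close>
  have mem: "?d (\<kappa> \<omega>) + \<kappa> (?d \<omega>) \<in> Omega EA k"
  proof (cases k)
    case 0
    then have "?d (\<kappa> \<omega>) = 0" using \<kappa>_0form \<omega> E.prod.ext_deriv_0 by simp
    then show ?thesis using \<kappa>_Omega[OF d\<omega>] by simp
  next
    case (Suc j)
    then show ?thesis
      using E.prod.ext_deriv_Omega[OF \<kappa>_Omega[OF \<omega>]] \<kappa>_Omega[OF d\<omega>] by (simp add: Omega_add)
  qed
  show ?thesis by (rule E.prod_eqI[OF mem Omega_diff[OF \<omega> W_E_Omega[OF R]] main])
qed

section \<open>The radial homotopy\<close>

lemma H_eq: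
  assumes "c \<in> A" "x \<in> fst c" "r \<in> I" "\<theta> \<in> U01"
  shows "H.fibre_integral \<omega> (cC c) (x, r, \<theta>) vs = integral {0..r} (\<lambda>s. \<omega> (cC c) (x, s, \<theta>) ((0, 1, 0) # vs))"
  using H.fibre_integral_eq[OF assms(1,2), of "(r, \<theta>)"] assms(3,4) by (simp add: H_step)

text \<open>The lower boundary term of \<open>fibre_integral_homotopy_id\<close> is the value at
  \<open>r = 0\<close> with radial components removed, which is restriction to \<open>E\<close>
  followed by pullback along the projection.\<close>

lemma H_homotopy:
  assumes \<omega>: "\<omega> \<in> Omega CA k"
  shows "ext_deriv CA (H.fibre_integral \<omega>) + H.fibre_integral (ext_deriv CA \<omega>) = \<omega> - piE A I (jE A I \<omega>)"
proof -
  let ?d = "ext_deriv CA"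
  note d\<omega> = C.prod.ext_deriv_Omega[OF \<omega>]
  have mem: "?d (H.fibre_integral \<omega>) + H.fibre_integral (?d \<omega>) \<in> Omega CA k"
  proof (cases k)
    case 0
    then have "?d (H.fibre_integral \<omega>) = 0" using H.fibre_integral_0form \<omega> C.prod.ext_deriv_0 by simp
    then show ?thesis using H_Omega[OF d\<omega>] by simp
  next
    case (Suc j)
    then show ?thesis
      using C.prod.ext_deriv_Omega[OF H_Omega[OF \<omega>]] H_Omega[OF d\<omega>] by (simp add: Omega_add)
  qed
  show ?thesis
  proof (rule C.prod_eqI[OF mem Omega_diff[OF \<omega> piE_Omega[OF jE_Omega[OF \<omega>]]]])
    fix c x q vs assume c: "c \<in> A" "x \<in> fst c" and q: "q \<in> I \<times> U01"
    then obtain r \<theta> where rt: "q = (r, \<theta>)" "r \<in> I" "\<theta> \<in> U01" by blast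
    show "(?d (H.fibre_integral \<omega>) + H.fibre_integral (?d \<omega>)) (cC c) (x, q) vs = (\<omega> - piE A I (jE A I \<omega>)) (cC c) (x, q) vs"
      using fibre_integral_homotopy_id[OF H.product_slices_axioms \<omega> c q, of vs] rt
      by (simp add: H_step flat_eq piE_eq[OF jE_Omega[OF \<omega>] c] jE_eq[OF \<omega> c] o_def)
  qed
qed

text \<open>The radial vector projects to 0 on \<open>E\<close>, so the contracted integrand has a
  zero slot.\<close>

lemma H_piE:
  assumes \<omega>: "\<omega> \<in> Omega EA k"
  shows "H.fibre_integral (piE A I \<omega>) = 0"
proof (rule C.prod_eqI[OF H_Omega[OF piE_Omega[OF \<omega>]] Omega_0])
  fix c x q vs assume c: "c \<in> A" "x \<in> fst c" and q: "q \<in> I \<times> U01"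
  then obtain r \<theta> where rt: "q = (r, \<theta>)" "r \<in> I" "\<theta> \<in> U01" by blast
  have "(x, \<theta>) \<in> fst (cE c)" using c rt by simp
  from linear_0[OF alternating_linear_Cons[OF Omega_alternating[OF \<omega> prod_chart_in[OF c(1)] this]]]
  have z: "\<omega> (cE c) (x, \<theta>) ((0, 0) # ws) = 0" for ws by (simp add: zero_prod_def)
  have "{0..r} \<subseteq> I" by (rule H.segment_J[OF rt(2)])
  then have "H.fibre_integral (piE A I \<omega>) (cC c) (x, r, \<theta>) vs = integral {0..r} (\<lambda>s. 0)"
    unfolding H_eq[OF c rt(2,3)]
    by (intro Henstock_Kurzweil_Integration.integral_cong) (auto simp: piE_eq[OF \<omega> c _ rt(3)] z)
  then show "H.fibre_integral (piE A I \<omega>) (cC c) (x, q) vs = 0 (cC c) (x, q) vs" by (simp add: rt(1))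
qed

lemma H_H:
  assumes \<omega>: "\<omega> \<in> Omega CA k"
  shows "H.fibre_integral (H.fibre_integral \<omega>) = 0"
proof (rule C.prod_eqI[OF H_Omega[OF H_Omega[OF \<omega>]] Omega_0])
  fix c x q vs assume c: "c \<in> A" "x \<in> fst c" and q: "q \<in> I \<times> U01"
  then obtain r \<theta> where "q = (r, \<theta>)" "r \<in> I" "\<theta> \<in> U01" by blast
  then show "H.fibre_integral (H.fibre_integral \<omega>) (cC c) (x, q) vs = 0 (cC c) (x, q) vs"
    using H.fibre_integral_Cons[OF \<omega>] by (simp add: H_eq[OF c])
qed

lemma jE_H:
  assumes \<omega>: "\<omega> \<in> Omega CA k"
  shows "jE A I (H.fibre_integral \<omega>) = 0"
  by (rule E.prod_eqI[OF jE_Omega[OF H_Omega[OF \<omega>]] Omega_0]) (simp add: jE_eq[OF H_Omega[OF \<omega>]] H_eq I_props)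

section \<open>The combined homotopy\<close>

definition h :: "('a \<times> real \<times> real, 'e \<times> real \<times> real) form \<Rightarrow> ('a \<times> real \<times> real, 'e \<times> real \<times> real) form"
  where "h \<omega> = H.fibre_integral \<omega> + piE A I (\<kappa> (jE A I \<omega>))"

lemma homotopy_map_eq: "homotopy_map A I = h"
  by (rule ext) (simp add: homotopy_map_def h_def H_radial_eq kappa_E_eq)

lemma h_Omega: "\<omega> \<in> Omega CA k \<Longrightarrow> h \<omega> \<in> Omega CA (k - 1)"
  unfolding h_def by (intro Omega_add H_Omega piE_Omega \<kappa>_Omega jE_Omega)

lemma h_0form: "\<omega> \<in> Omega CA 0 \<Longrightarrow> h \<omega> = 0"
  by (simp add: h_def H.fibre_integral_0form \<kappa>_0form[OF jE_Omega] piE_0)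

lemma jE_h:
  assumes \<omega>: "\<omega> \<in> Omega CA k"
  shows "jE A I (h \<omega>) = \<kappa> (jE A I \<omega>)"
  by (simp add: h_def jE_add jE_H[OF \<omega>] jE_piE[OF \<kappa>_Omega[OF jE_Omega[OF \<omega>]]])

lemma h_add:
  assumes "\<alpha> \<in> Omega CA k" "\<beta> \<in> Omega CA k"
  shows "h (\<alpha> + \<beta>) = h \<alpha> + h \<beta>"
  by (simp add: h_def H.fibre_integral_add[OF assms] jE_add \<kappa>_add[OF jE_Omega[OF assms(1)] jE_Omega[OF assms(2)]] piE_add)

lemma h_scale: "h (r *\<^sub>R \<alpha>) = r *\<^sub>R h \<alpha>"
  by (simp add: h_def H.fibre_integral_scale jE_scale \<kappa>_scale piE_scale scaleR_add_right)

lemma h_homotopy: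
  assumes \<omega>: "\<omega> \<in> Omega CA k"
  shows "ext_deriv CA (h \<omega>) + h (ext_deriv CA \<omega>) = \<omega> - piE A I (W_E A (R_E A (jE A I \<omega>)))"
proof -
  note j = jE_Omega[OF \<omega>] and kj = \<kappa>_Omega[OF jE_Omega[OF \<omega>]]
  have "ext_deriv CA (h \<omega>) + h (ext_deriv CA \<omega>)
    = (ext_deriv CA (H.fibre_integral \<omega>) + H.fibre_integral (ext_deriv CA \<omega>))
      + piE A I (ext_deriv EA (\<kappa> (jE A I \<omega>)) + \<kappa> (ext_deriv EA (jE A I \<omega>)))"
    by (simp add: h_def C.prod.ext_deriv_add[OF H_Omega[OF \<omega>] piE_Omega[OF kj]] jE_d[OF \<omega>] piE_d[OF kj] piE_add)
  also have "\<dots> = \<omega> - piE A I (W_E A (R_E A (jE A I \<omega>)))"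
    unfolding H_homotopy[OF \<omega>] \<kappa>_homotopy[OF j] piE_diff by simp
  finally show ?thesis .
qed

text \<open>\<open>H\<close> kills both summands of \<open>h \<omega>\<close>. The second summand of
  \<open>h\<close> sees \<open>h \<omega>\<close> only through its restriction
  \<open>\<kappa> (j \<omega>)\<close> to \<open>E\<close>, and \<kappa> squares to 0.\<close>

lemma h_h:
  assumes \<omega>: "\<omega> \<in> Omega CA k"
  shows "h (h \<omega>) = 0"
proof -
  note j = jE_Omega[OF \<omega>]
  have "H.fibre_integral (h \<omega>) = 0"
    unfolding h_def H.fibre_integral_add[OF H_Omega[OF \<omega>] piE_Omega[OF \<kappa>_Omega[OF j]]]
    by (simp add: H_H[OF \<omega>] H_piE[OF \<kappa>_Omega[OF j]])
  then show ?thesis unfolding h_def[of "h \<omega>"] jE_h[OF \<omega>] \<kappa>_\<kappa>[OF j] by (simp add: piE_0)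
qed

lemma incl_map_eq: "incl_map A I \<eta> = piE A I (W_E A \<eta>)"
  and proj_map_eq: "proj_map A I \<omega> = R_E A (jE A I \<omega>)"
  by (simp_all add: incl_map_def proj_map_def)

lemma retract:
  "special_deformation_retract (Omega CA) (ext_deriv CA) (OmegaC A) (dC A) (incl_map A I) (proj_map A I) h"
  unfolding special_deformation_retract_def
proof (intro conjI allI ballI C.prod.cochain_complex_Omega A.cochain_complex_OmegaC)
  show "cochain_map (OmegaC A) (dC A) (Omega CA) (ext_deriv CA) (incl_map A I)"
    unfolding cochain_map_def linear_between_def incl_map_eq
  proof (intro conjI allI ballI)
    show "(\<lambda>\<eta>. piE A I (W_E A \<eta>)) ` OmegaC A k \<subseteq> Omega CA k" for k
      by (intro image_subsetI piE_Omega W_E_Omega)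
  qed (simp_all add: incl_map_eq W_E_add piE_add W_E_scale piE_scale W_E_d piE_d[OF W_E_Omega])
  show "cochain_map (Omega CA) (ext_deriv CA) (OmegaC A) (dC A) (proj_map A I)"
    unfolding cochain_map_def linear_between_def proj_map_eq
  proof (intro conjI allI ballI)
    show "(\<lambda>\<omega>. R_E A (jE A I \<omega>)) ` Omega CA k \<subseteq> OmegaC A k" for k
      by (intro image_subsetI R_E_OmegaC jE_Omega)
  qed (simp_all add: jE_add R_E_add[OF jE_Omega jE_Omega] jE_scale R_E_scale[OF jE_Omega] jE_d R_E_d[OF jE_Omega])
  show "linear_between (Omega CA 0) {0} h"
    unfolding linear_between_def using h_0form h_add h_scale by auto
  show "linear_between (Omega CA (Suc k)) (Omega CA k) h" for k
    unfolding linear_between_def using h_Omega[of _ "Suc k"] h_add h_scale by auto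
  show "ext_deriv CA (h v) + h (ext_deriv CA v) = v - incl_map A I (proj_map A I v)" if "v \<in> Omega CA k" for k v
    unfolding incl_map_eq proj_map_eq by (rule h_homotopy[OF that])
  show "proj_map A I (incl_map A I \<eta>) = \<eta>" if "\<eta> \<in> OmegaC A k" for k \<eta>
    unfolding incl_map_eq proj_map_eq jE_piE[OF W_E_Omega[OF that]] by (rule R_E_W_E[OF that])
  show "h (h v) = 0" if "v \<in> Omega CA k" for k v by (rule h_h[OF that])
  show "h (incl_map A I \<eta>) = 0" if "\<eta> \<in> OmegaC A k" for k \<eta>
    unfolding h_def incl_map_eq H_piE[OF W_E_Omega[OF that]] jE_piE[OF W_E_Omega[OF that]] \<kappa>_W_E[OF that]
    by (simp add: piE_0)
  show "proj_map A I (h v) = 0" if "v \<in> Omega CA k" for k v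
    unfolding proj_map_eq jE_h[OF that] by (rule R_E_\<kappa>[OF jE_Omega[OF that]])
qed

text \<open>The summand with \<kappa> vanishes at both ends of the angular interval. The formula
  serves the faces and also the corners, where the integral runs over the single point 0.\<close>

lemma h_at_ends:
  assumes \<omega>: "\<omega> \<in> Omega CA k" and c: "c \<in> A" "x \<in> fst c" "r \<in> I" "i \<in> {0, 1}"
  shows "h \<omega> (cC c) (x, r, i) vs = integral {0..r} (\<lambda>s. \<omega> (cC c) (x, s, i) ((0, 1, 0) # vs))"
proof -
  have "i \<in> U01" using c(4) by auto
  then show ?thesis
    using \<kappa>_ends[OF c(1,2,4)] c by (simp add: h_def H_eq piE_eq[OF \<kappa>_Omega[OF jE_Omega[OF \<omega>]]])
qed

text \<open>The radial vector is tangent to \<open>F0\<close> and \<open>F1\<close>, so radial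
  contraction and integration commute with restriction to them.\<close>

lemma jF_h:
  assumes \<omega>: "\<omega> \<in> Omega CA k" and i: "i \<in> {0, 1}"
  shows "jF A I i (h \<omega>) = H_radial_F A I (jF A I i \<omega>)"
proof (intro ext)
  fix d q vs
  have i': "i \<in> U01" using i by auto
  show "jF A I i (h \<omega>) d q vs = H_radial_F A I (jF A I i \<omega>) d q vs"
  proof (cases "d \<in> FA \<and> q \<in> fst d")
    case True
    then obtain c where c: "c \<in> A" "d = cF c" by (auto elim: prod_atlasE)
    then obtain x r where q: "q = (x, r)" "x \<in> fst c" "r \<in> I" using True by auto
    have "{0..r} \<subseteq> I" by (rule H.segment_J[OF q(3)])
    then have "integral {0..r} (\<lambda>s. jF A I i \<omega> (cF c) (x, s) ((0, 1) # vs))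
      = integral {0..r} (\<lambda>s. \<omega> (cC c) (x, s, i) ((0, 1, 0) # map (\<lambda>z. (fst z, snd z, 0)) vs))"
      by (intro Henstock_Kurzweil_Integration.integral_cong) (auto simp: jF_eq[OF i' \<omega> c(1) q(2)])
    then show ?thesis
      using c q prod_chart_in[OF c(1), of I]
      by (simp add: H_radial_F_def line_integral_def atlases jF_eq[OF i' h_Omega[OF \<omega>]] h_at_ends[OF \<omega> _ _ _ i])
  next
    case False
    then show ?thesis by (auto simp: H_radial_F_def line_integral_def jF_def pullback_def atlases)
  qed
qed

lemma jEF_h:
  assumes \<omega>: "\<omega> \<in> Omega CA k" and i: "i \<in> {0, 1}"
  shows "jEF A I i (h \<omega>) = 0"
proof (intro ext)
  fix c x vs
  have i': "i \<in> U01" using i by auto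
  show "jEF A I i (h \<omega>) c x vs = 0 c x vs"
  proof (cases "c \<in> A \<and> x \<in> fst c")
    case True
    then show ?thesis by (simp add: jEF_eq[OF i' h_Omega[OF \<omega>]] h_at_ends[OF \<omega> _ _ I_props(2) i])
  next
    case False
    then show ?thesis by (auto simp: jEF_def pullback_def)
  qed
qed

end

theorem theorem16p5:
  fixes \<Gamma> :: "'a topology" and A :: "('a, 'e::banach) atlas" and I :: "real set"
  assumes "smooth_manifold \<Gamma> A" and "radial_interval I"
  shows "special_deformation_retract
      (Omega (collar A I)) (ext_deriv (collar A I)) (OmegaC A) (dC A)
      (incl_map A I) (proj_map A I) (homotopy_map A I) \<and>
    (\<forall>k. \<forall>\<omega>\<in>Omega (collar A I) k. jE A I (homotopy_map A I \<omega>) = kappa_E A (jE A I \<omega>)) \<and>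
    (\<forall>k. \<forall>\<omega>\<in>Omega (collar A I) k. \<forall>i\<in>{0, 1}.
      jF A I i (homotopy_map A I \<omega>) = H_radial_F A I (jF A I i \<omega>)) \<and>
    (\<forall>k. \<forall>\<omega>\<in>Omega (collar A I) k. \<forall>i\<in>{0, 1}. jEF A I i (homotopy_map A I \<omega>) = 0)"
proof -
  interpret collar_setup A I
    by (rule collar_setup.intro[OF corner_atlas_manifold[OF assms(1)] collar_setup_axioms.intro[OF assms(2)]])
  show ?thesis
    unfolding homotopy_map_eq kappa_E_eq atlases(3)
    by (intro conjI allI ballI retract jE_h jF_h jEF_h)
qed

end
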